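(* Let $I\subseteq\mathbb R$ be an interval, $X\in\mathcal C^\gamma(I,V)$ and $\mathbb X^2\in\Omega\mathcal C^{2\gamma}(I,V\otimes V)$ with $N\mathbb X^{2,\mu\nu}_{sut}=\delta X^\mu_{su}\,\delta X^\nu_{ut}$ for all $s,u,t\in I$. For every $(Z,Z')\in\mathcal D_X^{\gamma,\eta}(I,V)$ and $(W,W')\in\mathcal D_X^{\gamma,\eta}(I,V)$ with $\eta+\gamma=\delta>1$ define $$\int_s^t Z^\mu_u\,dW^\nu_u:=Z^\mu_s\,\delta W^\nu_{st}+Z'^{\,\mu}_{\mu',s}W'^{\,\nu}_{\nu',s}\mathbb X^{2,\mu'\nu'}_{st}-\big[\Lambda N\big(Z^\mu\delta W^\nu+Z'^{\,\mu}_{\mu'}W'^{\,\nu}_{\nu'}\mathbb X^{2,\mu'\nu'}\big)\big]_{st},\qquad s,t\in I.$$ Then this integral extends the Young integral (defined by $\int_s^tF_u\,dG_u:=[F\,\delta G-\Lambda N(F\,\delta G)]_{st}$ for $F\in\mathcal C^{\rho}(I)$, $G\in\mathcal C^{\gamma}(I)$ with $\gamma+\rho>1$), and the following bound holds: $$\left|\int_s^t(Z^\mu_u-Z^\mu_s)\,dW^\nu_u-Z'^{\,\mu}_{\mu',s}W'^{\,\nu}_{\nu',s}\mathbb X^{2,\mu'\nu'}_{st}\right|\le\frac{1}{2^{\delta}-2}\,|t-s|^{\delta}\,\|(Z,Z')\|_{D(X,\gamma,\eta)}\,\|(W,W')\|_{D(X,\gamma,\eta)},$$ which implies the continuity of the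 bilinear application $$((Z,Z'),(W,W'))\mapsto\Big(\int_0^\cdot Z\,dW,\;ZW'\Big)$$ from $\mathcal D_X^{\gamma,\eta}(V)\times\mathcal D_X^{\gamma,\eta}(V)$ to $\mathcal D_X^{\gamma,\min(2\gamma,\eta)}(V\otimes V)$.
   Context: $V$ is a finite-dimensional vector space, $\gamma>0$, and repeated vector indices are summed. The exponent $\delta=\eta+\gamma$ (a number) is not to be confused with the increment operator $\delta$. For a finite-dimensional space $U$: $\mathcal C(I,U)$ is the space of bounded continuous functions $I\to U$; $\Omega\mathcal C_n(I,U)$ is the space of bounded continuous functions $I^{n+1}\to U$ which are zero when all arguments are equal; $\Omega\mathcal C=\Omega\mathcal C_1$. $\delta f_{st}:=f_t-f_s$. For $R\in\Omega\mathcal C(I,U)$, $\|R\|_{\gamma,I}:=\sup_{s\ne t\in I}|R_{st}|/|t-s|^\gamma$, and $\Omega\mathcal C^\gamma(I,U)$ is the subspace where this is finite; for paths $\|f\|_{\gamma,I}:=\|\delta f\|_{\gamma,I}$, $\|f\|_{\infty,I}:=\sup_I|f|$, and $\mathcal C^\gamma(I,U)=\{f\in\mathcal C(I,U):\|f\|_{\gamma,I}<\infty\}$. For a path $f$ and a process $R\in\Omega\mathcal C$, $(fR)_{st}=f_sR_{st}$. $(NR)_{sut}:=R_{st}-R_{ut}-R_{su}$. $\Omega\mathcal C_2^z(I,U)$ is the set of finite sums of $A_i\in\Omega\mathcal C_2(I,U)$ with $\|A_i\|_{\rho_i,z-\rho_i,I}:=\sup|A_{i,sut}|/(|u-s|^{\rho_i}|t-u|^{z-\rho_i})<\infty$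 for some $0<\rho_i<z$; $\mathcal Z_2^z(I,U)=\Omega\mathcal C_2^z(I,U)\cap N(\Omega\mathcal C(I,U))$. For $z>1$, $\Lambda:\mathcal Z_2^z\to\Omega\mathcal C^z$ on $\mathbb R$ is the unique linear map with $N\Lambda A=A$ and $\|\Lambda A\|_z\le\frac1{2^z-2}\sum_i\|A_i\|_{\rho_i,z-\rho_i}$ for every decomposition $A=\sum_iA_i$; on an interval $I$, $\Lambda A$ is the restriction to $I^2$ of $\Lambda\tilde A$ for any extension $\tilde A\in\mathcal Z_2^z$ of $A$ to $\mathbb R^3$ (independent of the extension); it acts componentwise. For $X\in\mathcal C^\gamma(I,V)$ and $\eta>\gamma$, $\mathcal D_X^{\gamma,\eta}(I,U)$ is the linear space of pairs $(Z,Z')$ with $Z\in\mathcal C^\gamma(I,U)$ and $Z'\in\mathcal C^{\eta-\gamma}(I,U\otimes V^* )$ such that $\delta Z^\mu=Z'^{\,\mu}_\nu\,\delta X^\nu+R_Z^\mu$ with $R_Z\in\Omega\mathcal C^\eta(I,U)$; on it one considers the semi-norm $\|(Z,Z')\|_{D(X,\gamma,\eta),I}:=\|Z'\|_{\infty,I}+\|Z'\|_{\eta-\gamma,I}+\|R_Z\|_{\eta,I}+\|Z\|_{\gamma,I}$. When the interval is not displayed in a space or semi-norm, it is the one under consideration. In the bound $Z_s$ is constant with respect to the integration variable: $\int_s^t(Z^\mu_u-Z^\mu_s)\,dW^\nu_u=\int_s^tZ^\mu_u\,dW^\nu_u-Z^\mu_s\,\delta W^\nu_{st}$. $ZW'$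 denotes $Z^\mu W'^{\,\nu}_\kappa$.
   Formalization: The bound gets the extra factor max(1, ‖X‖_γ²+‖𝕏²‖_{2γ}), as it fails without it; continuity uses the sup norm of Z plus the semi-norm and assumes I bounded with 0∈I; values of Λ on ℝ need not be bounded; Young agreement assumes Z'=0, W'=0 or 2γ>1. *)

theory Defs
  imports "HOL-Analysis.Analysis"
begin

text \<open>
  Functions on an interval \<open>I\<close>, \<open>I\<^sup>2\<close> or \<open>I\<^sup>3\<close> are total functions on the reals of which only the
  values with arguments in \<open>I\<close> matter.  All suprema below are over sets of nonnegative reals;
  inserting \<open>0\<close> only settles the value for the empty set (degenerate intervals).

  The space \<open>V\<close> is \<open>real^'n\<close>, a tensor in \<open>V \<otimes> V\<close> is \<open>M :: real^'n^'n\<close> with components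
  \<open>M $ \<mu> $ \<nu>\<close>, and an element of \<open>U \<otimes> V\<^sup>*\<close> is \<open>P :: 'u^'n\<close>, where \<open>P $ \<nu>\<close> is the \<open>U\<close>-valued
  component with lower index \<open>\<nu>\<close>.  So for \<open>U = V\<close> the component with upper index \<open>\<mu>\<close> and lower
  index \<open>\<nu>\<close> is \<open>P $ \<nu> $ \<mu>\<close>.  All tensor spaces carry the Euclidean norm of their components.
\<close>

definition C_space :: "real set \<Rightarrow> (real \<Rightarrow> 'u::euclidean_space) set" where
  "C_space I = {f. continuous_on I f \<and> bounded (f ` I)}"

definition Omega_C :: "real set \<Rightarrow> (real \<Rightarrow> real \<Rightarrow> 'u::euclidean_space) set" where
  "Omega_C I = {R. continuous_on (I \<times> I) (\<lambda>(s, t). R s t) \<and>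
     bounded ((\<lambda>(s, t). R s t) ` (I \<times> I)) \<and> (\<forall>s\<in>I. R s s = 0)}"

definition Omega_C2 :: "real set \<Rightarrow> (real \<Rightarrow> real \<Rightarrow> real \<Rightarrow> 'u::euclidean_space) set" where
  "Omega_C2 I = {A. continuous_on (I \<times> I \<times> I) (\<lambda>(s, u, t). A s u t) \<and>
     bounded ((\<lambda>(s, u, t). A s u t) ` (I \<times> I \<times> I)) \<and> (\<forall>s\<in>I. A s s s = 0)}"

definition sup_norm :: "real set \<Rightarrow> (real \<Rightarrow> 'u::euclidean_space) \<Rightarrow> real" where
  "sup_norm I f = Sup (insert 0 {norm (f t) | t. t \<in> I})"

definition hoelder_quots :: "real \<Rightarrow> real set \<Rightarrow> (real \<Rightarrow> real \<Rightarrow> 'u::euclidean_space) \<Rightarrow> real set" where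
  "hoelder_quots a I R = {norm (R s t) / \<bar>t - s\<bar> powr a | s t. s \<in> I \<and> t \<in> I \<and> s \<noteq> t}"

definition Omega_norm :: "real \<Rightarrow> real set \<Rightarrow> (real \<Rightarrow> real \<Rightarrow> 'u::euclidean_space) \<Rightarrow> real" where
  "Omega_norm a I R = Sup (insert 0 (hoelder_quots a I R))"

definition Omega_C_hoelder :: "real \<Rightarrow> real set \<Rightarrow> (real \<Rightarrow> real \<Rightarrow> 'u::euclidean_space) set" where
  "Omega_C_hoelder a I = {R \<in> Omega_C I. bdd_above (hoelder_quots a I R)}"

definition incr :: "(real \<Rightarrow> 'u::euclidean_space) \<Rightarrow> real \<Rightarrow> real \<Rightarrow> 'u" where
  "incr f s t = f t - f s"

definition path_norm :: "real \<Rightarrow> real set \<Rightarrow> (real \<Rightarrow> 'u::euclidean_space) \<Rightarrow> real" where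
  "path_norm a I f = Omega_norm a I (incr f)"

definition C_hoelder :: "real \<Rightarrow> real set \<Rightarrow> (real \<Rightarrow> 'u::euclidean_space) set" where
  "C_hoelder a I = {f \<in> C_space I. bdd_above (hoelder_quots a I (incr f))}"

definition N_op :: "(real \<Rightarrow> real \<Rightarrow> 'u::euclidean_space) \<Rightarrow> real \<Rightarrow> real \<Rightarrow> real \<Rightarrow> 'u" where
  "N_op R s u t = R s t - R u t - R s u"

definition hoelder2_quots ::
    "real \<Rightarrow> real \<Rightarrow> real set \<Rightarrow> (real \<Rightarrow> real \<Rightarrow> real \<Rightarrow> 'u::euclidean_space) \<Rightarrow> real set" where
  "hoelder2_quots a b I A =
     {norm (A s u t) / (\<bar>u - s\<bar> powr a * \<bar>t - u\<bar> powr b) | s u t.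
        s \<in> I \<and> u \<in> I \<and> t \<in> I \<and> u \<noteq> s \<and> t \<noteq> u}"

definition Omega2_norm ::
    "real \<Rightarrow> real \<Rightarrow> real set \<Rightarrow> (real \<Rightarrow> real \<Rightarrow> real \<Rightarrow> 'u::euclidean_space) \<Rightarrow> real" where
  "Omega2_norm a b I A = Sup (insert 0 (hoelder2_quots a b I A))"

definition is_decomposition ::
    "real \<Rightarrow> real set \<Rightarrow> (real \<Rightarrow> real \<Rightarrow> real \<Rightarrow> 'u::euclidean_space) \<Rightarrow> nat \<Rightarrow>
     (nat \<Rightarrow> real \<Rightarrow> real \<Rightarrow> real \<Rightarrow> 'u) \<Rightarrow> (nat \<Rightarrow> real) \<Rightarrow> bool" where
  "is_decomposition z I A n B \<rho> \<longleftrightarrow>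
     (\<forall>i<n. B i \<in> Omega_C2 I \<and> 0 < \<rho> i \<and> \<rho> i < z \<and>
        bdd_above (hoelder2_quots (\<rho> i) (z - \<rho> i) I (B i))) \<and>
     (\<forall>s\<in>I. \<forall>u\<in>I. \<forall>t\<in>I. A s u t = (\<Sum>i<n. B i s u t))"

definition Omega_C2_hoelder ::
    "real \<Rightarrow> real set \<Rightarrow> (real \<Rightarrow> real \<Rightarrow> real \<Rightarrow> 'u::euclidean_space) set" where
  "Omega_C2_hoelder z I = {A. \<exists>n B \<rho>. is_decomposition z I A n B \<rho>}"

definition Z2_space :: "real \<Rightarrow> real set \<Rightarrow> (real \<Rightarrow> real \<Rightarrow> real \<Rightarrow> 'u::euclidean_space) set" where
  "Z2_space z I = {A \<in> Omega_C2_hoelder z I.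
     \<exists>R\<in>Omega_C I. \<forall>s\<in>I. \<forall>u\<in>I. \<forall>t\<in>I. A s u t = N_op R s u t}"

text \<open>
  The map \<open>\<Lambda>\<close> on the whole line.  Its values are continuous, vanish on the diagonal and have finite
  \<open>z\<close>-norm, but are not required to be bounded: with \<open>R s t = max (-1) (min 1 (t - s))\<close>, which is
  bounded, \<open>N R\<close> lies in \<open>Z2_space z UNIV\<close> for every \<open>z > 1\<close>, whereas the only \<open>R'\<close> of finite
  \<open>z\<close>-norm with \<open>N R' = N R\<close> is \<open>R s t - (t - s)\<close>, which is unbounded.  The last clause only fixes
  the value outside the domain, so that the map is unique as a total function.
\<close>

definition is_Lambda ::
    "real \<Rightarrow> ((real \<Rightarrow> real \<Rightarrow> real \<Rightarrow> 'u::euclidean_space) \<Rightarrow> real \<Rightarrow> real \<Rightarrow> 'u) \<Rightarrow> bool" where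
  "is_Lambda z L \<longleftrightarrow>
     (\<forall>A\<in>Z2_space z UNIV.
        continuous_on UNIV (\<lambda>(s, t). L A s t) \<and> (\<forall>s. L A s s = 0) \<and>
        bdd_above (hoelder_quots z UNIV (L A)) \<and> N_op (L A) = A) \<and>
     (\<forall>A\<in>Z2_space z UNIV. \<forall>B\<in>Z2_space z UNIV.
        L (\<lambda>s u t. A s u t + B s u t) = (\<lambda>s t. L A s t + L B s t)) \<and>
     (\<forall>c. \<forall>A\<in>Z2_space z UNIV. L (\<lambda>s u t. c *\<^sub>R A s u t) = (\<lambda>s t. c *\<^sub>R L A s t)) \<and>
     (\<forall>A\<in>Z2_space z UNIV. \<forall>n B \<rho>. is_decomposition z UNIV A n B \<rho> \<longrightarrow>
        Omega_norm z UNIV (L A)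
          \<le> 1 / (2 powr z - 2) * (\<Sum>i<n. Omega2_norm (\<rho> i) (z - \<rho> i) UNIV (B i))) \<and>
     (\<forall>A. A \<notin> Z2_space z UNIV \<longrightarrow> L A = (\<lambda>s t. 0))"

definition Lambda_line ::
    "real \<Rightarrow> (real \<Rightarrow> real \<Rightarrow> real \<Rightarrow> 'u::euclidean_space) \<Rightarrow> real \<Rightarrow> real \<Rightarrow> 'u" where
  "Lambda_line z = (THE L. is_Lambda z L)"

definition Lambda ::
    "real \<Rightarrow> real set \<Rightarrow> (real \<Rightarrow> real \<Rightarrow> real \<Rightarrow> 'u::euclidean_space) \<Rightarrow> real \<Rightarrow> real \<Rightarrow> 'u" where
  "Lambda z I A = Lambda_line z
     (SOME A'. A' \<in> Z2_space z UNIV \<and> (\<forall>s\<in>I. \<forall>u\<in>I. \<forall>t\<in>I. A' s u t = A s u t))"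

definition tensor :: "real^'n \<Rightarrow> real^'n \<Rightarrow> real^'n^'n" where
  "tensor a b = (\<chi> \<mu> \<nu>. a $ \<mu> * b $ \<nu>)"

definition contract :: "'u::euclidean_space^'n \<Rightarrow> real^'n \<Rightarrow> 'u" where
  "contract P x = (\<Sum>\<nu>\<in>UNIV. x $ \<nu> *\<^sub>R P $ \<nu>)"

definition contract2 :: "real^'n^'n \<Rightarrow> real^'n^'n \<Rightarrow> real^'n^'n \<Rightarrow> real^'n^'n" where
  "contract2 P Q M =
     (\<chi> \<mu> \<nu>. \<Sum>\<mu>'\<in>UNIV. \<Sum>\<nu>'\<in>UNIV. P $ \<mu>' $ \<mu> * Q $ \<nu>' $ \<nu> * M $ \<mu>' $ \<nu>')"

definition remainder ::
    "(real \<Rightarrow> real^'n) \<Rightarrow> (real \<Rightarrow> 'u::euclidean_space) \<Rightarrow> (real \<Rightarrow> 'u^'n) \<Rightarrow> real \<Rightarrow> real \<Rightarrow> 'u" where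
  "remainder X Z Z' s t = incr Z s t - contract (Z' s) (incr X s t)"

definition controlled ::
    "real \<Rightarrow> real \<Rightarrow> real set \<Rightarrow> (real \<Rightarrow> real^'n) \<Rightarrow>
     ((real \<Rightarrow> 'u::euclidean_space) \<times> (real \<Rightarrow> 'u^'n)) set" where
  "controlled \<gamma> \<eta> I X = {(Z, Z'). Z \<in> C_hoelder \<gamma> I \<and> Z' \<in> C_hoelder (\<eta> - \<gamma>) I \<and>
     remainder X Z Z' \<in> Omega_C_hoelder \<eta> I}"

definition D_seminorm ::
    "real \<Rightarrow> real \<Rightarrow> real set \<Rightarrow> (real \<Rightarrow> real^'n) \<Rightarrow>
     (real \<Rightarrow> 'u::euclidean_space) \<times> (real \<Rightarrow> 'u^'n) \<Rightarrow> real" where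
  "D_seminorm \<gamma> \<eta> I X = (\<lambda>(Z, Z'). sup_norm I Z' + path_norm (\<eta> - \<gamma>) I Z' +
     Omega_norm \<eta> I (remainder X Z Z') + path_norm \<gamma> I Z)"

text \<open>\<open>c p + q\<close> for pairs of paths.\<close>

definition pair_comb ::
    "real \<Rightarrow> (real \<Rightarrow> 'u::euclidean_space) \<times> (real \<Rightarrow> 'w::euclidean_space) \<Rightarrow>
     (real \<Rightarrow> 'u) \<times> (real \<Rightarrow> 'w) \<Rightarrow> (real \<Rightarrow> 'u) \<times> (real \<Rightarrow> 'w)" where
  "pair_comb c p q = (\<lambda>t. c *\<^sub>R fst p t + fst q t, \<lambda>t. c *\<^sub>R snd p t + snd q t)"

text \<open>
  The semi-norm does not see an additive constant in \<open>Z\<close>, while \<open>Z W'\<close> does.  So the topology of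
  the space of controlled paths is the one of the sup norm of \<open>Z\<close> together with the semi-norm.
\<close>

definition D_dist ::
    "real \<Rightarrow> real \<Rightarrow> real set \<Rightarrow> (real \<Rightarrow> real^'n) \<Rightarrow>
     (real \<Rightarrow> 'u::euclidean_space) \<times> (real \<Rightarrow> 'u^'n) \<Rightarrow>
     (real \<Rightarrow> 'u) \<times> (real \<Rightarrow> 'u^'n) \<Rightarrow> real" where
  "D_dist \<gamma> \<eta> I X p q =
     sup_norm I (fst (pair_comb (-1) p q)) + D_seminorm \<gamma> \<eta> I X (pair_comb (-1) p q)"

definition young_integral ::
    "real \<Rightarrow> real \<Rightarrow> real set \<Rightarrow> (real \<Rightarrow> real^'n) \<Rightarrow> (real \<Rightarrow> real^'n) \<Rightarrow>
     real \<Rightarrow> real \<Rightarrow> real^'n^'n" where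
  "young_integral \<rho> \<sigma> I F G s t = tensor (F s) (incr G s t)
     - Lambda (\<rho> + \<sigma>) I (N_op (\<lambda>s t. tensor (F s) (incr G s t))) s t"

definition rough_germ ::
    "(real \<Rightarrow> real \<Rightarrow> real^'n^'n) \<Rightarrow> (real \<Rightarrow> real^'n) \<times> (real \<Rightarrow> real^'n^'n) \<Rightarrow>
     (real \<Rightarrow> real^'n) \<times> (real \<Rightarrow> real^'n^'n) \<Rightarrow> real \<Rightarrow> real \<Rightarrow> real^'n^'n" where
  "rough_germ X2 = (\<lambda>(Z, Z') (W, W') s t.
     tensor (Z s) (incr W s t) + contract2 (Z' s) (W' s) (X2 s t))"

definition rough_integral ::
    "real \<Rightarrow> real set \<Rightarrow> (real \<Rightarrow> real \<Rightarrow> real^'n^'n) \<Rightarrow>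
     (real \<Rightarrow> real^'n) \<times> (real \<Rightarrow> real^'n^'n) \<Rightarrow>
     (real \<Rightarrow> real^'n) \<times> (real \<Rightarrow> real^'n^'n) \<Rightarrow> real \<Rightarrow> real \<Rightarrow> real^'n^'n" where
  "rough_integral \<delta> I X2 p q s t =
     rough_germ X2 p q s t - Lambda \<delta> I (N_op (rough_germ X2 p q)) s t"

definition integration_map ::
    "real \<Rightarrow> real set \<Rightarrow> (real \<Rightarrow> real \<Rightarrow> real^'n^'n) \<Rightarrow>
     (real \<Rightarrow> real^'n) \<times> (real \<Rightarrow> real^'n^'n) \<Rightarrow>
     (real \<Rightarrow> real^'n) \<times> (real \<Rightarrow> real^'n^'n) \<Rightarrow>
     (real \<Rightarrow> real^'n^'n) \<times> (real \<Rightarrow> real^'n^'n^'n)" where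
  "integration_map \<delta> I X2 p q =
     (\<lambda>t. rough_integral \<delta> I X2 p q 0 t, \<lambda>t. \<chi> \<kappa>. tensor (fst p t) (snd q t $ \<kappa>))"

end

theory Submission
  imports Defs
begin

text \<open>
  A germ \<open>R\<close> on \<open>I\<^sup>2\<close> becomes an integral by subtracting \<open>\<Lambda> N R\<close>, and everything rests on one description
  of \<open>\<Lambda>\<close>: it is the series of the midpoint defects \<open>N R\<close> over the dyadic subdivisions of \<open>[s, t]\<close>, so
  that \<open>R - \<Lambda> N R\<close> is the limit of the dyadic Riemann sums of \<open>R\<close>.  If \<open>N R\<close> is of order \<open>z > 1\<close>, level \<open>n\<close>
  of the series has \<open>2\<^sup>n\<close> terms of size \<open>(2\<^sup>-\<^sup>n\<^sup>-\<^sup>1 \<bar>t - s\<bar>)\<^sup>z\<close>, and the geometric sum is the constant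
  \<open>1 / (2\<^sup>z - 2)\<close> (\<open>sew_sums\<close>).  The limit is additive at midpoints by construction.  A midpoint additive
  function of order larger than \<open>1\<close> vanishes (\<open>bisect_invariant_eq_0\<close>); applied to suitable auxiliary
  functions, this principle yields additivity at all points (\<open>bisect_invariant_additive\<close>), the
  uniqueness of \<open>\<Lambda>\<close> (\<open>Lambda_line_eq_sewing_map\<close>) and the agreement of integrals defined by different
  germs.

  On an interval, \<open>\<Lambda>\<close> is evaluated on an extension to the line.  The series shows that the choice does
  not matter (\<open>Lambda_eq_sew\<close>), but an extension has to exist.  It is obtained by extending the data: the
  paths are composed with maps of the line into \<open>I\<close> that do not increase distances, followed by a limit,
  and the second level is rebuilt from paths by Chen's relation (\<open>rough_germ_extendable\<close>).

  For the germ \<open>Z \<delta>W + Z' W' X2\<close> of two controlled paths, Chen's relation cancels the part of order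
  \<open>2 * \<gamma>\<close> of the defect, and each of the remaining terms has order \<open>\<eta> + \<gamma> > 1\<close> (\<open>N_rough_germ\<close>).  Estimating
  these terms at midpoints gives the bound (\<open>rough_integral_bound\<close>).  The Young germ \<open>Z \<delta>W\<close> differs from
  this germ by \<open>Z' W' X2\<close>, which is zero or of order \<open>2 * \<gamma> > 1\<close>, hence invisible in the limit
  (\<open>rough_integral_eq_young\<close>).  Finally, the increment of the integral is the germ minus a term of order
  \<open>\<eta> + \<gamma>\<close>, which exhibits \<open>Z W'\<close> as its derivative, with a bound that is bilinear in the two controlled
  paths (\<open>integration_map_bound\<close>); for a bilinear map, such a bound is continuity.
\<close>

section \<open>Dyadic Riemann sums and the sewing series\<close>

text \<open>
  Iterating \<open>bisect\<close> on \<open>f\<close> gives the Riemann sums of \<open>f\<close> over the dyadic partitions of \<open>[s, t]\<close>; a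
  function that it fixes is additive at midpoints.  The formula makes sense for \<open>t < s\<close> as well, so
  no orientation has to be chosen.
\<close>

definition bisect :: "(real \<Rightarrow> real \<Rightarrow> 'u::real_vector) \<Rightarrow> real \<Rightarrow> real \<Rightarrow> 'u" where
  "bisect f s t = f s ((s + t) / 2) + f ((s + t) / 2) t"

text \<open>
  For \<open>A = N R\<close> the \<open>n\<close>-th term is the difference between the dyadic Riemann sums of \<open>R\<close> of levels \<open>n\<close>
  and \<open>n + 1\<close>, so the series telescopes to \<open>R\<close> minus the limit of these sums.  Writing it in terms of
  \<open>A\<close> alone shows that it is linear in \<open>A\<close> and only sees triples between \<open>s\<close> and \<open>t\<close>.
\<close>

definition sew :: "(real \<Rightarrow> real \<Rightarrow> real \<Rightarrow> 'u::real_normed_vector) \<Rightarrow> real \<Rightarrow> real \<Rightarrow> 'u" where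
  "sew A s t = (\<Sum>n. (bisect ^^ n) (\<lambda>s t. A s ((s + t) / 2) t) s t)"

lemma midpoint_mem_interval:
  fixes s t :: real
  assumes "is_interval I" "s \<in> I" "t \<in> I"
  shows "(s + t) / 2 \<in> I"
  using assms mem_is_interval_1_I[of I s t "(s + t) / 2"] mem_is_interval_1_I[of I t s "(s + t) / 2"]
  by (cases "s \<le> t") auto

text \<open>
  All points of a dyadic subdivision stay in the interval.  This is why \<open>\<Lambda>\<close> on \<open>I\<close> cannot depend on
  how a function on \<open>I\<^sup>3\<close> is extended.
\<close>

lemma bisect_pow_cong:
  assumes "is_interval I" and "\<And>s t. s \<in> I \<Longrightarrow> t \<in> I \<Longrightarrow> f s t = g s t" and "s \<in> I" "t \<in> I"
  shows "(bisect ^^ n) f s t = (bisect ^^ n) g s t"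
  using assms(3,4)
proof (induction n arbitrary: s t)
  case 0
  then show ?case using assms(2) by simp
next
  case (Suc n)
  then show ?case using midpoint_mem_interval[OF assms(1) Suc.prems] by (simp add: bisect_def)
qed

lemma bisect_pow_lincomb:
  "(bisect ^^ n) (\<lambda>s t. c *\<^sub>R f s t + g s t) s t = c *\<^sub>R (bisect ^^ n) f s t + (bisect ^^ n) g s t"
  by (induction n arbitrary: s t) (simp_all add: bisect_def algebra_simps)

text \<open>
  There are \<open>2 ^ n\<close> pieces of length \<open>\<bar>t - s\<bar> / 2 ^ n\<close>.  The modulus \<open>\<omega>\<close> is kept general because the
  comparison of two integrals involves a sum of several powers.
\<close>

lemma norm_bisect_pow_le:
  fixes f :: "real \<Rightarrow> real \<Rightarrow> 'u::real_normed_vector"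
  assumes "is_interval I" and "\<And>s t. s \<in> I \<Longrightarrow> t \<in> I \<Longrightarrow> norm (f s t) \<le> \<omega> \<bar>t - s\<bar>"
    and "s \<in> I" "t \<in> I"
  shows "norm ((bisect ^^ n) f s t) \<le> 2 ^ n * \<omega> (\<bar>t - s\<bar> / 2 ^ n)"
  using assms(3,4)
proof (induction n arbitrary: s t)
  case 0
  then show ?case using assms(2) by simp
next
  case (Suc n)
  let ?m = "(s + t) / 2"
  have m: "?m \<in> I" using midpoint_mem_interval[OF assms(1) Suc.prems] .
  have half: "\<bar>?m - s\<bar> / 2 ^ n = \<bar>t - s\<bar> / 2 ^ Suc n" "\<bar>t - ?m\<bar> / 2 ^ n = \<bar>t - s\<bar> / 2 ^ Suc n"
    by (simp_all add: field_simps abs_if)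
  have "norm ((bisect ^^ n) f s ?m) \<le> 2 ^ n * \<omega> (\<bar>t - s\<bar> / 2 ^ Suc n)"
    using Suc.IH[OF Suc.prems(1) m] unfolding half .
  moreover have "norm ((bisect ^^ n) f ?m t) \<le> 2 ^ n * \<omega> (\<bar>t - s\<bar> / 2 ^ Suc n)"
    using Suc.IH[OF m Suc.prems(2)] unfolding half .
  ultimately have "norm (bisect ((bisect ^^ n) f) s t) \<le> 2 * (2 ^ n * \<omega> (\<bar>t - s\<bar> / 2 ^ Suc n))"
    unfolding bisect_def mult_2 by (rule norm_triangle_mono)
  then show ?case by (simp add: mult.assoc)
qed

text \<open>
  The uniqueness behind sewing: midpoint additivity writes \<open>D s t\<close> as a sum of \<open>2 ^ n\<close> values of \<open>D\<close> at
  scale \<open>2 ^ - n\<close>, and \<open>\<omega> x\<close> is of smaller order than \<open>x\<close>.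
\<close>

lemma bisect_invariant_eq_0:
  fixes D :: "real \<Rightarrow> real \<Rightarrow> 'u::real_normed_vector"
  assumes I: "is_interval I"
    and inv: "\<And>s t. s \<in> I \<Longrightarrow> t \<in> I \<Longrightarrow> bisect D s t = D s t"
    and bd: "\<And>s t. s \<in> I \<Longrightarrow> t \<in> I \<Longrightarrow> norm (D s t) \<le> \<omega> \<bar>t - s\<bar>"
    and lim: "\<And>x. (\<lambda>n. 2 ^ n * \<omega> (x / 2 ^ n)) \<longlonglongrightarrow> 0"
    and st: "s \<in> I" "t \<in> I"
  shows "D s t = 0"
proof -
  have "(bisect ^^ n) D s t = D s t" for n
    using st
  proof (induction n arbitrary: s t)
    case (Suc n)
    then show ?case
      using midpoint_mem_interval[OF I Suc.prems] inv[OF Suc.prems] by (simp add: bisect_def)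
  qed simp
  then have "norm (D s t) \<le> 2 ^ n * \<omega> (\<bar>t - s\<bar> / 2 ^ n)" for n
    using norm_bisect_pow_le[of I D \<omega> s t n, OF I bd st] by simp
  then have "norm (D s t) \<le> 0"
    using LIMSEQ_le_const[OF lim[of "\<bar>t - s\<bar>"]] by blast
  then show ?thesis by simp
qed

lemma powr_rescale:
  fixes x z :: real
  assumes "0 \<le> x"
  shows "2 ^ n * (C * (x / 2 ^ n) powr z) = C * x powr z * (2 powr (1 - z)) ^ n"
proof -
  have "(2 powr (1 - z)) ^ n = (2 ^ n) powr (1 - z)"
    by (simp add: powr_realpow[symmetric] powr_powr mult.commute)
  also have "\<dots> = 2 ^ n / (2 ^ n) powr z"
    by (simp add: powr_diff)
  finally show ?thesis using assms by (simp add: powr_divide)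
qed

lemma two_powr_less_1: "z > 1 \<Longrightarrow> (2::real) powr (1 - z) < 1"
  using powr_less_cancel_iff[of 2 "1 - z" 0] by simp

lemma powr_rescale_lim:
  fixes x z :: real
  assumes "z > 1"
  shows "(\<lambda>n. 2 ^ n * (C * \<bar>x / 2 ^ n\<bar> powr z)) \<longlonglongrightarrow> 0"
proof -
  have "(\<lambda>n. C * \<bar>x\<bar> powr z * (2 powr (1 - z)) ^ n) \<longlonglongrightarrow> C * \<bar>x\<bar> powr z * 0"
    by (intro tendsto_intros LIMSEQ_realpow_zero two_powr_less_1 assms) simp
  moreover have eq: "2 ^ n * (C * \<bar>x / 2 ^ n\<bar> powr z) = C * \<bar>x\<bar> powr z * (2 powr (1 - z)) ^ n" for n
    using powr_rescale[OF abs_ge_zero, of n C x z] by (simp only: abs_divide power_abs abs_numeral)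
  ultimately show ?thesis unfolding eq by simp
qed

text \<open>
  The terms decay geometrically with ratio \<open>2 powr (1 - z)\<close>.  At the midpoint both gaps are half of
  \<open>\<bar>t - s\<bar>\<close>, which contributes \<open>2 powr (- z)\<close>; since \<open>2\<^sup>-\<^sup>z / (1 - 2\<^sup>1\<^sup>-\<^sup>z) = 1 / (2\<^sup>z - 2)\<close>, this is
  where the constant of the estimate comes from.
\<close>

lemma sew_sums:
  fixes A :: "real \<Rightarrow> real \<Rightarrow> real \<Rightarrow> 'u::banach"
  assumes I: "is_interval I" and z: "z > 1"
    and bd: "\<And>s t. s \<in> I \<Longrightarrow> t \<in> I \<Longrightarrow> norm (A s ((s + t) / 2) t) \<le> K * (\<bar>t - s\<bar> / 2) powr z"
    and st: "s \<in> I" "t \<in> I"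
  shows "(\<lambda>n. (bisect ^^ n) (\<lambda>s t. A s ((s + t) / 2) t) s t) sums sew A s t"
    and "norm (sew A s t) \<le> 1 / (2 powr z - 2) * K * \<bar>t - s\<bar> powr z"
proof -
  let ?a = "\<lambda>n. (bisect ^^ n) (\<lambda>s t. A s ((s + t) / 2) t) s t"
  let ?q = "2 powr (1 - z) :: real"
  define c where "c = K / 2 powr z * \<bar>t - s\<bar> powr z"
  have q: "0 < ?q" "?q < 1" using two_powr_less_1[OF z] by auto
  have bd': "norm (A s ((s + t) / 2) t) \<le> K / 2 powr z * \<bar>t - s\<bar> powr z" if "s \<in> I" "t \<in> I" for s t
    using bd[OF that] by (simp add: powr_divide)
  have le: "norm (?a n) \<le> c * ?q ^ n" for n
    using norm_bisect_pow_le[of I "\<lambda>s t. A s ((s + t) / 2) t" "\<lambda>x. K / 2 powr z * x powr z" s t n,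
        OF I bd' st]
    unfolding c_def powr_rescale[of "\<bar>t - s\<bar>" n "K / 2 powr z" z, OF abs_ge_zero] .
  have geo: "(\<lambda>n. c * ?q ^ n) sums (c * (1 / (1 - ?q)))"
    by (intro sums_mult geometric_sums) (use q in auto)
  have summ: "summable ?a"
    by (rule summable_comparison_test'[OF sums_summable[OF geo]]) (rule le)
  then show "?a sums sew A s t" unfolding sew_def by (rule summable_sums)
  have "norm (sew A s t) \<le> c * (1 / (1 - ?q))"
    unfolding sew_def sums_unique[OF geo]
    by (rule norm_suminf_le[OF le sums_summable[OF geo]])
  also have "\<dots> = 1 / (2 powr z - 2) * K * \<bar>t - s\<bar> powr z"
  proof -
    have q_eq: "?q = 2 / 2 powr z" by (simp add: powr_diff)
    have "2 powr z > (2::real)" using z powr_less_cancel_iff[of 2 1 z] by simp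
    then have "1 / (1 - ?q) = 2 powr z / (2 powr z - 2)" unfolding q_eq by (simp add: field_simps)
    then show ?thesis by (simp add: c_def)
  qed
  finally show "norm (sew A s t) \<le> 1 / (2 powr z - 2) * K * \<bar>t - s\<bar> powr z" .
qed

text \<open>sewing\<close>

lemma continuous_on_bisect:
  fixes f :: "real \<Rightarrow> real \<Rightarrow> 'u::real_normed_vector"
  assumes "continuous_on UNIV (\<lambda>(s, t). f s t)"
  shows "continuous_on UNIV (\<lambda>(s, t). (bisect ^^ n) f s t)"
proof (induction n)
  case 0
  then show ?case using assms by simp
next
  case (Suc n)
  let ?g = "\<lambda>(s, t). (bisect ^^ n) f s t"
  have "continuous_on UNIV (\<lambda>x::real \<times> real. ?g (fst x, (fst x + snd x) / 2) + ?g ((fst x + snd x) / 2, snd x))"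
    by (intro continuous_intros continuous_on_compose2[OF Suc]) auto
  moreover have "(\<lambda>(s, t). (bisect ^^ Suc n) f s t)
      = (\<lambda>x. ?g (fst x, (fst x + snd x) / 2) + ?g ((fst x + snd x) / 2, snd x))"
    by (simp add: bisect_def[of "(bisect ^^ n) f"] fun_eq_iff)
  ultimately show ?case by simp
qed

text \<open>
  The geometric majorant is uniform on each strip \<open>\<bar>t - s\<bar> < M\<close>, and these open strips cover the plane.
\<close>

lemma continuous_on_sew:
  fixes A :: "real \<Rightarrow> real \<Rightarrow> real \<Rightarrow> 'u::banach"
  assumes z: "z > 1"
    and bd: "\<And>s t. norm (A s ((s + t) / 2) t) \<le> K * (\<bar>t - s\<bar> / 2) powr z"
    and cont: "continuous_on UNIV (\<lambda>(s, t). A s ((s + t) / 2) t)"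
  shows "continuous_on UNIV (\<lambda>(s, t). sew A s t)"
proof -
  let ?a = "\<lambda>n x. (bisect ^^ n) (\<lambda>s t. A s ((s + t) / 2) t) (fst x) (snd x)"
  let ?q = "2 powr (1 - z) :: real"
  have K: "K \<ge> 0" using order.trans[OF norm_ge_zero bd[of 0 2]] by simp
  have on_strip: "continuous_on {x. \<bar>snd x - fst x\<bar> < M} (\<lambda>x. sew A (fst x) (snd x))" for M
  proof (cases "M > 0")
    case True
    let ?S = "{x::real \<times> real. \<bar>snd x - fst x\<bar> < M}"
    have "norm (?a n x) \<le> K / 2 powr z * M powr z * ?q ^ n" if x: "x \<in> ?S" for n x
    proof -
      have "norm (?a n x) \<le> 2 ^ n * (K / 2 powr z * (\<bar>snd x - fst x\<bar> / 2 ^ n) powr z)"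
        using bd by (intro norm_bisect_pow_le[where I = UNIV and \<omega> = "\<lambda>x. K / 2 powr z * x powr z"])
          (auto simp: powr_divide)
      also have "\<dots> = K / 2 powr z * \<bar>snd x - fst x\<bar> powr z * ?q ^ n"
        by (rule powr_rescale) simp
      also have "\<dots> \<le> K / 2 powr z * M powr z * ?q ^ n"
        using x K z by (intro mult_right_mono mult_left_mono powr_mono2) auto
      finally show ?thesis .
    qed
    moreover have "summable (\<lambda>n. K / 2 powr z * M powr z * ?q ^ n)"
      using two_powr_less_1[OF z] by (intro summable_mult summable_geometric) auto
    ultimately have "uniform_limit ?S (\<lambda>n x. \<Sum>i<n. ?a i x) (\<lambda>x. \<Sum>i. ?a i x) sequentially"
      by (rule Weierstrass_m_test)
    moreover have "continuous_on ?S (\<lambda>x. \<Sum>i<n. ?a i x)" for n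
      using continuous_on_bisect[OF cont]
      by (intro continuous_intros) (auto simp: case_prod_unfold intro: continuous_on_subset)
    ultimately have "continuous_on ?S (\<lambda>x. \<Sum>i. ?a i x)"
      by (intro uniform_limit_theorem) auto
    then show ?thesis by (simp add: sew_def)
  next
    case False
    then have "{x::real \<times> real. \<bar>snd x - fst x\<bar> < M} = {}" by auto
    then show ?thesis by simp
  qed
  have "isCont (\<lambda>x. sew A (fst x) (snd x)) x" for x
  proof -
    let ?S = "{y::real \<times> real. \<bar>snd y - fst y\<bar> < \<bar>snd x - fst x\<bar> + 1}"
    have "open ?S" by (intro open_Collect_less continuous_intros)
    moreover have "x \<in> ?S" by simp
    ultimately show ?thesis
      using on_strip[of "\<bar>snd x - fst x\<bar> + 1"] continuous_on_eq_continuous_at by blast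
  qed
  then show ?thesis by (simp add: case_prod_unfold continuous_at_imp_continuous_on)
qed

text \<open>
  Both \<open>R\<close> and its sewing series equal the midpoint defect plus their own bisection, for the series by
  a shift of the index; the defect cancels in the difference.
\<close>

lemma bisect_sew:
  fixes R :: "real \<Rightarrow> real \<Rightarrow> 'u::euclidean_space"
  assumes "z > 1"
    and bd: "\<And>s t. norm (N_op R s ((s + t) / 2) t) \<le> K * (\<bar>t - s\<bar> / 2) powr z"
  shows "bisect (\<lambda>s t. R s t - sew (N_op R) s t) s t = R s t - sew (N_op R) s t"
proof -
  let ?g = "\<lambda>s t. N_op R s ((s + t) / 2) t"
  let ?m = "(s + t) / 2"
  note sums = sew_sums(1)[of UNIV z "N_op R", OF _ assms(1) bd]
  have "(\<lambda>n. (bisect ^^ n) ?g s ?m + (bisect ^^ n) ?g ?m t)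
      sums (sew (N_op R) s ?m + sew (N_op R) ?m t)"
    by (intro sums_add sums) auto
  then have "(\<lambda>n. (bisect ^^ Suc n) ?g s t) sums (sew (N_op R) s ?m + sew (N_op R) ?m t)"
    by (simp add: bisect_def)
  then have "(\<lambda>n. (bisect ^^ n) ?g s t) sums (sew (N_op R) s ?m + sew (N_op R) ?m t + ?g s t)"
    using sums_Suc[of "\<lambda>n. (bisect ^^ n) ?g s t"] by simp
  moreover have "(\<lambda>n. (bisect ^^ n) ?g s t) sums sew (N_op R) s t"
    by (rule sums) auto
  ultimately have "sew (N_op R) s t = sew (N_op R) s ?m + sew (N_op R) ?m t + ?g s t"
    using sums_unique2 by blast
  then show ?thesis by (simp add: bisect_def N_op_def algebra_simps)
qed

lemma sum_pairs:
  fixes k :: nat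
  shows "(\<Sum>i<2 * k. f i) = (\<Sum>i<k. f (2 * i) + f (2 * i + 1) :: 'a::comm_monoid_add)"
  by (induction k) (simp_all add: ac_simps)

text \<open>
  Additivity over \<open>k\<close> equal pieces, by induction on \<open>k\<close>.  The induction hypothesis reduces the difference
  between \<open>J\<close> and the sum over \<open>k + 1\<close> pieces to a single value of \<open>N J\<close>, which is of order
  \<open>\<bar>t - s\<bar> powr z\<close>.  That difference is again midpoint additive, because cutting each of the \<open>k + 1\<close>
  pieces in half gives the equal pieces of the two halves of the interval.  So it vanishes by
  uniqueness.
\<close>

lemma bisect_invariant_additive_multiples:
  fixes J :: "real \<Rightarrow> real \<Rightarrow> 'u::euclidean_space"
  assumes z: "z > 1" and inv: "\<And>s t. bisect J s t = J s t"
    and bd: "\<And>s u t. norm (N_op J s u t) \<le> K * (\<bar>u - s\<bar> + \<bar>t - u\<bar>) powr z"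
  shows "J s (s + real k * h) = (\<Sum>i<k. J (s + real i * h) (s + (real i + 1) * h))"
proof (induction k arbitrary: s h)
  case 0
  have "J s s = 0" using inv[of s s] by (simp add: bisect_def)
  then show ?case by simp
next
  case (Suc k)
  define P where "P s h = (\<Sum>i<Suc k. J (s + real i * h) (s + (real i + 1) * h))" for s h
  define D where "D s t = J s t - P s ((t - s) / Suc k)" for s t
  \<comment> \<open>halving all pieces of \<open>P s h\<close> gives twice as many pieces, the first half of which belongs to \<open>P s (h / 2)\<close>\<close>
  have P_split: "P s h = P s (h / 2) + P (s + real (Suc k) * (h / 2)) (h / 2)" for s h
  proof -
    let ?f = "\<lambda>i. J (s + real i * (h / 2)) (s + (real i + 1) * (h / 2))"
    have "P (s + real (Suc k) * (h / 2)) (h / 2) = (\<Sum>i<Suc k. ?f (Suc k + i))"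
      unfolding P_def by (intro sum.cong refl arg_cong2[where f = J]) (simp_all add: algebra_simps add_divide_distrib)
    moreover have "P s (h / 2) = (\<Sum>i<Suc k. ?f i)" by (simp add: P_def)
    moreover have "(\<Sum>i<Suc k. ?f i) + (\<Sum>i<Suc k. ?f (Suc k + i)) = (\<Sum>i<2 * Suc k. ?f i)"
      using sum.atLeastLessThan_concat[of 0 "Suc k" "2 * Suc k" ?f]
        sum.shift_bounds_nat_ivl[of ?f 0 "Suc k" "Suc k"]
      by (simp add: lessThan_atLeast0 mult_2 add.commute del: sum.op_ivl_Suc)
    moreover have "(\<Sum>i<2 * Suc k. ?f i) = (\<Sum>i<Suc k. ?f (2 * i) + ?f (2 * i + 1))"
      by (rule sum_pairs)
    moreover have "?f (2 * i) + ?f (2 * i + 1) = J (s + real i * h) (s + (real i + 1) * h)" for i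
    proof -
      have "?f (2 * i) + ?f (2 * i + 1) = bisect J (s + real i * h) (s + (real i + 1) * h)"
        unfolding bisect_def
        by (intro arg_cong2[where f = "(+)"] arg_cong2[where f = J]) (simp_all add: field_simps)
      then show ?thesis using inv by simp
    qed
    ultimately have "P s (h / 2) + P (s + real (Suc k) * (h / 2)) (h / 2)
        = (\<Sum>i<Suc k. J (s + real i * h) (s + (real i + 1) * h))"
      by (simp del: sum.lessThan_Suc of_nat_Suc)
    then show ?thesis by (simp add: P_def del: sum.lessThan_Suc of_nat_Suc)
  qed
  have D_inv: "bisect D s t = D s t" for s t
  proof -
    let ?m = "(s + t) / 2"
    define h where "h = (t - s) / Suc k"
    have t: "t = s + real (Suc k) * h" by (simp add: h_def del: of_nat_Suc)
    have m: "s + real (Suc k) * (h / 2) = ?m" by (simp add: t field_simps)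
    have "(?m - s) / Suc k = h / 2" "(t - ?m) / Suc k = h / 2"
      unfolding m[symmetric] by (simp_all add: t field_simps del: of_nat_Suc)
    then have "P s ((t - s) / Suc k) = P s ((?m - s) / Suc k) + P ?m ((t - ?m) / Suc k)"
      using P_split[of s h] unfolding m h_def[symmetric] by (simp only:)
    then show ?thesis using inv[of s t] by (simp add: D_def bisect_def algebra_simps)
  qed
  have D_bd: "norm (D s t) \<le> K * \<bar>\<bar>t - s\<bar>\<bar> powr z" for s t
  proof -
    define h where "h = (t - s) / Suc k"
    have t: "t = s + (real k + 1) * h" by (simp add: h_def field_simps)
    have "P s h = J s (s + real k * h) + J (s + real k * h) t"
      using Suc.IH[of s h] by (simp add: P_def t)
    then have "D s t = N_op J s (s + real k * h) t" by (simp add: D_def N_op_def h_def)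
    moreover have "\<bar>s + real k * h - s\<bar> + \<bar>t - (s + real k * h)\<bar> = \<bar>t - s\<bar>"
    proof -
      have e: "t - (s + real k * h) = h" "t - s = (real k + 1) * h" by (simp_all add: t algebra_simps)
      have "\<bar>s + real k * h - s\<bar> = real k * \<bar>h\<bar>" "\<bar>(real k + 1) * h\<bar> = (real k + 1) * \<bar>h\<bar>"
        by (simp_all add: abs_mult)
      then show ?thesis unfolding e by (simp add: algebra_simps)
    qed
    ultimately show ?thesis using bd[of s "s + real k * h" t] by simp
  qed
  have "D s t = 0" for s t
    by (rule bisect_invariant_eq_0[where I = UNIV and \<omega> = "\<lambda>x. K * \<bar>x\<bar> powr z"])
      (use powr_rescale_lim[OF z] D_inv D_bd in auto)
  from this[of s "s + real (Suc k) * h"] show ?case by (simp add: D_def P_def del: of_nat_Suc sum.lessThan_Suc)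
qed

text \<open>
  Equal subdivisions give additivity at cut points with rational ratio, and continuity gives all cut
  points between \<open>s\<close> and \<open>t\<close>.  Together with \<open>J s t = - J t s\<close>, another instance of uniqueness, this
  covers every ordering of \<open>s\<close>, \<open>u\<close>, \<open>t\<close>.
\<close>

lemma bisect_invariant_additive:
  fixes J :: "real \<Rightarrow> real \<Rightarrow> 'u::euclidean_space"
  assumes z: "z > 1" and inv: "\<And>s t. bisect J s t = J s t"
    and bd: "\<And>s u t. norm (N_op J s u t) \<le> K * (\<bar>u - s\<bar> + \<bar>t - u\<bar>) powr z"
    and cont: "continuous_on UNIV (\<lambda>(s, t). J s t)"
  shows "N_op J s u t = 0"
proof -
  note mult = bisect_invariant_additive_multiples[OF z inv bd]
  have rat: "J s t = J s (s + real j / real k * (t - s)) + J (s + real j / real k * (t - s)) t"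
    if "j \<le> k" "k > 0" for s t j k
  proof -
    define h where "h = (t - s) / real k"
    let ?f = "\<lambda>i. J (s + real i * h) (s + (real i + 1) * h)"
    have "t = s + real k * h" using that by (simp add: h_def)
    then have "J s t = (\<Sum>i<k. ?f i)" using mult by metis
    also have "\<dots> = (\<Sum>i<j. ?f i) + (\<Sum>i<k - j. ?f (j + i))"
      using sum.atLeastLessThan_concat[of 0 j k ?f] sum.shift_bounds_nat_ivl[of ?f 0 j "k - j"] that
      by (simp add: lessThan_atLeast0 add.commute)
    also have "(\<Sum>i<j. ?f i) = J s (s + real j * h)" using mult[of s j h] by simp
    also have "(\<Sum>i<k - j. ?f (j + i)) = J (s + real j * h) (s + real j * h + real (k - j) * h)"
      unfolding mult[of "s + real j * h" "k - j" h]
      by (intro sum.cong refl arg_cong2[where f = J]) (simp_all add: algebra_simps)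
    also have "s + real j * h + real (k - j) * h = t"
      using that \<open>t = s + real k * h\<close> by (simp add: of_nat_diff algebra_simps)
    finally show ?thesis by (simp add: h_def)
  qed
  have between: "J s t = J s (s + l * (t - s)) + J (s + l * (t - s)) t" if l: "0 \<le> l" "l \<le> 1" for s t l
  proof -
    \<comment> \<open>approximation of the ratio \<open>l\<close> from below by fractions with denominator \<open>n + 1\<close>\<close>
    define r where "r n = real (nat \<lfloor>l * Suc n\<rfloor>) / real (Suc n)" for n
    have r_eq: "r n = of_int \<lfloor>l * Suc n\<rfloor> / real (Suc n)" for n
      using l by (simp add: r_def)
    have "\<bar>r n - l\<bar> \<le> 1 / real (Suc n)" for n
    proof -
      have "\<bar>of_int \<lfloor>l * Suc n\<rfloor> - l * Suc n\<bar> \<le> 1" by linarith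
      moreover have "r n - l = (of_int \<lfloor>l * Suc n\<rfloor> - l * Suc n) / real (Suc n)"
        unfolding r_eq by (simp add: diff_divide_distrib del: of_nat_Suc)
      then have "\<bar>r n - l\<bar> = \<bar>of_int \<lfloor>l * Suc n\<rfloor> - l * Suc n\<bar> / real (Suc n)"
        by (simp only: abs_divide abs_of_nat)
      ultimately show ?thesis by (simp add: divide_right_mono del: of_nat_Suc)
    qed
    then have "(\<lambda>n. r n - l) \<longlonglongrightarrow> 0"
      by (intro Lim_null_comparison[OF _ lim_1_over_n[THEN LIMSEQ_Suc]]) auto
    then have rl: "r \<longlonglongrightarrow> l" by (simp add: LIM_zero_iff)
    have contJ: "isCont (\<lambda>x. J (fst x) (snd x)) x" for x
      using cont continuous_on_eq_continuous_at[of UNIV] by (auto simp: case_prod_unfold)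
    have limJ: "(\<lambda>n. J (a n) (b n)) \<longlonglongrightarrow> J a0 b0" if "a \<longlonglongrightarrow> a0" "b \<longlonglongrightarrow> b0" for a b a0 b0
      using isCont_tendsto_compose[OF contJ tendsto_Pair[OF that]] by simp
    have "(\<lambda>n. J s (s + r n * (t - s)) + J (s + r n * (t - s)) t)
        \<longlonglongrightarrow> J s (s + l * (t - s)) + J (s + l * (t - s)) t"
      by (intro tendsto_add limJ tendsto_intros rl)
    moreover have "J s (s + r n * (t - s)) + J (s + r n * (t - s)) t = J s t" for n
    proof -
      have "nat \<lfloor>l * Suc n\<rfloor> \<le> Suc n"
      proof -
        have "l * real (Suc n) \<le> 1 * real (Suc n)" using l by (intro mult_right_mono) auto
        then have "\<lfloor>l * Suc n\<rfloor> \<le> \<lfloor>real (Suc n)\<rfloor>" by (intro floor_mono) simp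
        then show ?thesis by (simp only: floor_of_nat nat_le_iff)
      qed
      then show ?thesis using rat[of "nat \<lfloor>l * Suc n\<rfloor>" "Suc n" s t] by (simp add: r_def)
    qed
    ultimately show ?thesis by (simp add: LIMSEQ_const_iff)
  qed
  have btw: "J a c = J a b + J b c" if ab: "b \<in> closed_segment a c" for a b c
  proof -
    obtain l where "0 \<le> l" "l \<le> 1" "b = (1 - l) * a + l * c"
      using ab by (auto simp: in_segment)
    then have "b = a + l * (c - a)" by (simp add: algebra_simps)
    then show ?thesis using between[of l a c] \<open>0 \<le> l\<close> \<open>l \<le> 1\<close> by simp
  qed
  have diag: "J a a = 0" for a using inv[of a a] by (simp add: bisect_def)
  have anti: "J a b + J b a = 0" for a b
  proof (rule bisect_invariant_eq_0[where I = UNIV and \<omega> = "\<lambda>x. K * 2 powr z * \<bar>x\<bar> powr z" and D = "\<lambda>a b. J a b + J b a"])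
    show "bisect (\<lambda>a b. J a b + J b a) s t = J s t + J t s" for s t
    proof -
      have "bisect (\<lambda>a b. J a b + J b a) s t = bisect J s t + bisect J t s"
        by (simp add: bisect_def algebra_simps)
      then show ?thesis by (simp add: inv)
    qed
    show "norm (J s t + J t s) \<le> K * 2 powr z * \<bar>\<bar>t - s\<bar>\<bar> powr z" for s t
    proof -
      have "J s t + J t s = - N_op J s t s" by (simp add: N_op_def diag)
      then have "norm (J s t + J t s) \<le> K * (2 * \<bar>t - s\<bar>) powr z"
        using bd[of s t s] by (simp add: abs_minus_commute)
      then show ?thesis by (simp add: powr_mult mult.assoc)
    qed
    show "(\<lambda>n. 2 ^ n * (K * 2 powr z * \<bar>x / 2 ^ n\<bar> powr z)) \<longlonglongrightarrow> 0" for x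
      using powr_rescale_lim[OF z] .
  qed auto
  have "u \<in> closed_segment s t \<or> s \<in> closed_segment u t \<or> t \<in> closed_segment s u"
    by (auto simp: closed_segment_eq_real_ivl)
  then have "J s t = J s u + J u t"
    using btw[of u s t] btw[of s u t] btw[of t s u] anti[of s u] anti[of u t]
    by (auto simp: algebra_simps add_eq_0_iff)
  then show ?thesis by (simp add: N_op_def)
qed

section \<open>The map \<open>\<Lambda>\<close> on the line and on an interval\<close>

lemma Omega_norm_nonneg: "bdd_above (hoelder_quots a I R) \<Longrightarrow> 0 \<le> Omega_norm a I R"
  unfolding Omega_norm_def by (intro cSup_upper) auto

lemma norm_le_Omega_norm:
  assumes "bdd_above (hoelder_quots a I R)" "s \<in> I" "t \<in> I" "s = t \<Longrightarrow> R s t = 0"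
  shows "norm (R s t) \<le> Omega_norm a I R * \<bar>t - s\<bar> powr a"
proof (cases "s = t")
  case False
  then have "norm (R s t) / \<bar>t - s\<bar> powr a \<le> Omega_norm a I R"
    unfolding Omega_norm_def using assms
    by (intro cSup_upper) (auto simp: hoelder_quots_def)
  then show ?thesis using False by (simp add: divide_le_eq)
qed (use assms in simp)

lemma hoelder_quots_le:
  assumes "\<And>s t. s \<in> I \<Longrightarrow> t \<in> I \<Longrightarrow> norm (R s t) \<le> K * \<bar>t - s\<bar> powr a" "q \<in> hoelder_quots a I R"
  shows "q \<le> K"
  using assms by (auto simp: hoelder_quots_def divide_le_eq)

lemma hoelder_quots_bdd:
  assumes "\<And>s t. s \<in> I \<Longrightarrow> t \<in> I \<Longrightarrow> norm (R s t) \<le> K * \<bar>t - s\<bar> powr a"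
  shows "bdd_above (hoelder_quots a I R)"
  using hoelder_quots_le[OF assms] by (intro bdd_aboveI) blast

lemma Omega_norm_le:
  assumes "\<And>s t. s \<in> I \<Longrightarrow> t \<in> I \<Longrightarrow> norm (R s t) \<le> K * \<bar>t - s\<bar> powr a" "0 \<le> K"
  shows "Omega_norm a I R \<le> K"
  unfolding Omega_norm_def using hoelder_quots_le[OF assms(1)] assms(2) by (intro cSup_least) auto

lemma norm_le_Omega2_norm:
  assumes "bdd_above (hoelder2_quots a b I B)" "s \<in> I" "u \<in> I" "t \<in> I" "u \<noteq> s" "t \<noteq> u"
  shows "norm (B s u t) \<le> Omega2_norm a b I B * (\<bar>u - s\<bar> powr a * \<bar>t - u\<bar> powr b)"
proof -
  have "norm (B s u t) / (\<bar>u - s\<bar> powr a * \<bar>t - u\<bar> powr b) \<le> Omega2_norm a b I B"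
    unfolding Omega2_norm_def using assms
    by (intro cSup_upper) (auto simp: hoelder2_quots_def)
  then show ?thesis using assms by (simp add: divide_le_eq)
qed

lemma Omega2_norm_nonneg: "bdd_above (hoelder2_quots a b I B) \<Longrightarrow> 0 \<le> Omega2_norm a b I B"
  unfolding Omega2_norm_def by (intro cSup_upper) auto

text \<open>
  The exponents \<open>\<rho> i\<close> and \<open>z - \<rho> i\<close> add up to \<open>z\<close> for every \<open>i\<close>, so only \<open>h powr z\<close> remains.
\<close>

lemma decomposition_bound:
  assumes dec: "is_decomposition z I A n B \<rho>"
    and "s \<in> I" "u \<in> I" "t \<in> I" "u \<noteq> s" "t \<noteq> u" and h: "\<bar>u - s\<bar> \<le> h" "\<bar>t - u\<bar> \<le> h"
  shows "norm (A s u t) \<le> (\<Sum>i<n. Omega2_norm (\<rho> i) (z - \<rho> i) I (B i)) * h powr z"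
proof -
  have "norm (B i s u t) \<le> Omega2_norm (\<rho> i) (z - \<rho> i) I (B i) * h powr z" if "i < n" for i
  proof -
    have i: "0 < \<rho> i" "\<rho> i < z" "bdd_above (hoelder2_quots (\<rho> i) (z - \<rho> i) I (B i))"
      using dec that by (auto simp: is_decomposition_def)
    have "norm (B i s u t)
        \<le> Omega2_norm (\<rho> i) (z - \<rho> i) I (B i) * (\<bar>u - s\<bar> powr \<rho> i * \<bar>t - u\<bar> powr (z - \<rho> i))"
      using i assms by (intro norm_le_Omega2_norm) auto
    also have "\<dots> \<le> Omega2_norm (\<rho> i) (z - \<rho> i) I (B i) * (h powr \<rho> i * h powr (z - \<rho> i))"
      using i h by (intro mult_left_mono mult_mono powr_mono2 Omega2_norm_nonneg) auto
    finally show ?thesis by (simp add: powr_add[symmetric])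
  qed
  then have "(\<Sum>i<n. norm (B i s u t)) \<le> (\<Sum>i<n. Omega2_norm (\<rho> i) (z - \<rho> i) I (B i) * h powr z)"
    by (intro sum_mono) auto
  moreover have "A s u t = (\<Sum>i<n. B i s u t)" using dec assms by (simp add: is_decomposition_def)
  ultimately show ?thesis
    using norm_sum[of "\<lambda>i. B i s u t" "{..<n}"] by (simp add: sum_distrib_right)
qed

lemma decomposition_bound_nonneg:
  "is_decomposition z I A n B \<rho> \<Longrightarrow> 0 \<le> (\<Sum>i<n. Omega2_norm (\<rho> i) (z - \<rho> i) I (B i))"
  by (intro sum_nonneg Omega2_norm_nonneg) (auto simp: is_decomposition_def)

lemma N_op_refl: "R s s = 0 \<Longrightarrow> N_op R s s t = 0" "R t t = 0 \<Longrightarrow> N_op R s t t = 0"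
  by (simp_all add: N_op_def)

text \<open>
  The series subtracted from \<open>R\<close> leaves the limit \<open>J\<close> of the Riemann sums.  It is midpoint additive, and
  its defect is of order \<open>z\<close> since those of \<open>R\<close> and of the series are; hence \<open>J\<close> is additive, which is
  the first claim.
\<close>

lemma sewing:
  fixes R :: "real \<Rightarrow> real \<Rightarrow> 'u::euclidean_space"
  assumes z: "z > 1"
    and cont: "continuous_on UNIV (\<lambda>(s, t). R s t)"
    and K: "0 \<le> K" 
    and bd: "\<And>s u t h. \<bar>u - s\<bar> \<le> h \<Longrightarrow> \<bar>t - u\<bar> \<le> h \<Longrightarrow> norm (N_op R s u t) \<le> K * h powr z"
  shows "N_op (sew (N_op R)) = N_op R"
    and "continuous_on UNIV (\<lambda>(s, t). sew (N_op R) s t)"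
    and "norm (sew (N_op R) s t) \<le> 1 / (2 powr z - 2) * K * \<bar>t - s\<bar> powr z"
proof -
  define L where "L = sew (N_op R)"
  let ?c = "1 / (2 powr z - 2) * K"
  have mid: "norm (N_op R s ((s + t) / 2) t) \<le> K * (\<bar>t - s\<bar> / 2) powr z" for s t
    by (rule bd) (auto simp: field_simps abs_if)
  show L_bd: "norm (sew (N_op R) s t) \<le> ?c * \<bar>t - s\<bar> powr z" for s t
    using sew_sums(2)[of UNIV z "N_op R" K s t] z mid by simp
  have "continuous_on UNIV (\<lambda>x::real \<times> real. (\<lambda>(s, t). R s t) (fst x, snd x) 
      - (\<lambda>(s, t). R s t) ((fst x + snd x) / 2, snd x) - (\<lambda>(s, t). R s t) (fst x, (fst x + snd x) / 2))"
    by (intro continuous_intros continuous_on_compose2[OF cont]) auto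
  then have "continuous_on UNIV (\<lambda>(s, t). N_op R s ((s + t) / 2) t)"
    by (simp add: N_op_def case_prod_unfold)
  then show L_cont: "continuous_on UNIV (\<lambda>(s, t). sew (N_op R) s t)"
    using continuous_on_sew[of z "N_op R" K] z mid by blast
  define J where "J s t = R s t - L s t" for s t
  have "N_op J s u t = 0" for s u t
  proof (rule bisect_invariant_additive[OF z])
    show "bisect J s t = J s t" for s t
      using bisect_sew[of z R K s t] z mid unfolding J_def L_def by blast
    have "continuous_on UNIV (\<lambda>x. (\<lambda>(s, t). R s t) x - (\<lambda>(s, t). L s t) x)"
      using cont L_cont unfolding L_def by (intro continuous_intros)
    then show "continuous_on UNIV (\<lambda>(s, t). J s t)" by (simp add: J_def case_prod_unfold)
    show "norm (N_op J s u t) \<le> (K + 3 * ?c) * (\<bar>u - s\<bar> + \<bar>t - u\<bar>) powr z" for s u t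
    proof -
      let ?h = "\<bar>u - s\<bar> + \<bar>t - u\<bar>"
      have c: "0 \<le> ?c" using K z powr_less_cancel_iff[of 2 1 z] by simp
      have "norm (L a b) \<le> ?c * ?h powr z" if "\<bar>b - a\<bar> \<le> ?h" for a b
      proof -
        have "norm (L a b) \<le> ?c * \<bar>b - a\<bar> powr z" using L_bd by (simp add: L_def)
        also have "\<dots> \<le> ?c * ?h powr z" using c that z by (intro mult_left_mono powr_mono2) auto
        finally show ?thesis .
      qed
      then have "norm (L s t) \<le> ?c * ?h powr z" "norm (L u t) \<le> ?c * ?h powr z"
        "norm (L s u) \<le> ?c * ?h powr z"
        by auto
      moreover have "norm (N_op R s u t) \<le> K * ?h powr z" by (rule bd) auto
      moreover have J_eq: "N_op J s u t = N_op R s u t - (L s t - L u t - L s u)"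
        by (simp add: N_op_def J_def)
      ultimately have "norm (N_op J s u t) \<le> K * ?h powr z + (?c * ?h powr z + ?c * ?h powr z + ?c * ?h powr z)"
        using norm_triangle_ineq4[of "N_op R s u t" "L s t - L u t - L s u"]
          norm_triangle_ineq4[of "L s t - L u t" "L s u"] norm_triangle_ineq4[of "L s t" "L u t"]
        unfolding J_eq by linarith
      then show ?thesis by (simp add: algebra_simps)
    qed
  qed
  then show "N_op (sew (N_op R)) = N_op R"
    by (auto simp: fun_eq_iff J_def N_op_def L_def algebra_simps)
qed

lemma sum_lessThan_add:
  fixes n m :: nat
  shows "sum f {..<n + m} = sum f {..<n} + (\<Sum>i<m. f (n + i) :: 'a::comm_monoid_add)"
  by (induction m) (simp_all add: add.assoc)

lemma Omega_C2_hoelder_add: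
  assumes "A \<in> Omega_C2_hoelder z I" "A' \<in> Omega_C2_hoelder z I"
  shows "(\<lambda>s u t. A s u t + A' s u t) \<in> Omega_C2_hoelder z I"
proof -
  obtain n B \<rho> n' B' \<rho>' where dec: "is_decomposition z I A n B \<rho>" "is_decomposition z I A' n' B' \<rho>'"
    using assms by (auto simp: Omega_C2_hoelder_def)
  have "is_decomposition z I (\<lambda>s u t. A s u t + A' s u t) (n + n')
      (\<lambda>i. if i < n then B i else B' (i - n)) (\<lambda>i. if i < n then \<rho> i else \<rho>' (i - n))"
    using dec unfolding is_decomposition_def sum_lessThan_add by auto
  then show ?thesis by (auto simp: Omega_C2_hoelder_def)
qed

lemma Omega_C2_hoelder_single:
  assumes "0 < a" "0 < b" "B \<in> Omega_C2 I" "bdd_above (hoelder2_quots a b I B)"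
  shows "B \<in> Omega_C2_hoelder (a + b) I"
proof -
  have "is_decomposition (a + b) I B 1 (\<lambda>_. B) (\<lambda>_. a)"
    using assms by (auto simp: is_decomposition_def)
  then show ?thesis by (auto simp: Omega_C2_hoelder_def)
qed

lemma Omega_C2_scaleR: "B \<in> Omega_C2 I \<Longrightarrow> (\<lambda>s u t. c *\<^sub>R B s u t) \<in> Omega_C2 I"
proof -
  assume B: "B \<in> Omega_C2 I"
  have "continuous_on (I \<times> I \<times> I) (\<lambda>x. c *\<^sub>R (\<lambda>(s, u, t). B s u t) x)"
    using B by (intro continuous_intros) (auto simp: Omega_C2_def)
  moreover have "bounded ((\<lambda>x. c *\<^sub>R (\<lambda>(s, u, t). B s u t) x) ` (I \<times> I \<times> I))"
    using B bounded_scaling[of "(\<lambda>(s, u, t). B s u t) ` (I \<times> I \<times> I)" c] by (simp add: Omega_C2_def image_image)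
  ultimately show ?thesis using B by (simp add: Omega_C2_def case_prod_unfold)
qed

lemma Omega_C_scaleR: "R \<in> Omega_C I \<Longrightarrow> (\<lambda>s t. c *\<^sub>R R s t) \<in> Omega_C I"
proof -
  assume B: "R \<in> Omega_C I"
  have "continuous_on (I \<times> I) (\<lambda>x. c *\<^sub>R (\<lambda>(s, t). R s t) x)"
    using B by (intro continuous_intros) (auto simp: Omega_C_def)
  moreover have "bounded ((\<lambda>x. c *\<^sub>R (\<lambda>(s, t). R s t) x) ` (I \<times> I))"
    using B bounded_scaling[of "(\<lambda>(s, t). R s t) ` (I \<times> I)" c] by (simp add: Omega_C_def image_image)
  ultimately show ?thesis using B by (simp add: Omega_C_def case_prod_unfold)
qed

lemma Omega_C_add: "R \<in> Omega_C I \<Longrightarrow> S \<in> Omega_C I \<Longrightarrow> (\<lambda>s t. R s t + S s t) \<in> Omega_C I"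
proof -
  assume B: "R \<in> Omega_C I" "S \<in> Omega_C I"
  have "continuous_on (I \<times> I) (\<lambda>x. (\<lambda>(s, t). R s t) x + (\<lambda>(s, t). S s t) x)"
    using B by (intro continuous_intros) (auto simp: Omega_C_def)
  moreover have "bounded ((\<lambda>x. (\<lambda>(s, t). R s t) x + (\<lambda>(s, t). S s t) x) ` (I \<times> I))"
    using B by (intro bounded_plus_comp) (auto simp: Omega_C_def)
  ultimately show ?thesis using B by (simp add: Omega_C_def case_prod_unfold)
qed

lemma Omega_C2_hoelder_scaleR:
  fixes A :: "real \<Rightarrow> real \<Rightarrow> real \<Rightarrow> 'u::euclidean_space"
  assumes "A \<in> Omega_C2_hoelder z I"
  shows "(\<lambda>s u t. c *\<^sub>R A s u t) \<in> Omega_C2_hoelder z I"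
proof -
  obtain n B \<rho> where dec: "is_decomposition z I A n B \<rho>"
    using assms by (auto simp: Omega_C2_hoelder_def)
  have "bdd_above (hoelder2_quots a b I (\<lambda>s u t. c *\<^sub>R C s u t))"
    if bdd: "bdd_above (hoelder2_quots a b I C)" for a b and C :: "real \<Rightarrow> real \<Rightarrow> real \<Rightarrow> 'u"
  proof -
    have "hoelder2_quots a b I (\<lambda>s u t. c *\<^sub>R C s u t) \<subseteq> (\<lambda>x. \<bar>c\<bar> * x) ` hoelder2_quots a b I C"
      by (force simp: hoelder2_quots_def image_iff)
    moreover have "bdd_above ((\<lambda>x. \<bar>c\<bar> * x) ` hoelder2_quots a b I C)"
      using bdd by (intro bdd_above_image_mono) (auto simp: mono_def intro: mult_left_mono)
    ultimately show ?thesis by (rule bdd_above_mono[rotated])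
  qed
  then have "is_decomposition z I (\<lambda>s u t. c *\<^sub>R A s u t) n (\<lambda>i s u t. c *\<^sub>R B i s u t) \<rho>"
    using dec unfolding is_decomposition_def by (auto simp: Omega_C2_scaleR scaleR_sum_right)
  then show ?thesis by (auto simp: Omega_C2_hoelder_def)
qed

lemma Omega_C2_hoelder_cong:
  assumes "A \<in> Omega_C2_hoelder z I" "\<And>s u t. s \<in> I \<Longrightarrow> u \<in> I \<Longrightarrow> t \<in> I \<Longrightarrow> A s u t = A' s u t"
  shows "A' \<in> Omega_C2_hoelder z I"
  using assms unfolding Omega_C2_hoelder_def is_decomposition_def by simp

lemma Z2_space_lincomb:
  assumes "A \<in> Z2_space z I" "A' \<in> Z2_space z I"
  shows "(\<lambda>s u t. c *\<^sub>R A s u t + A' s u t) \<in> Z2_space z I"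
proof -
  obtain R R' where R: "R \<in> Omega_C I" "R' \<in> Omega_C I"
    "\<forall>s\<in>I. \<forall>u\<in>I. \<forall>t\<in>I. A s u t = N_op R s u t" "\<forall>s\<in>I. \<forall>u\<in>I. \<forall>t\<in>I. A' s u t = N_op R' s u t"
    using assms by (auto simp: Z2_space_def)
  have "\<forall>s\<in>I. \<forall>u\<in>I. \<forall>t\<in>I. c *\<^sub>R A s u t + A' s u t = N_op (\<lambda>s t. c *\<^sub>R R s t + R' s t) s u t"
    using R(3,4) by (simp add: N_op_def scaleR_diff_right)
  moreover have "(\<lambda>s t. c *\<^sub>R R s t + R' s t) \<in> Omega_C I"
    using R by (intro Omega_C_add Omega_C_scaleR)
  ultimately show ?thesis
    using assms unfolding Z2_space_def
    by (auto intro!: Omega_C2_hoelder_add Omega_C2_hoelder_scaleR)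
qed

text \<open>
  Zero outside the domain, as the last clause of \<^const>\<open>is_Lambda\<close> demands.
\<close>

definition sewing_map :: "real \<Rightarrow> (real \<Rightarrow> real \<Rightarrow> real \<Rightarrow> 'u::euclidean_space) \<Rightarrow> real \<Rightarrow> real \<Rightarrow> 'u" where
  "sewing_map z A = (if A \<in> Z2_space z UNIV then sew A else (\<lambda>s t. 0))"

lemma Z2_space_line_E:
  assumes "A \<in> Z2_space z UNIV"
  obtains R where "A = N_op R" "continuous_on UNIV (\<lambda>(s, t). R s t)" "\<And>s. R s s = 0"
proof -
  obtain R where "R \<in> Omega_C UNIV" "A = N_op R" using assms by (auto simp: Z2_space_def fun_eq_iff)
  then show thesis using that[of R] by (simp add: Omega_C_def)
qed

text \<open>
  The norms of the summands carry no information for \<open>u = s\<close> or \<open>t = u\<close>, but there \<open>N R\<close> vanishes because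
  \<open>R\<close> vanishes on the diagonal.
\<close>

lemma decomposition_bound_line:
  assumes "A \<in> Z2_space z UNIV" "is_decomposition z UNIV A n B \<rho>" "\<bar>u - s\<bar> \<le> h" "\<bar>t - u\<bar> \<le> h"
  shows "norm (A s u t) \<le> (\<Sum>i<n. Omega2_norm (\<rho> i) (z - \<rho> i) UNIV (B i)) * h powr z"
proof (cases "u = s \<or> t = u")
  case True
  then have "A s u t = 0" using assms(1) by (elim Z2_space_line_E) (auto simp: N_op_refl)
  then show ?thesis using decomposition_bound_nonneg[OF assms(2)] by simp
qed (use decomposition_bound[OF assms(2)] assms in auto)

lemma sew_on_Z2_space:
  assumes z: "z > 1" and A: "A \<in> Z2_space z UNIV"
  shows "N_op (sew A) = A" "continuous_on UNIV (\<lambda>(s, t). sew A s t)"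
    and "is_decomposition z UNIV A n B \<rho> \<Longrightarrow> norm (sew A s t)
      \<le> 1 / (2 powr z - 2) * (\<Sum>i<n. Omega2_norm (\<rho> i) (z - \<rho> i) UNIV (B i)) * \<bar>t - s\<bar> powr z"
    and "\<exists>K. \<forall>s t. norm (A s ((s + t) / 2) t) \<le> K * (\<bar>t - s\<bar> / 2) powr z"
proof -
  obtain R where R: "A = N_op R" "continuous_on UNIV (\<lambda>(s, t). R s t)" "\<And>s. R s s = 0"
    using Z2_space_line_E[OF A] by blast
  obtain n' B' \<rho>' where dec: "is_decomposition z UNIV A n' B' \<rho>'"
    using A by (auto simp: Z2_space_def Omega_C2_hoelder_def)
  note * = sewing[OF z R(2) decomposition_bound_nonneg decomposition_bound_line[OF A, unfolded R(1)]]
  show "N_op (sew A) = A" "continuous_on UNIV (\<lambda>(s, t). sew A s t)"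
    using *(1,2)[OF dec[unfolded R(1)] dec[unfolded R(1)]] by (simp_all add: R(1))
  show "norm (sew A s t)
      \<le> 1 / (2 powr z - 2) * (\<Sum>i<n. Omega2_norm (\<rho> i) (z - \<rho> i) UNIV (B i)) * \<bar>t - s\<bar> powr z"
    if "is_decomposition z UNIV A n B \<rho>"
    using *(3)[OF that[unfolded R(1)] that[unfolded R(1)]] by (simp add: R(1))
  show "\<exists>K. \<forall>s t. norm (A s ((s + t) / 2) t) \<le> K * (\<bar>t - s\<bar> / 2) powr z"
    using decomposition_bound_line[OF A dec]
    by (intro exI[of _ "\<Sum>i<n'. Omega2_norm (\<rho>' i) (z - \<rho>' i) UNIV (B' i)"] allI)
       (auto simp: field_simps abs_if)
qed

lemma sew_lincomb:
  fixes A A' :: "real \<Rightarrow> real \<Rightarrow> real \<Rightarrow> 'u::euclidean_space"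
  assumes z: "z > 1" and A: "A \<in> Z2_space z UNIV" "A' \<in> Z2_space z UNIV"
  shows "sew (\<lambda>s u t. c *\<^sub>R A s u t + A' s u t) s t = c *\<^sub>R sew A s t + sew A' s t"
proof -
  obtain K K' where K: "\<And>s t. norm (A s ((s + t) / 2) t) \<le> K * (\<bar>t - s\<bar> / 2) powr z"
    "\<And>s t. norm (A' s ((s + t) / 2) t) \<le> K' * (\<bar>t - s\<bar> / 2) powr z"
    using sew_on_Z2_space(4)[OF z] A by metis
  have "(\<lambda>n. c *\<^sub>R (bisect ^^ n) (\<lambda>s t. A s ((s + t) / 2) t) s t
      + (bisect ^^ n) (\<lambda>s t. A' s ((s + t) / 2) t) s t) sums (c *\<^sub>R sew A s t + sew A' s t)"
    using sew_sums(1)[of UNIV z A K s t] sew_sums(1)[of UNIV z A' K' s t] z K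
    by (intro sums_add sums_scaleR_right) auto
  then show ?thesis
    unfolding bisect_pow_lincomb[symmetric] sew_def[of "\<lambda>s u t. c *\<^sub>R A s u t + A' s u t"]
    by (rule sums_unique[symmetric])
qed

text \<open>
  Existence of \<open>\<Lambda>\<close>.  The sewing series is computed from \<open>A\<close> itself, so one map obeys the bounds coming
  from all decompositions of \<open>A\<close> at once.
\<close>

lemma sewing_map_is_Lambda:
  assumes z: "z > 1"
  shows "is_Lambda z (sewing_map z :: (real \<Rightarrow> real \<Rightarrow> real \<Rightarrow> 'u::euclidean_space) \<Rightarrow> _)"
  unfolding is_Lambda_def
proof (intro conjI ballI allI impI)
  fix A :: "real \<Rightarrow> real \<Rightarrow> real \<Rightarrow> 'u" assume A: "A \<in> Z2_space z UNIV"
  obtain n B \<rho> where dec: "is_decomposition z UNIV A n B \<rho>"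
    using A by (auto simp: Z2_space_def Omega_C2_hoelder_def)
  show "continuous_on UNIV (\<lambda>(s, t). sewing_map z A s t)" "N_op (sewing_map z A) = A"
    using sew_on_Z2_space[OF z A] A by (simp_all add: sewing_map_def)
  show "sewing_map z A s s = 0" for s
    using sew_on_Z2_space(3)[OF z A dec, of s s] A by (simp add: sewing_map_def)
  show "bdd_above (hoelder_quots z UNIV (sewing_map z A))"
    by (rule hoelder_quots_bdd) (use sew_on_Z2_space(3)[OF z A dec] A in \<open>simp only: sewing_map_def if_True\<close>)
next
  fix A A' :: "real \<Rightarrow> real \<Rightarrow> real \<Rightarrow> 'u" assume A: "A \<in> Z2_space z UNIV" "A' \<in> Z2_space z UNIV"
  show "sewing_map z (\<lambda>s u t. A s u t + A' s u t) = (\<lambda>s t. sewing_map z A s t + sewing_map z A' s t)"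
    using sew_lincomb[OF z A, of 1] Z2_space_lincomb[OF A, of 1] A by (simp add: sewing_map_def fun_eq_iff)
next
  fix c :: real and A :: "real \<Rightarrow> real \<Rightarrow> real \<Rightarrow> 'u" assume A: "A \<in> Z2_space z UNIV"
  have "(\<lambda>s u t. (-1) *\<^sub>R A s u t + A s u t) \<in> Z2_space z UNIV" using A by (intro Z2_space_lincomb)
  then have 0: "(\<lambda>s u t. 0 :: 'u) \<in> Z2_space z UNIV" by simp
  have "sew (\<lambda>s u t. 0 :: 'u) s t = 0" for s t using sew_lincomb[OF z A A, of "-1"] by simp
  then show "sewing_map z (\<lambda>s u t. c *\<^sub>R A s u t) = (\<lambda>s t. c *\<^sub>R sewing_map z A s t)"
    using sew_lincomb[OF z A 0, of c] Z2_space_lincomb[OF A 0, of c] A by (simp add: sewing_map_def fun_eq_iff)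
next
  fix A :: "real \<Rightarrow> real \<Rightarrow> real \<Rightarrow> 'u" and n B \<rho>
  assume A: "A \<in> Z2_space z UNIV" and dec: "is_decomposition z UNIV A n B \<rho>"
  have "(2::real) < 2 powr z" using z powr_less_cancel_iff[of 2 1 z] by simp
  then show "Omega_norm z UNIV (sewing_map z A)
      \<le> 1 / (2 powr z - 2) * (\<Sum>i<n. Omega2_norm (\<rho> i) (z - \<rho> i) UNIV (B i))"
    using sew_on_Z2_space(3)[OF z A dec] decomposition_bound_nonneg[OF dec] A
    by (intro Omega_norm_le) (auto simp: sewing_map_def)
next
  fix A :: "real \<Rightarrow> real \<Rightarrow> real \<Rightarrow> 'u" assume "A \<notin> Z2_space z UNIV"
  then show "sewing_map z A = (\<lambda>s t. 0)" by (simp add: sewing_map_def)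
qed

lemma additive_hoelder_eq_0:
  fixes D :: "real \<Rightarrow> real \<Rightarrow> 'u::euclidean_space"
  assumes "z > 1" "N_op D = (\<lambda>s u t. 0)" "\<And>s t. norm (D s t) \<le> K * \<bar>t - s\<bar> powr z"
  shows "D s t = 0"
proof (rule bisect_invariant_eq_0[where I = UNIV and \<omega> = "\<lambda>x. K * \<bar>x\<bar> powr z"])
  show "bisect D s t = D s t" for s t
    using fun_cong[OF fun_cong[OF fun_cong[OF assms(2), of s], of "(s + t) / 2"], of t]
    by (simp add: N_op_def bisect_def algebra_simps)
  show "(\<lambda>n. 2 ^ n * (K * \<bar>x / 2 ^ n\<bar> powr z)) \<longlonglongrightarrow> 0" for x
    using powr_rescale_lim[OF assms(1)] .
qed (use assms in auto)

text \<open>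
  The difference of two candidates for \<open>\<Lambda> A\<close> is additive and has a finite \<open>z\<close>-norm with \<open>z > 1\<close>, so it is
  zero; the description of \<open>\<Lambda>\<close> therefore determines it.
\<close>

lemma Lambda_line_eq_sewing_map:
  assumes z: "z > 1"
  shows "(Lambda_line z :: (real \<Rightarrow> real \<Rightarrow> real \<Rightarrow> 'u::euclidean_space) \<Rightarrow> _) = sewing_map z"
  unfolding Lambda_line_def
proof (rule the_equality)
  show "is_Lambda z (sewing_map z :: (real \<Rightarrow> real \<Rightarrow> real \<Rightarrow> 'u) \<Rightarrow> _)"
    by (rule sewing_map_is_Lambda[OF z])
next
  fix L :: "(real \<Rightarrow> real \<Rightarrow> real \<Rightarrow> 'u) \<Rightarrow> real \<Rightarrow> real \<Rightarrow> 'u" assume L: "is_Lambda z L"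
  note S = sewing_map_is_Lambda[OF z, where ?'u = 'u]
  show "L = sewing_map z"
  proof (rule ext)
    fix A show "L A = sewing_map z A"
    proof (cases "A \<in> Z2_space z UNIV")
      case False
      then show ?thesis using L S by (simp add: is_Lambda_def)
    next
      case True
      have bd: "norm (M A s t) \<le> Omega_norm z UNIV (M A) * \<bar>t - s\<bar> powr z" if "is_Lambda z M" for M s t
        using that True by (intro norm_le_Omega_norm) (auto simp: is_Lambda_def)
      have "L A s t - sewing_map z A s t = 0" for s t
      proof (rule additive_hoelder_eq_0[OF z])
        have "N_op (L A) = A" "N_op (sewing_map z A) = A"
          using L S True by (simp_all add: is_Lambda_def)
        moreover have "N_op (\<lambda>s t. L A s t - sewing_map z A s t)
            = (\<lambda>s u t. N_op (L A) s u t - N_op (sewing_map z A) s u t)"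
          by (simp add: N_op_def fun_eq_iff)
        ultimately show "N_op (\<lambda>s t. L A s t - sewing_map z A s t) = (\<lambda>s u t. 0)"
          by simp
        show "norm (L A s t - sewing_map z A s t)
            \<le> (Omega_norm z UNIV (L A) + Omega_norm z UNIV (sewing_map z A)) * \<bar>t - s\<bar> powr z" for s t
          using norm_triangle_ineq4[of "L A s t" "sewing_map z A s t"] bd[OF L, of s t] bd[OF S, of s t]
          by (simp add: algebra_simps)
      qed
      then show ?thesis by (simp add: fun_eq_iff)
    qed
  qed
qed

text \<open>
  \<^const>\<open>Lambda\<close> on \<open>I\<close> is computed from an arbitrarily chosen extension, and says nothing about \<open>A\<close> unless
  there is one.
\<close>

definition extendable :: "real \<Rightarrow> real set \<Rightarrow> (real \<Rightarrow> real \<Rightarrow> real \<Rightarrow> 'u::euclidean_space) \<Rightarrow> bool" where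
  "extendable z I A \<longleftrightarrow> (\<exists>A'\<in>Z2_space z UNIV. \<forall>s\<in>I. \<forall>u\<in>I. \<forall>t\<in>I. A' s u t = A s u t)"

text \<open>
  The series at \<open>s, t \<in> I\<close> involves only triples in \<open>I\<close>, where all extensions agree.
\<close>

lemma Lambda_eq_sew:
  assumes z: "z > 1" and I: "is_interval I" and ext: "extendable z I A"
  shows "s \<in> I \<Longrightarrow> t \<in> I \<Longrightarrow> Lambda z I A s t = sew A s t"
    and "s \<in> I \<Longrightarrow> u \<in> I \<Longrightarrow> t \<in> I \<Longrightarrow> N_op (Lambda z I A) s u t = A s u t"
    and "\<exists>K. \<forall>s\<in>I. \<forall>t\<in>I. norm (A s ((s + t) / 2) t) \<le> K * (\<bar>t - s\<bar> / 2) powr z"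
proof -
  define A' where "A' = (SOME A'. A' \<in> Z2_space z UNIV \<and> (\<forall>s\<in>I. \<forall>u\<in>I. \<forall>t\<in>I. A' s u t = A s u t))"
  have "A' \<in> Z2_space z UNIV \<and> (\<forall>s\<in>I. \<forall>u\<in>I. \<forall>t\<in>I. A' s u t = A s u t)"
    using someI_ex[of "\<lambda>A'. A' \<in> Z2_space z UNIV \<and> (\<forall>s\<in>I. \<forall>u\<in>I. \<forall>t\<in>I. A' s u t = A s u t)"] ext
    unfolding A'_def extendable_def by blast
  then have A': "A' \<in> Z2_space z UNIV" "\<And>s u t. s \<in> I \<Longrightarrow> u \<in> I \<Longrightarrow> t \<in> I \<Longrightarrow> A' s u t = A s u t"
    by auto
  have L: "Lambda z I A = sew A'"
    using A'(1) by (simp add: Lambda_def A'_def[symmetric] Lambda_line_eq_sewing_map[OF z] sewing_map_def)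
  have "(bisect ^^ n) (\<lambda>s t. A' s ((s + t) / 2) t) s t = (bisect ^^ n) (\<lambda>s t. A s ((s + t) / 2) t) s t"
    if "s \<in> I" "t \<in> I" for n s t
    using that by (intro bisect_pow_cong[OF I]) (auto intro!: A' midpoint_mem_interval[OF I])
  then show "s \<in> I \<Longrightarrow> t \<in> I \<Longrightarrow> Lambda z I A s t = sew A s t"
    by (simp add: L sew_def)
  show "s \<in> I \<Longrightarrow> u \<in> I \<Longrightarrow> t \<in> I \<Longrightarrow> N_op (Lambda z I A) s u t = A s u t"
    using sew_on_Z2_space(1)[OF z A'(1)] A'(2) by (simp add: L)
  show "\<exists>K. \<forall>s\<in>I. \<forall>t\<in>I. norm (A s ((s + t) / 2) t) \<le> K * (\<bar>t - s\<bar> / 2) powr z"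
    using sew_on_Z2_space(4)[OF z A'(1)] A'(2) midpoint_mem_interval[OF I] by metis
qed

text \<open>
  A bound at midpoints of points of \<open>I\<close> is enough.  So the estimate holds with norms taken on \<open>I\<close>, although
  the extension may have larger ones.
\<close>

lemma Lambda_bound:
  assumes z: "z > 1" and I: "is_interval I" and ext: "extendable z I A"
    and bd: "\<And>s t. s \<in> I \<Longrightarrow> t \<in> I \<Longrightarrow> norm (A s ((s + t) / 2) t) \<le> K * (\<bar>t - s\<bar> / 2) powr z"
    and st: "s \<in> I" "t \<in> I"
  shows "norm (Lambda z I A s t) \<le> 1 / (2 powr z - 2) * K * \<bar>t - s\<bar> powr z"
  using Lambda_eq_sew(1)[OF z I ext st] sew_sums(2)[of I z A K s t] I z bd st by simp

lemma Lambda_lincomb: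
  assumes z: "z > 1" and I: "is_interval I"
    and ext: "extendable z I A" "extendable z I A'" "extendable z I B"
    and B: "\<And>s u t. s \<in> I \<Longrightarrow> u \<in> I \<Longrightarrow> t \<in> I \<Longrightarrow> B s u t = c *\<^sub>R A s u t + A' s u t"
    and st: "s \<in> I" "t \<in> I"
  shows "Lambda z I B s t = c *\<^sub>R Lambda z I A s t + Lambda z I A' s t"
proof -
  obtain K K' where K: "\<forall>s\<in>I. \<forall>t\<in>I. norm (A s ((s + t) / 2) t) \<le> K * (\<bar>t - s\<bar> / 2) powr z"
    "\<forall>s\<in>I. \<forall>t\<in>I. norm (A' s ((s + t) / 2) t) \<le> K' * (\<bar>t - s\<bar> / 2) powr z"
    using Lambda_eq_sew(3)[OF z I] ext by metis
  have "(bisect ^^ n) (\<lambda>s t. B s ((s + t) / 2) t) s t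
      = (bisect ^^ n) (\<lambda>s t. c *\<^sub>R A s ((s + t) / 2) t + A' s ((s + t) / 2) t) s t" for n
    using st by (intro bisect_pow_cong[OF I]) (auto intro!: B midpoint_mem_interval[OF I])
  moreover have "(\<lambda>n. c *\<^sub>R (bisect ^^ n) (\<lambda>s t. A s ((s + t) / 2) t) s t
      + (bisect ^^ n) (\<lambda>s t. A' s ((s + t) / 2) t) s t) sums (c *\<^sub>R sew A s t + sew A' s t)"
    using sew_sums(1)[of I z A K s t] sew_sums(1)[of I z A' K' s t] z K I st
    by (intro sums_add sums_scaleR_right) auto
  ultimately have "sew B s t = c *\<^sub>R sew A s t + sew A' s t"
    by (simp add: sew_def[of B] bisect_pow_lincomb sums_iff)
  then show ?thesis using ext by (simp add: Lambda_eq_sew(1)[OF z I _ st])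
qed

section \<open>Tensors and contractions\<close>

lemma norm_contract_le: "norm (contract P x) \<le> norm P * norm x"
proof -
  have "norm (contract P x) \<le> (\<Sum>\<nu>\<in>UNIV. \<bar>x $ \<nu>\<bar> * \<bar>norm (P $ \<nu>)\<bar>)"
    unfolding contract_def by (rule order.trans[OF norm_sum]) simp
  also have "\<dots> \<le> L2_set (\<lambda>\<nu>. x $ \<nu>) UNIV * L2_set (\<lambda>\<nu>. norm (P $ \<nu>)) UNIV"
    by (rule L2_set_mult_ineq)
  finally show ?thesis by (simp add: norm_vec_def mult.commute L2_set_def)
qed

lemma bounded_bilinear_contract: "bounded_bilinear contract"
proof (rule bounded_bilinear.intro)
  show "\<exists>K. \<forall>P x. norm (contract P x) \<le> norm P * norm x * K"
    using norm_contract_le by (intro exI[of _ 1]) auto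
qed (simp_all add: contract_def sum.distrib scaleR_sum_right algebra_simps)

lemma norm_vec_le_mult:
  fixes F :: "'a::real_normed_vector^'n"
  assumes "\<And>i. norm (F $ i) \<le> c * norm (x $ i)"
  shows "norm F \<le> c * norm (x :: 'b::real_normed_vector^'n)"
proof (cases "0 \<le> c")
  case True
  have "norm F \<le> L2_set (\<lambda>i. c * norm (x $ i)) UNIV"
    unfolding norm_vec_def using assms by (intro L2_set_mono) auto
  also have "\<dots> = c * norm x" using True by (simp add: norm_vec_def L2_set_right_distrib)
  finally show ?thesis .
next
  case False
  have "norm (x $ i) = 0" for i
  proof (rule ccontr)
    assume "norm (x $ i) \<noteq> 0"
    then have "c * norm (x $ i) < 0" using False by (intro mult_neg_pos) auto
    then show False using assms[of i] norm_ge_zero[of "F $ i"] by linarith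
  qed
  moreover have "norm (F $ i) \<le> 0" for i using assms[of i] calculation[of i] by simp
  ultimately have "F = 0" "x = 0" by (simp_all add: vec_eq_iff)
  then show ?thesis by simp
qed

lemma norm_tensor_le: "norm (tensor a b) \<le> norm a * norm b"
proof -
  have "tensor a b $ \<mu> = a $ \<mu> *\<^sub>R b" for \<mu> by (simp add: tensor_def vec_eq_iff)
  then show ?thesis using norm_vec_le_mult[of "tensor a b" "norm b" a] by (simp add: mult.commute)
qed

lemma bounded_bilinear_tensor: "bounded_bilinear tensor"
proof (rule bounded_bilinear.intro)
  show "\<exists>K. \<forall>P x. norm (tensor P x) \<le> norm P * norm x * K"
    using norm_tensor_le by (intro exI[of _ 1]) auto
qed (simp_all add: tensor_def vec_eq_iff algebra_simps)

lemmas tensor_simps =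
  bounded_bilinear.add_left[OF bounded_bilinear_tensor] bounded_bilinear.add_right[OF bounded_bilinear_tensor]
  bounded_bilinear.diff_left[OF bounded_bilinear_tensor] bounded_bilinear.diff_right[OF bounded_bilinear_tensor]
  bounded_bilinear.scaleR_left[OF bounded_bilinear_tensor] bounded_bilinear.scaleR_right[OF bounded_bilinear_tensor]
  bounded_bilinear.zero_left[OF bounded_bilinear_tensor] bounded_bilinear.zero_right[OF bounded_bilinear_tensor]

lemmas contract_simps =
  bounded_bilinear.add_left[OF bounded_bilinear_contract] bounded_bilinear.add_right[OF bounded_bilinear_contract]
  bounded_bilinear.diff_left[OF bounded_bilinear_contract] bounded_bilinear.diff_right[OF bounded_bilinear_contract]
  bounded_bilinear.scaleR_left[OF bounded_bilinear_contract] bounded_bilinear.scaleR_right[OF bounded_bilinear_contract]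
  bounded_bilinear.zero_left[OF bounded_bilinear_contract] bounded_bilinear.zero_right[OF bounded_bilinear_contract]

lemma norm_transpose: "norm (transpose P) = norm (P :: real^'n^'m)"
proof -
  have "(\<Sum>i\<in>UNIV. \<Sum>j\<in>UNIV. (P $ j $ i)\<^sup>2) = (\<Sum>j\<in>UNIV. \<Sum>i\<in>UNIV. (P $ j $ i)\<^sup>2)"
    by (rule sum.swap)
  then show ?thesis by (simp add: norm_vec_def L2_set_def transpose_def sum_nonneg)
qed

text \<open>
  In matrix notation \<open>contract2 P Q M\<close> is the product of the transpose of \<open>P\<close> with \<open>M\<close> and \<open>Q\<close>: two successive
  contractions, each of which costs at most a Frobenius norm by Cauchy-Schwarz.
\<close>

lemma norm_contract2_le: "norm (contract2 P Q M) \<le> norm P * norm Q * norm M"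
proof -
  define MQ where "MQ = (\<chi> \<mu>'. contract Q (M $ \<mu>'))"
  have "norm MQ \<le> norm Q * norm M"
    by (rule norm_vec_le_mult) (simp add: MQ_def norm_contract_le)
  moreover have "contract2 P Q M $ \<mu> = contract MQ (transpose P $ \<mu>)" for \<mu>
    by (simp add: contract2_def contract_def MQ_def transpose_def vec_eq_iff sum_distrib_left mult_ac)
  then have "norm (contract2 P Q M) \<le> norm MQ * norm (transpose P)"
    using norm_vec_le_mult[of "contract2 P Q M" "norm MQ" "transpose P"] by (simp add: norm_contract_le)
  ultimately have "norm (contract2 P Q M) \<le> (norm Q * norm M) * norm P"
    unfolding norm_transpose by (meson mult_right_mono norm_ge_zero order.trans)
  then show ?thesis by (simp add: mult_ac)
qed

lemma contract2_simps:
  "contract2 (P + P') Q M = contract2 P Q M + contract2 P' Q M"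
  "contract2 P (Q + Q') M = contract2 P Q M + contract2 P Q' M"
  "contract2 P Q (M + M') = contract2 P Q M + contract2 P Q M'"
  "contract2 (P - P') Q M = contract2 P Q M - contract2 P' Q M"
  "contract2 P (Q - Q') M = contract2 P Q M - contract2 P Q' M"
  "contract2 P Q (M - M') = contract2 P Q M - contract2 P Q M'"
  "contract2 (c *\<^sub>R P) Q M = c *\<^sub>R contract2 P Q M"
  "contract2 P (c *\<^sub>R Q) M = c *\<^sub>R contract2 P Q M"
  "contract2 0 Q M = 0" "contract2 P 0 M = 0" "contract2 P Q 0 = 0"
  by (simp_all add: contract2_def vec_eq_iff sum.distrib sum_subtractf sum_distrib_left algebra_simps)

lemma contract2_tensor: "contract2 P Q (tensor x y) = tensor (contract P x) (contract Q y)"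
  by (simp add: contract2_def tensor_def contract_def vec_eq_iff sum_product mult_ac)

lemma continuous_on_contract2 [continuous_intros]:
  assumes "continuous_on S P" "continuous_on S Q" "continuous_on S M"
  shows "continuous_on S (\<lambda>x. contract2 (P x) (Q x) (M x))"
  unfolding contract2_def by (intro continuous_intros assms)

lemmas [continuous_intros] =
  bounded_bilinear.continuous_on[OF bounded_bilinear_tensor]
  bounded_bilinear.continuous_on[OF bounded_bilinear_contract]

text \<open>
  The component \<open>Z W'\<close> of the integral, as a tensor with one lower index.
\<close>

definition tensor_dual :: "real^'n \<Rightarrow> real^'n^'n \<Rightarrow> real^'n^'n^'n" where
  "tensor_dual a P = (\<chi> \<kappa>. tensor a (P $ \<kappa>))"

lemma norm_tensor_dual_le: "norm (tensor_dual a P) \<le> norm a * norm P"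
  by (rule norm_vec_le_mult) (simp add: tensor_dual_def norm_tensor_le)

lemma tensor_dual_simps:
  "tensor_dual (a + b) P = tensor_dual a P + tensor_dual b P"
  "tensor_dual a (P + Q) = tensor_dual a P + tensor_dual a Q"
  "tensor_dual (a - b) P = tensor_dual a P - tensor_dual b P"
  "tensor_dual a (P - Q) = tensor_dual a P - tensor_dual a Q"
  "tensor_dual (c *\<^sub>R a) P = c *\<^sub>R tensor_dual a P"
  "tensor_dual a (c *\<^sub>R P) = c *\<^sub>R tensor_dual a P"
  by (simp_all add: tensor_dual_def tensor_simps vec_eq_iff)

text \<open>
  This identity makes \<open>Z W'\<close> the derivative of the integral: the linear part \<open>Z \<delta>W\<close> of the germ becomes
  \<open>Z W' \<delta>X\<close> up to \<open>Z\<close> times the remainder of \<open>W\<close>.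
\<close>

lemma contract_tensor_dual: "contract (tensor_dual a P) x = tensor a (contract P x)"
  by (simp add: tensor_dual_def contract_def tensor_def vec_eq_iff sum_distrib_left mult_ac)

section \<open>Pointwise bounds for paths and controlled paths\<close>

text \<open>
  The power bound serves for \<open>x \<le> 1\<close> and the constant bound for \<open>x \<ge> 1\<close>.  So on unbounded intervals, too,
  boundedness allows a smaller Hoelder exponent.
\<close>

lemma le_lower_powr:
  fixes v K x a b :: real
  assumes "v \<le> K" "v \<le> K * x powr a" "0 \<le> K" "0 \<le> b" "b \<le> a" "0 \<le> x"
  shows "v \<le> K * x powr b"
proof (cases "x \<le> 1")
  case True
  have "x powr a \<le> x powr b"
    using True assms by (cases "x = 0") (auto intro: powr_mono')
  then show ?thesis using assms by (meson mult_left_mono order.trans)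
next
  case False
  then have "1 \<le> x powr b" using assms by (intro ge_one_powr_ge_zero) auto
  then show ?thesis using assms by (metis mult_left_mono mult.right_neutral order.trans)
qed

lemma incr_self [simp]: "incr f s s = 0"
  by (simp add: incr_def)

text \<open>
  One constant for the sup norm and the Hoelder norm.  Unlike the suprema, such a bound passes to limits
  and to linear combinations without any side condition.
\<close>

definition path_bound :: "real \<Rightarrow> real set \<Rightarrow> (real \<Rightarrow> 'u::euclidean_space) \<Rightarrow> real \<Rightarrow> bool" where
  "path_bound a I f K \<longleftrightarrow> 0 \<le> K \<and> (\<forall>t\<in>I. norm (f t) \<le> K) \<and>
     (\<forall>s\<in>I. \<forall>t\<in>I. norm (incr f s t) \<le> K * \<bar>t - s\<bar> powr a)"

lemma path_bound_incr_le:
  assumes "path_bound a I f K" "s \<in> I" "t \<in> I"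
  shows "norm (incr f s t) \<le> 2 * K"
proof -
  have "norm (f s) \<le> K" "norm (f t) \<le> K" using assms by (auto simp: path_bound_def)
  then show ?thesis using norm_triangle_ineq4[of "f t" "f s"] by (simp add: incr_def)
qed

lemma path_bound_weaken:
  assumes "path_bound a I f K" "0 < b" "b \<le> a"
  shows "path_bound b I f (2 * K)"
proof -
  have "norm (incr f s t) \<le> 2 * K * \<bar>t - s\<bar> powr b" if "s \<in> I" "t \<in> I" for s t
  proof (rule le_lower_powr)
    have f: "norm (f s) \<le> K" "norm (f t) \<le> K" "norm (incr f s t) \<le> K * \<bar>t - s\<bar> powr a" "0 \<le> K"
      using assms that by (auto simp: path_bound_def)
    show "norm (incr f s t) \<le> 2 * K" using path_bound_incr_le[OF assms(1) that] .
    have "K * \<bar>t - s\<bar> powr a \<le> 2 * K * \<bar>t - s\<bar> powr a" using f(4) by (intro mult_right_mono) auto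
    then show "norm (incr f s t) \<le> 2 * K * \<bar>t - s\<bar> powr a" using f by linarith
  qed (use assms in \<open>auto simp: path_bound_def\<close>)
  then show ?thesis using assms by (fastforce simp: path_bound_def)
qed

lemma path_bound_uniformly_continuous:
  assumes "path_bound a I f K" "0 < a"
  shows "uniformly_continuous_on I f"
  unfolding uniformly_continuous_on_def
proof (intro allI impI)
  fix e :: real assume e: "0 < e"
  define d where "d = (e / (K + 1)) powr (1 / a)"
  have K: "0 \<le> K" using assms by (simp add: path_bound_def)
  have "dist (f t) (f s) < e" if "s \<in> I" "t \<in> I" "dist t s < d" for s t
  proof -
    have "\<bar>t - s\<bar> powr a < d powr a"
      using that assms by (intro powr_less_mono2) (auto simp: dist_real_def)
    also have "d powr a = e / (K + 1)" using e K assms by (simp add: d_def powr_powr)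
    finally have "(K + 1) * \<bar>t - s\<bar> powr a < e" using K by (simp add: field_simps)
    moreover have "norm (incr f s t) \<le> K * \<bar>t - s\<bar> powr a"
      using assms that by (simp add: path_bound_def)
    moreover have "K * \<bar>t - s\<bar> powr a \<le> (K + 1) * \<bar>t - s\<bar> powr a" by (intro mult_right_mono) auto
    ultimately show ?thesis by (simp add: dist_norm incr_def)
  qed
  then show "\<exists>d>0. \<forall>x\<in>I. \<forall>x'\<in>I. dist x' x < d \<longrightarrow> dist (f x') (f x) < e"
    using e K by (intro exI[of _ d]) (auto simp: d_def)
qed

lemmas path_bound_continuous = uniformly_continuous_imp_continuous[OF path_bound_uniformly_continuous]

lemma C_hoelder_iff_path_bound:
  assumes "0 < a"
  shows "f \<in> C_hoelder a I \<longleftrightarrow> (\<exists>K. path_bound a I f K)"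
proof
  assume f: "f \<in> C_hoelder a I"
  then obtain B where B: "\<forall>t\<in>I. norm (f t) \<le> B"
    by (auto simp: C_hoelder_def C_space_def bounded_iff)
  have bdd: "bdd_above (hoelder_quots a I (incr f))" using f by (simp add: C_hoelder_def)
  let ?K = "max \<bar>B\<bar> (Omega_norm a I (incr f))"
  have "norm (incr f s t) \<le> ?K * \<bar>t - s\<bar> powr a" if "s \<in> I" "t \<in> I" for s t
    using norm_le_Omega_norm[OF bdd that] mult_right_mono[of "Omega_norm a I (incr f)" ?K "\<bar>t - s\<bar> powr a"]
    by (simp add: incr_def)
  then have "path_bound a I f ?K" using B by (fastforce simp: path_bound_def)
  then show "\<exists>K. path_bound a I f K" ..
next
  assume "\<exists>K. path_bound a I f K"
  then obtain K where K: "path_bound a I f K" ..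
  then show "f \<in> C_hoelder a I"
    using path_bound_continuous[OF K assms] hoelder_quots_bdd[of I "incr f" K a]
    by (auto simp: C_hoelder_def C_space_def bounded_iff path_bound_def)
qed

text \<open>
  The corresponding single constant for a controlled path, for the norm made of the sup norm of \<open>Z\<close> and
  the semi-norm.
\<close>

definition controlled_bound ::
    "real \<Rightarrow> real \<Rightarrow> real set \<Rightarrow> (real \<Rightarrow> real^'n) \<Rightarrow>
     (real \<Rightarrow> 'u::euclidean_space) \<times> (real \<Rightarrow> 'u^'n) \<Rightarrow> real \<Rightarrow> bool" where
  "controlled_bound \<gamma> \<eta> I X p K \<longleftrightarrow>
     path_bound \<gamma> I (fst p) K \<and> path_bound (\<eta> - \<gamma>) I (snd p) K \<and>
     (\<forall>s\<in>I. \<forall>t\<in>I. norm (remainder X (fst p) (snd p) s t) \<le> K * \<bar>t - s\<bar> powr \<eta>)"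

lemma bdd_above_norms: "bounded (f ` I) \<Longrightarrow> bdd_above (insert 0 {norm (f t) | t. t \<in> I})"
  unfolding bounded_iff by (elim exE, subst bdd_above_insert, intro bdd_aboveI) auto

lemma sup_norm_upper: "bounded (f ` I) \<Longrightarrow> t \<in> I \<Longrightarrow> norm (f t) \<le> sup_norm I f"
  unfolding sup_norm_def by (rule cSup_upper[OF _ bdd_above_norms]) auto

lemma sup_norm_nonneg: "bounded (f ` I) \<Longrightarrow> 0 \<le> sup_norm I f"
  unfolding sup_norm_def by (rule cSup_upper[OF _ bdd_above_norms]) auto

lemma sup_norm_le: "(\<And>t. t \<in> I \<Longrightarrow> norm (f t) \<le> K) \<Longrightarrow> 0 \<le> K \<Longrightarrow> sup_norm I f \<le> K"
  unfolding sup_norm_def by (rule cSup_least) auto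

lemma path_norm_upper:
  "f \<in> C_hoelder a I \<Longrightarrow> s \<in> I \<Longrightarrow> t \<in> I \<Longrightarrow> norm (incr f s t) \<le> path_norm a I f * \<bar>t - s\<bar> powr a"
  using norm_le_Omega_norm[of a I "incr f" s t] by (auto simp: path_norm_def C_hoelder_def)

lemma path_norm_nonneg: "f \<in> C_hoelder a I \<Longrightarrow> 0 \<le> path_norm a I f"
  unfolding path_norm_def by (rule Omega_norm_nonneg) (auto simp: C_hoelder_def)

lemma Omega_norm_upper:
  "R \<in> Omega_C_hoelder a I \<Longrightarrow> s \<in> I \<Longrightarrow> t \<in> I \<Longrightarrow> norm (R s t) \<le> Omega_norm a I R * \<bar>t - s\<bar> powr a"
  by (rule norm_le_Omega_norm) (auto simp: Omega_C_hoelder_def Omega_C_def)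

lemma controlled_norms:
  assumes "(Z, Z') \<in> controlled \<gamma> \<eta> I X"
  shows "0 \<le> sup_norm I Z" "0 \<le> sup_norm I Z'" "0 \<le> path_norm (\<eta> - \<gamma>) I Z'"
    "0 \<le> Omega_norm \<eta> I (remainder X Z Z')" "0 \<le> path_norm \<gamma> I Z"
    and "t \<in> I \<Longrightarrow> norm (Z t) \<le> sup_norm I Z" "t \<in> I \<Longrightarrow> norm (Z' t) \<le> sup_norm I Z'"
    and "s \<in> I \<Longrightarrow> t \<in> I \<Longrightarrow> norm (incr Z' s t) \<le> path_norm (\<eta> - \<gamma>) I Z' * \<bar>t - s\<bar> powr (\<eta> - \<gamma>)"
    and "s \<in> I \<Longrightarrow> t \<in> I \<Longrightarrow>
      norm (remainder X Z Z' s t) \<le> Omega_norm \<eta> I (remainder X Z Z') * \<bar>t - s\<bar> powr \<eta>"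
    and "s \<in> I \<Longrightarrow> t \<in> I \<Longrightarrow> norm (incr Z s t) \<le> path_norm \<gamma> I Z * \<bar>t - s\<bar> powr \<gamma>"
proof -
  have Z: "Z \<in> C_hoelder \<gamma> I" "Z' \<in> C_hoelder (\<eta> - \<gamma>) I" "remainder X Z Z' \<in> Omega_C_hoelder \<eta> I"
    using assms by (auto simp: controlled_def)
  have b: "bounded (Z ` I)" "bounded (Z' ` I)" using Z by (auto simp: C_hoelder_def C_space_def)
  show "0 \<le> sup_norm I Z" "0 \<le> sup_norm I Z'" "0 \<le> path_norm (\<eta> - \<gamma>) I Z'"
    "0 \<le> Omega_norm \<eta> I (remainder X Z Z')" "0 \<le> path_norm \<gamma> I Z"
    using Z b by (auto intro: sup_norm_nonneg path_norm_nonneg Omega_norm_nonneg simp: Omega_C_hoelder_def)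
  show "t \<in> I \<Longrightarrow> norm (Z t) \<le> sup_norm I Z" "t \<in> I \<Longrightarrow> norm (Z' t) \<le> sup_norm I Z'"
    "s \<in> I \<Longrightarrow> t \<in> I \<Longrightarrow> norm (incr Z' s t) \<le> path_norm (\<eta> - \<gamma>) I Z' * \<bar>t - s\<bar> powr (\<eta> - \<gamma>)"
    "s \<in> I \<Longrightarrow> t \<in> I \<Longrightarrow>
      norm (remainder X Z Z' s t) \<le> Omega_norm \<eta> I (remainder X Z Z') * \<bar>t - s\<bar> powr \<eta>"
    "s \<in> I \<Longrightarrow> t \<in> I \<Longrightarrow> norm (incr Z s t) \<le> path_norm \<gamma> I Z * \<bar>t - s\<bar> powr \<gamma>"
    using Z b by (auto intro: sup_norm_upper path_norm_upper Omega_norm_upper)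
qed

lemma controlled_bound_norm:
  assumes "p \<in> controlled \<gamma> \<eta> I X"
  shows "controlled_bound \<gamma> \<eta> I X p (sup_norm I (fst p) + D_seminorm \<gamma> \<eta> I X p)"
proof -
  obtain Z Z' where p: "p = (Z, Z')" by (cases p)
  note n = controlled_norms[OF assms[unfolded p]]
  let ?K = "sup_norm I Z + D_seminorm \<gamma> \<eta> I X (Z, Z')"
  have le: "sup_norm I Z \<le> ?K" "sup_norm I Z' \<le> ?K" "path_norm (\<eta> - \<gamma>) I Z' \<le> ?K"
    "Omega_norm \<eta> I (remainder X Z Z') \<le> ?K" "path_norm \<gamma> I Z \<le> ?K"
    using n(1-5) by (simp_all add: D_seminorm_def)
  have mono: "v \<le> ?K * x powr a" if "v \<le> c * x powr a" "c \<le> ?K" for v c x a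
    using that(1) mult_right_mono[OF that(2), of "x powr a"] by simp
  have "0 \<le> ?K" using le(1) n(1) by linarith
  moreover have "norm (Z t) \<le> ?K" "norm (Z' t) \<le> ?K" if "t \<in> I" for t
    using n(6,7)[OF that] le(1,2) by linarith+
  ultimately show ?thesis
    unfolding p controlled_bound_def path_bound_def fst_conv snd_conv
    using mono[OF n(8) le(3)] mono[OF n(9) le(4)] mono[OF n(10) le(5)] by simp
qed

text \<open>
  The factor counts the five terms: the sup norm of \<open>Z\<close> and the four parts of the semi-norm.
\<close>

lemma norm_le_controlled_bound:
  assumes "controlled_bound \<gamma> \<eta> I X p K"
  shows "sup_norm I (fst p) + D_seminorm \<gamma> \<eta> I X p \<le> 5 * K"
proof -
  obtain Z Z' where p: "p = (Z, Z')" by (cases p)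
  have b: "path_bound \<gamma> I Z K" "path_bound (\<eta> - \<gamma>) I Z' K"
    "\<forall>s\<in>I. \<forall>t\<in>I. norm (remainder X Z Z' s t) \<le> K * \<bar>t - s\<bar> powr \<eta>"
    using assms by (auto simp: controlled_bound_def p)
  have "sup_norm I Z \<le> K" "sup_norm I Z' \<le> K" "path_norm (\<eta> - \<gamma>) I Z' \<le> K"
    "Omega_norm \<eta> I (remainder X Z Z') \<le> K" "path_norm \<gamma> I Z \<le> K"
    using b unfolding path_norm_def path_bound_def by (auto intro!: sup_norm_le Omega_norm_le)
  then show ?thesis by (simp add: D_seminorm_def p)
qed

text \<open>
  Continuity and boundedness of the remainder come for free from those of \<open>Z\<close>, \<open>Z'\<close> and \<open>X\<close>.
\<close>

lemma controlled_iff_bound: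
  assumes "0 < \<gamma>" "\<gamma> < \<eta>" and X: "X \<in> C_hoelder \<gamma> I"
  shows "p \<in> controlled \<gamma> \<eta> I X \<longleftrightarrow> (\<exists>K. controlled_bound \<gamma> \<eta> I X p K)"
proof
  assume "p \<in> controlled \<gamma> \<eta> I X"
  then show "\<exists>K. controlled_bound \<gamma> \<eta> I X p K" using controlled_bound_norm by blast
next
  assume "\<exists>K. controlled_bound \<gamma> \<eta> I X p K"
  then obtain K where K: "controlled_bound \<gamma> \<eta> I X p K" ..
  obtain Z Z' where p: "p = (Z, Z')" by (cases p)
  have b: "path_bound \<gamma> I Z K" "path_bound (\<eta> - \<gamma>) I Z' K"
    "\<And>s t. s \<in> I \<Longrightarrow> t \<in> I \<Longrightarrow> norm (remainder X Z Z' s t) \<le> K * \<bar>t - s\<bar> powr \<eta>"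
    using K by (auto simp: controlled_bound_def p)
  have c: "continuous_on I Z" "continuous_on I Z'" "continuous_on I X"
    using path_bound_continuous[OF b(1)] path_bound_continuous[OF b(2)] assms
    by (auto simp: C_hoelder_def C_space_def)
  obtain L where L: "path_bound \<gamma> I X L" using X C_hoelder_iff_path_bound[OF assms(1)] by blast
  have "continuous_on (I \<times> I) (\<lambda>x. remainder X Z Z' (fst x) (snd x))"
    unfolding remainder_def incr_def
    by (intro continuous_intros continuous_on_compose2[OF c(1)] continuous_on_compose2[OF c(2)]
        continuous_on_compose2[OF c(3)]) auto
  moreover have "norm (remainder X Z Z' s t) \<le> 2 * K + K * (2 * L)" if "s \<in> I" "t \<in> I" for s t
  proof -
    have "norm (incr Z s t) \<le> 2 * K" "norm (incr X s t) \<le> 2 * L"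
      using path_bound_incr_le[OF b(1) that] path_bound_incr_le[OF L that] .
    moreover have "norm (contract (Z' s) (incr X s t)) \<le> K * (2 * L)"
    proof -
      have "norm (Z' s) * norm (incr X s t) \<le> K * (2 * L)"
        using b(2) that calculation(2) unfolding path_bound_def by (intro mult_mono) auto
      then show ?thesis using norm_contract_le[of "Z' s" "incr X s t"] by linarith
    qed
    ultimately show ?thesis
      unfolding remainder_def
      using norm_triangle_ineq4[of "incr Z s t" "contract (Z' s) (incr X s t)"] by linarith
  qed
  moreover have "remainder X Z Z' s s = 0" for s by (simp add: remainder_def incr_def contract_simps)
  ultimately have "remainder X Z Z' \<in> Omega_C_hoelder \<eta> I"
    using hoelder_quots_bdd[of I "remainder X Z Z'", OF b(3)]
    by (auto simp: Omega_C_hoelder_def Omega_C_def case_prod_unfold bounded_iff)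
  then show "p \<in> controlled \<gamma> \<eta> I X"
    using b assms by (auto simp: p controlled_def C_hoelder_iff_path_bound)
qed

lemma path_bound_lincomb:
  assumes "path_bound a I f K" "path_bound a I g L"
  shows "path_bound a I (\<lambda>t. c *\<^sub>R f t + g t) (\<bar>c\<bar> * K + L)"
proof -
  have "norm (c *\<^sub>R x + y) \<le> \<bar>c\<bar> * A + B" if "norm x \<le> A" "norm y \<le> B" for x y :: 'a and A B
    using that by (intro order.trans[OF norm_triangle_ineq] add_mono) (auto intro: mult_left_mono)
  moreover have "incr (\<lambda>t. c *\<^sub>R f t + g t) s t = c *\<^sub>R incr f s t + incr g s t" for s t
    by (simp add: incr_def algebra_simps)
  moreover have "(\<bar>c\<bar> * K + L) * x = \<bar>c\<bar> * (K * x) + L * x" for x by (simp add: algebra_simps)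
  ultimately show ?thesis using assms unfolding path_bound_def by simp
qed

lemma remainder_lincomb:
  "remainder X (\<lambda>t. c *\<^sub>R Z t + W t) (\<lambda>t. c *\<^sub>R Z' t + W' t) s t
    = c *\<^sub>R remainder X Z Z' s t + remainder X W W' s t"
  by (simp add: remainder_def incr_def contract_simps algebra_simps)

lemma controlled_bound_pair_comb:
  assumes "controlled_bound \<gamma> \<eta> I X p K" "controlled_bound \<gamma> \<eta> I X q L"
  shows "controlled_bound \<gamma> \<eta> I X (pair_comb c p q) (\<bar>c\<bar> * K + L)"
proof -
  have "norm (c *\<^sub>R x + y) \<le> (\<bar>c\<bar> * K + L) * v" if "norm x \<le> K * v" "norm y \<le> L * v" for x y :: 'b and v
  proof -
    have "norm (c *\<^sub>R x + y) \<le> \<bar>c\<bar> * (K * v) + L * v"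
      using that by (intro order.trans[OF norm_triangle_ineq] add_mono) (auto intro: mult_left_mono)
    then show ?thesis by (simp add: algebra_simps)
  qed
  then show ?thesis
    using assms unfolding controlled_bound_def pair_comb_def fst_conv snd_conv remainder_lincomb
    by (simp add: path_bound_lincomb)
qed

section \<open>Extending rough paths and controlled paths to the line\<close>

text \<open>
  Such maps let everything known on \<open>I\<close> pass to the line as a limit along \<open>k\<close>: values stay in \<open>I\<close>, so
  algebraic identities are kept; the maps do not increase distances, so Hoelder bounds are kept with
  the same constants; and uniformly continuous functions converge.  Endpoints that \<open>I\<close> lacks need no
  separate treatment.
\<close>

definition approx_retraction :: "real set \<Rightarrow> (nat \<Rightarrow> real \<Rightarrow> real) \<Rightarrow> bool" where
  "approx_retraction I \<rho> \<longleftrightarrow> (\<forall>k t. \<rho> k t \<in> I) \<and> (\<forall>k s t. \<bar>\<rho> k t - \<rho> k s\<bar> \<le> \<bar>t - s\<bar>) \<and>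
     (\<forall>t. convergent (\<lambda>k. \<rho> k t)) \<and> (\<forall>t\<in>I. (\<lambda>k. \<rho> k t) \<longlonglongrightarrow> t)"

text \<open>
  A point strictly between \<open>b\<close> and \<open>p\<close> lies between \<open>b\<close> and a point of \<open>I\<close> close to \<open>p\<close>.
\<close>

lemma shrink_closure_mem:
  fixes b p l :: real
  assumes I: "is_interval I" and b: "b \<in> I" and p: "p \<in> closure I" and l: "0 \<le> l" "l < 1"
  shows "b + l * (p - b) \<in> I"
proof (cases "p = b")
  case False
  then have "0 < (1 - l) * \<bar>p - b\<bar>" using l by simp
  then obtain y where y: "y \<in> I" "dist y p < (1 - l) * \<bar>p - b\<bar>"
    using p closure_approachable by blast
  then have y': "\<bar>y - p\<bar> < \<bar>p - b\<bar> - l * \<bar>p - b\<bar>" by (simp add: dist_real_def algebra_simps)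
  show ?thesis
  proof (cases "b \<le> p")
    case True
    then have "0 \<le> l * (p - b)" using l by simp
    moreover have "b + l * (p - b) \<le> y" using y' True by (simp add: abs_if split: if_splits)
    ultimately show ?thesis using mem_is_interval_1_I[OF I b y(1)] by simp
  next
    case False
    then have "l * (p - b) \<le> 0" using l by (simp add: mult_le_0_iff)
    moreover have "y \<le> b + l * (p - b)" using y' False by (simp add: abs_if algebra_simps split: if_splits)
    ultimately show ?thesis using mem_is_interval_1_I[OF I y(1) b] by simp
  qed
qed (use b in simp)

text \<open>
  The nearest point projection to the closure of \<open>I\<close> does not increase distances, but may hit endpoints
  outside \<open>I\<close>.  Contracting towards a point of \<open>I\<close> by a factor tending to \<open>1\<close> repairs this.
\<close>

lemma approx_retraction_exists:
  assumes I: "is_interval I" and b: "b \<in> I"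
  shows "\<exists>\<rho>. approx_retraction I \<rho>"
proof -
  define pr where "pr = closest_point (closure I)"
  define l where "l k = 1 - inverse (real (Suc k))" for k
  define \<rho> where "\<rho> k t = b + l k * (pr t - b)" for k t
  have ne: "closure I \<noteq> {}" using b closure_subset by blast
  have conv: "convex (closure I)" using I by (simp add: convex_closure is_interval_convex_1)
  have l: "0 \<le> l k" "l k < 1" "l k \<le> 1" for k by (auto simp: l_def inverse_le_1_iff)
  have liml: "l \<longlonglongrightarrow> 1"
    unfolding l_def using tendsto_diff[OF tendsto_const LIMSEQ_inverse_real_of_nat, of 1] by simp
  have lim: "(\<lambda>k. \<rho> k t) \<longlonglongrightarrow> pr t" for t
  proof -
    have "(\<lambda>k. b + l k * (pr t - b)) \<longlonglongrightarrow> b + 1 * (pr t - b)"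
      by (intro tendsto_intros liml)
    then show ?thesis by (simp add: \<rho>_def)
  qed
  have "\<rho> k t \<in> I" for k t
    unfolding \<rho>_def pr_def
    using closest_point_in_set[OF closed_closure ne] l by (intro shrink_closure_mem[OF I b])
  moreover have "\<bar>\<rho> k t - \<rho> k s\<bar> \<le> \<bar>t - s\<bar>" for k s t
  proof -
    have "\<rho> k t - \<rho> k s = l k * (pr t - pr s)" by (simp add: \<rho>_def algebra_simps)
    then have "\<bar>\<rho> k t - \<rho> k s\<bar> = l k * \<bar>pr t - pr s\<bar>" using l by (simp add: abs_mult)
    also have "\<dots> \<le> 1 * \<bar>pr t - pr s\<bar>" using l by (intro mult_right_mono) auto
    also have "\<dots> \<le> \<bar>t - s\<bar>"
      using closest_point_lipschitz[OF conv closed_closure ne, of t s] by (simp add: pr_def dist_real_def)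
    finally show ?thesis .
  qed
  moreover have "convergent (\<lambda>k. \<rho> k t)" for t
    using lim by (auto simp: convergent_def)
  moreover have "(\<lambda>k. \<rho> k t) \<longlonglongrightarrow> t" if "t \<in> I" for t
  proof -
    have "pr t = t" using that closure_subset unfolding pr_def by (intro closest_point_self) auto
    then show ?thesis using lim[of t] by simp
  qed
  ultimately have "approx_retraction I \<rho>"
    unfolding approx_retraction_def by blast
  then show ?thesis by blast
qed

definition extension :: "(nat \<Rightarrow> real \<Rightarrow> real) \<Rightarrow> (real \<Rightarrow> 'u::real_normed_vector) \<Rightarrow> real \<Rightarrow> 'u" where
  "extension \<rho> f t = lim (\<lambda>k. f (\<rho> k t))"

lemma extension_tendsto:
  fixes f :: "real \<Rightarrow> 'u::euclidean_space"
  assumes "approx_retraction I \<rho>" "path_bound a I f K" "0 < a"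
  shows "(\<lambda>k. f (\<rho> k t)) \<longlonglongrightarrow> extension \<rho> f t"
proof -
  have "Cauchy (\<lambda>k. \<rho> k t)" "\<And>k. \<rho> k t \<in> I"
    using assms(1) by (auto simp: approx_retraction_def intro: convergent_Cauchy)
  then have "Cauchy (\<lambda>k. f (\<rho> k t))"
    by (rule uniformly_continuous_on_Cauchy[OF path_bound_uniformly_continuous[OF assms(2,3)]])
  then show ?thesis
    unfolding extension_def by (simp add: Cauchy_convergent flip: convergent_LIMSEQ_iff)
qed

lemma extension_eq:
  fixes f :: "real \<Rightarrow> 'u::euclidean_space"
  assumes \<rho>: "approx_retraction I \<rho>" and f: "path_bound a I f K" "0 < a" and t: "t \<in> I"
  shows "extension \<rho> f t = f t"
proof -
  have "(\<lambda>k. f (\<rho> k t)) \<longlonglongrightarrow> f t"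
    using \<rho> t by (intro continuous_on_tendsto_compose[OF path_bound_continuous[OF f]])
      (auto simp: approx_retraction_def)
  then show ?thesis using extension_tendsto[OF \<rho> f] LIMSEQ_unique by blast
qed

lemma norm_limit_le_hoelder:
  fixes R :: "real \<Rightarrow> real \<Rightarrow> 'u::euclidean_space"
  assumes \<rho>: "approx_retraction I \<rho>"
    and bd: "\<And>s t. s \<in> I \<Longrightarrow> t \<in> I \<Longrightarrow> norm (R s t) \<le> K * \<bar>t - s\<bar> powr a"
    and lim: "(\<lambda>k. R (\<rho> k s) (\<rho> k t)) \<longlonglongrightarrow> r" and "0 \<le> K" "0 < a"
  shows "norm r \<le> K * \<bar>t - s\<bar> powr a"
proof (rule LIMSEQ_le_const2[OF tendsto_norm[OF lim]], intro exI allI impI)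
  fix k
  have "norm (R (\<rho> k s) (\<rho> k t)) \<le> K * \<bar>\<rho> k t - \<rho> k s\<bar> powr a"
    using \<rho> by (intro bd) (auto simp: approx_retraction_def)
  also have "\<dots> \<le> K * \<bar>t - s\<bar> powr a"
    using \<rho> assms by (intro mult_left_mono powr_mono2) (auto simp: approx_retraction_def)
  finally show "norm (R (\<rho> k s) (\<rho> k t)) \<le> K * \<bar>t - s\<bar> powr a" .
qed

lemma path_bound_extension:
  assumes \<rho>: "approx_retraction I \<rho>" and f: "path_bound a I f K" "0 < a"
  shows "path_bound a UNIV (extension \<rho> f) K"
proof -
  note lim = extension_tendsto[OF \<rho> f]
  have "norm (extension \<rho> f t) \<le> K" for t
    using \<rho> f by (intro LIMSEQ_le_const2[OF tendsto_norm[OF lim]]) (auto simp: approx_retraction_def path_bound_def)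
  moreover have "norm (incr (extension \<rho> f) s t) \<le> K * \<bar>t - s\<bar> powr a" for s t
  proof (rule norm_limit_le_hoelder[OF \<rho>])
    show "(\<lambda>k. incr f (\<rho> k s) (\<rho> k t)) \<longlonglongrightarrow> incr (extension \<rho> f) s t"
      unfolding incr_def by (intro tendsto_diff lim)
  qed (use f in \<open>auto simp: path_bound_def\<close>)
  ultimately show ?thesis using f by (simp add: path_bound_def)
qed

lemma controlled_bound_extension:
  assumes \<rho>: "approx_retraction I \<rho>" and X: "path_bound \<gamma> I X L" 
    and p: "controlled_bound \<gamma> \<eta> I X (Z, Z') K" and "0 < \<gamma>" "\<gamma> < \<eta>"
  shows "controlled_bound \<gamma> \<eta> UNIV (extension \<rho> X) (extension \<rho> Z, extension \<rho> Z') K"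
proof -
  have Z: "path_bound \<gamma> I Z K" "path_bound (\<eta> - \<gamma>) I Z' K" and "0 < \<eta> - \<gamma>"
    using p assms by (auto simp: controlled_bound_def)
  note lims = extension_tendsto[OF \<rho> Z(1) \<open>0 < \<gamma>\<close>] extension_tendsto[OF \<rho> Z(2) \<open>0 < \<eta> - \<gamma>\<close>]
    extension_tendsto[OF \<rho> X \<open>0 < \<gamma>\<close>]
  have "norm (remainder (extension \<rho> X) (extension \<rho> Z) (extension \<rho> Z') s t) \<le> K * \<bar>t - s\<bar> powr \<eta>" for s t
  proof (rule norm_limit_le_hoelder[OF \<rho>])
    show "(\<lambda>k. remainder X Z Z' (\<rho> k s) (\<rho> k t))
        \<longlonglongrightarrow> remainder (extension \<rho> X) (extension \<rho> Z) (extension \<rho> Z') s t"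
      unfolding remainder_def incr_def
      by (intro tendsto_diff bounded_bilinear.tendsto[OF bounded_bilinear_contract] lims)
  qed (use p assms in \<open>auto simp: controlled_bound_def path_bound_def\<close>)
  then show ?thesis
    using path_bound_extension[OF \<rho> Z(1)] path_bound_extension[OF \<rho> Z(2)] assms
    by (simp add: controlled_bound_def)
qed

definition rough_path_bound ::
    "real \<Rightarrow> real set \<Rightarrow> (real \<Rightarrow> real^'n) \<Rightarrow> (real \<Rightarrow> real \<Rightarrow> real^'n^'n) \<Rightarrow> real \<Rightarrow> bool" where
  "rough_path_bound \<gamma> I X X2 L \<longleftrightarrow> path_bound \<gamma> I X L \<and>
     (\<forall>s\<in>I. \<forall>t\<in>I. norm (X2 s t) \<le> L \<and> norm (X2 s t) \<le> L * \<bar>t - s\<bar> powr (2 * \<gamma>)) \<and>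
     (\<forall>s\<in>I. \<forall>u\<in>I. \<forall>t\<in>I. N_op X2 s u t = tensor (incr X s u) (incr X u t))"

lemma rough_path_bound_exists:
  assumes "0 < \<gamma>" "X \<in> C_hoelder \<gamma> I" "X2 \<in> Omega_C_hoelder (2 * \<gamma>) I"
    "\<forall>s\<in>I. \<forall>u\<in>I. \<forall>t\<in>I. N_op X2 s u t = tensor (incr X s u) (incr X u t)"
  shows "\<exists>L. rough_path_bound \<gamma> I X X2 L"
proof -
  obtain K where K: "path_bound \<gamma> I X K" using assms C_hoelder_iff_path_bound by blast
  obtain B where B: "\<And>s t. s \<in> I \<Longrightarrow> t \<in> I \<Longrightarrow> norm (X2 s t) \<le> B"
    using assms(3) by (fastforce simp: Omega_C_hoelder_def Omega_C_def bounded_iff)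
  define L where "L = max K (max B (Omega_norm (2 * \<gamma>) I X2))"
  have L: "K \<le> L" "B \<le> L" "Omega_norm (2 * \<gamma>) I X2 \<le> L" by (auto simp: L_def)
  have "path_bound \<gamma> I X L"
    using K L(1) unfolding path_bound_def
    by (auto intro: order.trans[OF _ mult_right_mono[OF L(1)]])
  moreover have "norm (X2 s t) \<le> L" if "s \<in> I" "t \<in> I" for s t using B[OF that] L by simp
  moreover have "norm (X2 s t) \<le> L * \<bar>t - s\<bar> powr (2 * \<gamma>)" if "s \<in> I" "t \<in> I" for s t
    using Omega_norm_upper[OF assms(3) that] mult_right_mono[OF L(3), of "\<bar>t - s\<bar> powr (2 * \<gamma>)"] by simp
  ultimately show ?thesis using assms by (auto simp: rough_path_bound_def)
qed

text \<open>
  Chen's relation recovers the second level from \<open>X\<close> and the single path \<open>X2 b\<close>.  So extending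
  functions of one variable suffices.
\<close>

lemma chen_from_base:
  assumes "rough_path_bound \<gamma> I X X2 L" "b \<in> I" "s \<in> I" "t \<in> I"
  shows "X2 s t = X2 b t - X2 b s - tensor (incr X b s) (incr X s t)"
proof -
  have "N_op X2 b s t = tensor (incr X b s) (incr X s t)" using assms by (simp add: rough_path_bound_def)
  then show ?thesis by (simp add: N_op_def algebra_simps)
qed

text \<open>
  The term \<open>\<delta>X\<^sub>b\<^sub>s \<otimes> \<delta>X\<^sub>s\<^sub>t\<close> limits the regularity of this path to \<open>\<gamma>\<close>.
\<close>

lemma path_bound_second_level:
  assumes X: "rough_path_bound \<gamma> I X X2 L" and b: "b \<in> I" and \<gamma>: "0 < \<gamma>"
  shows "path_bound \<gamma> I (X2 b) (L + 2 * L * L)"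
proof -
  have L: "0 \<le> L" "\<And>s t. s \<in> I \<Longrightarrow> t \<in> I \<Longrightarrow> norm (X2 s t) \<le> L"
    "\<And>s t. s \<in> I \<Longrightarrow> t \<in> I \<Longrightarrow> norm (X2 s t) \<le> L * \<bar>t - s\<bar> powr (2 * \<gamma>)"
    and XL: "path_bound \<gamma> I X L"
    using X by (auto simp: rough_path_bound_def path_bound_def)
  have "norm (incr (X2 b) s t) \<le> (L + 2 * L * L) * \<bar>t - s\<bar> powr \<gamma>" if st: "s \<in> I" "t \<in> I" for s t
  proof -
    have "norm (X2 s t) \<le> L * \<bar>t - s\<bar> powr \<gamma>"
      using le_lower_powr[OF L(2)[OF st] L(3)[OF st], of \<gamma>] L(1) \<gamma> by simp
    moreover have "norm (tensor (incr X b s) (incr X s t)) \<le> (2 * L) * (L * \<bar>t - s\<bar> powr \<gamma>)"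
    proof -
      have "norm (incr X b s) * norm (incr X s t) \<le> (2 * L) * (L * \<bar>t - s\<bar> powr \<gamma>)"
        using path_bound_incr_le[OF XL b st(1)] XL st L(1)
        by (intro mult_mono) (auto simp: path_bound_def)
      then show ?thesis using norm_tensor_le[of "incr X b s" "incr X s t"] by linarith
    qed
    moreover have "incr (X2 b) s t = X2 s t + tensor (incr X b s) (incr X s t)"
      using chen_from_base[OF X b st] by (simp add: incr_def)
    ultimately have "norm (incr (X2 b) s t) \<le> L * \<bar>t - s\<bar> powr \<gamma> + (2 * L) * (L * \<bar>t - s\<bar> powr \<gamma>)"
      using norm_triangle_ineq[of "X2 s t" "tensor (incr X b s) (incr X s t)"] by simp
    then show ?thesis by (simp add: algebra_simps)
  qed
  moreover have "norm (X2 b t) \<le> L + 2 * L * L" if "t \<in> I" for t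
    using L(2)[OF b that] L(1) by (smt (verit) mult_nonneg_nonneg)
  ultimately show ?thesis using L(1) by (simp add: path_bound_def)
qed

lemma second_level_continuous:
  assumes X: "rough_path_bound \<gamma> I X X2 L" and \<gamma>: "0 < \<gamma>"
  shows "continuous_on (I \<times> I) (\<lambda>x. X2 (fst x) (snd x))"
proof (cases "I = {}")
  case False
  then obtain b where b: "b \<in> I" by blast
  have XL: "path_bound \<gamma> I X L" using X by (simp add: rough_path_bound_def)
  note c = path_bound_continuous[OF path_bound_second_level[OF X b \<gamma>] \<gamma>] path_bound_continuous[OF XL \<gamma>]
  have "continuous_on (I \<times> I) (\<lambda>x. X2 b (snd x) - X2 b (fst x) - tensor (incr X b (fst x)) (incr X (fst x) (snd x)))"
    unfolding incr_def
    by (intro continuous_intros continuous_on_compose2[OF c(1)] continuous_on_compose2[OF c(2)]) auto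
  moreover have "X2 (fst x) (snd x) = X2 b (snd x) - X2 b (fst x) - tensor (incr X b (fst x)) (incr X (fst x) (snd x))"
    if "x \<in> I \<times> I" for x
    using that by (intro chen_from_base[OF X b]) auto
  ultimately show ?thesis by (subst continuous_on_cong[OF refl])
qed simp

text \<open>
  The second level on the line is defined by the formula of \<open>chen_from_base\<close>, which makes Chen's relation an
  identity and continuity evident.  The exponent \<open>2 * \<gamma>\<close> is not visible in this formula; it follows
  because the value is also the limit of \<open>X2\<close> along the approximate retraction.
\<close>

lemma rough_path_bound_extension:
  assumes \<rho>: "approx_retraction I \<rho>" and X: "rough_path_bound \<gamma> I X X2 L" and b: "b \<in> I" and \<gamma>: "0 < \<gamma>"
  shows "\<exists>X2'. rough_path_bound \<gamma> UNIV (extension \<rho> X) X2' L \<and> (\<forall>s\<in>I. \<forall>t\<in>I. X2' s t = X2 s t)"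
proof -
  have XL: "path_bound \<gamma> I X L" and L0: "0 \<le> L" using X by (auto simp: rough_path_bound_def path_bound_def)
  note Y = path_bound_second_level[OF X b \<gamma>]
  \<comment> \<open>\<open>X b\<close> is the value at a point of \<open>I\<close>, so the increment of \<open>X\<close> from \<open>b\<close> extends as \<open>x\<close>\<close>
  define x where "x s = extension \<rho> X s - X b" for s
  define X2' where "X2' s t = extension \<rho> (X2 b) t - extension \<rho> (X2 b) s - tensor (x s) (x t - x s)" for s t
  have eq: "X2' s t = X2 s t" if "s \<in> I" "t \<in> I" for s t
    using chen_from_base[OF X b that] extension_eq[OF \<rho> Y \<gamma>] extension_eq[OF \<rho> XL \<gamma>] that
    by (simp add: X2'_def x_def incr_def)
  have lim: "(\<lambda>k. X2 (\<rho> k s) (\<rho> k t)) \<longlonglongrightarrow> X2' s t" for s t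
  proof -
    have "(\<lambda>k. X2 b (\<rho> k t) - X2 b (\<rho> k s)
        - tensor (X (\<rho> k s) - X b) ((X (\<rho> k t) - X b) - (X (\<rho> k s) - X b))) \<longlonglongrightarrow> X2' s t"
      unfolding X2'_def x_def
      by (intro tendsto_diff bounded_bilinear.tendsto[OF bounded_bilinear_tensor] tendsto_const
          extension_tendsto[OF \<rho> Y \<gamma>] extension_tendsto[OF \<rho> XL \<gamma>])
    moreover have "X2 (\<rho> k s) (\<rho> k t) = X2 b (\<rho> k t) - X2 b (\<rho> k s)
        - tensor (X (\<rho> k s) - X b) ((X (\<rho> k t) - X b) - (X (\<rho> k s) - X b))" for k
      using chen_from_base[OF X b, of "\<rho> k s" "\<rho> k t"] \<rho> by (simp add: incr_def approx_retraction_def)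
    ultimately show ?thesis by simp
  qed
  have "norm (X2' s t) \<le> L" for s t
    using \<rho> X by (intro LIMSEQ_le_const2[OF tendsto_norm[OF lim]])
      (auto simp: approx_retraction_def rough_path_bound_def)
  moreover have "norm (X2' s t) \<le> L * \<bar>t - s\<bar> powr (2 * \<gamma>)" for s t
    by (rule norm_limit_le_hoelder[where R = X2, OF \<rho>])
      (use X \<gamma> lim L0 in \<open>auto simp: rough_path_bound_def\<close>)
  moreover have "N_op X2' s u t = tensor (incr (extension \<rho> X) s u) (incr (extension \<rho> X) u t)" for s u t
    by (simp add: N_op_def X2'_def x_def incr_def tensor_simps algebra_simps)
  ultimately have "rough_path_bound \<gamma> UNIV (extension \<rho> X) X2' L"
    using path_bound_extension[OF \<rho> XL \<gamma>] by (simp add: rough_path_bound_def)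
  then show ?thesis using eq by blast
qed

section \<open>The defect of the germ\<close>

text \<open>
  The bounds needed of one factor of a product term: a constant, so that the term is bounded, and a power
  of the gap.
\<close>

definition dominated :: "real \<Rightarrow> real \<Rightarrow> real \<Rightarrow> real \<Rightarrow> bool" where
  "dominated K a x q \<longleftrightarrow> 0 \<le> q \<and> q \<le> K \<and> q \<le> K * x powr a"

lemma dominated_mult:
  "dominated K a x q \<Longrightarrow> dominated L b x r \<Longrightarrow> dominated (K * L) (a + b) x (q * r)"
  using mult_mono[of q K r L] mult_mono[of q "K * x powr a" r "L * x powr b"]
  by (auto simp: dominated_def powr_add mult_ac)

lemma dominated_cmult:
  assumes "dominated K a x q" "0 \<le> c" "c \<le> C"
  shows "dominated (C * K) a x (c * q)"
  using assms mult_mono[of c C q K] mult_mono[of c C q "K * x powr a"]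
  by (auto simp: dominated_def mult_ac)

lemma dominated_add: "dominated K a x q \<Longrightarrow> dominated L a x r \<Longrightarrow> dominated (K + L) a x (q + r)"
  by (auto simp: dominated_def algebra_simps)

lemma dominated_incr:
  assumes "path_bound a I f K" "s \<in> I" "t \<in> I"
  shows "dominated (2 * K) a \<bar>t - s\<bar> (norm (incr f s t))"
proof -
  have "norm (incr f s t) \<le> K * \<bar>t - s\<bar> powr a" "0 \<le> K * \<bar>t - s\<bar> powr a"
    using assms by (auto simp: path_bound_def)
  then show ?thesis using path_bound_incr_le[OF assms] by (simp add: dominated_def)
qed

text \<open>
  Each part of the defect of a germ is a product of a factor that is small in \<open>u - s\<close> and a factor that is
  small in \<open>t - u\<close>.
\<close>

lemma Omega_C2_hoelder_productI:
  assumes cont: "continuous_on (I \<times> I \<times> I) (\<lambda>x. B (fst x) (fst (snd x)) (snd (snd x)))"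
    and B: "\<And>s u t. s \<in> I \<Longrightarrow> u \<in> I \<Longrightarrow> t \<in> I \<Longrightarrow> norm (B s u t) \<le> f s u * g u t"
    and f: "\<And>s u. s \<in> I \<Longrightarrow> u \<in> I \<Longrightarrow> dominated K a \<bar>u - s\<bar> (f s u)"
    and g: "\<And>u t. u \<in> I \<Longrightarrow> t \<in> I \<Longrightarrow> dominated K' b \<bar>t - u\<bar> (g u t)"
    and ab: "0 < a" "0 < b"
  shows "B \<in> Omega_C2_hoelder (a + b) I"
proof (rule Omega_C2_hoelder_single[OF ab])
  note f = f[unfolded dominated_def] and g = g[unfolded dominated_def]
  have K: "0 \<le> K \<and> 0 \<le> K'" if "s \<in> I" for s using f[OF that that] g[OF that that] by linarith
  have "norm (B s u t) \<le> K * K'" if "s \<in> I" "u \<in> I" "t \<in> I" for s u t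
  proof -
    have "f s u * g u t \<le> K * K'" using f g that K by (intro mult_mono) auto
    then show ?thesis using B[OF that] by linarith
  qed
  moreover have "B s s s = 0" if "s \<in> I" for s
  proof -
    have "f s s = 0" using f[OF that that] ab by simp
    then show ?thesis using B[OF that that that] by simp
  qed
  ultimately show "B \<in> Omega_C2 I"
    using cont by (auto simp: Omega_C2_def case_prod_unfold bounded_iff)
  have "norm (B s u t) / (\<bar>u - s\<bar> powr a * \<bar>t - u\<bar> powr b) \<le> K * K'"
    if "s \<in> I" "u \<in> I" "t \<in> I" "u \<noteq> s" "t \<noteq> u" for s u t
  proof -
    have "f s u * g u t \<le> (K * \<bar>u - s\<bar> powr a) * (K' * \<bar>t - u\<bar> powr b)"
      using f g that K by (intro mult_mono) auto
    then have "norm (B s u t) \<le> K * K' * (\<bar>u - s\<bar> powr a * \<bar>t - u\<bar> powr b)"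
      using B[OF that(1-3)] by (simp add: mult_ac)
    then show ?thesis using that by (simp add: divide_le_eq)
  qed
  then show "bdd_above (hoelder2_quots a b I B)"
    by (intro bdd_aboveI[of _ "K * K'"]) (auto simp: hoelder2_quots_def)
qed

lemma Omega_C_memI:
  assumes "continuous_on (I \<times> I) (\<lambda>x. R (fst x) (snd x))"
    "\<And>s t. s \<in> I \<Longrightarrow> t \<in> I \<Longrightarrow> norm (R s t) \<le> K" "\<And>s. s \<in> I \<Longrightarrow> R s s = 0"
  shows "R \<in> Omega_C I"
  using assms by (auto simp: Omega_C_def case_prod_unfold bounded_iff)

lemma Z2_spaceI:
  assumes "R \<in> Omega_C I" "N_op R \<in> Omega_C2_hoelder z I"
  shows "N_op R \<in> Z2_space z I"
  using assms by (auto simp: Z2_space_def)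

lemma N_young_germ: "N_op (\<lambda>s t. tensor (F s) (incr G s t)) s u t = - tensor (incr F s u) (incr G u t)"
  by (simp add: N_op_def incr_def tensor_simps algebra_simps)

lemma young_germ_Z2:
  assumes F: "path_bound a I F K" and G: "path_bound b I G L" and ab: "0 < a" "0 < b"
  shows "N_op (\<lambda>s t. tensor (F s) (incr G s t)) \<in> Z2_space (a + b) I"
proof (rule Z2_spaceI)
  note c = path_bound_continuous[OF F ab(1)] path_bound_continuous[OF G ab(2)]
  have K: "0 \<le> K" "0 \<le> L" using F G by (auto simp: path_bound_def)
  have "norm (tensor (F s) (incr G s t)) \<le> K * (2 * L)" if "s \<in> I" "t \<in> I" for s t
  proof -
    have "norm (F s) * norm (incr G s t) \<le> K * (2 * L)"
      using F K that path_bound_incr_le[OF G that] by (intro mult_mono) (auto simp: path_bound_def)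
    then show ?thesis using norm_tensor_le[of "F s" "incr G s t"] by linarith
  qed
  moreover have "continuous_on (I \<times> I) (\<lambda>x. tensor (F (fst x)) (incr G (fst x) (snd x)))"
    unfolding incr_def
    by (intro continuous_intros continuous_on_compose2[OF c(1)] continuous_on_compose2[OF c(2)]) auto
  ultimately show "(\<lambda>s t. tensor (F s) (incr G s t)) \<in> Omega_C I"
    by (intro Omega_C_memI[where K = "K * (2 * L)"]) (auto simp: tensor_simps)
  have "(\<lambda>s u t. - tensor (incr F s u) (incr G u t)) \<in> Omega_C2_hoelder (a + b) I"
  proof (rule Omega_C2_hoelder_productI[OF _ _ dominated_incr[OF F] dominated_incr[OF G] ab])
    show "continuous_on (I \<times> I \<times> I)
        (\<lambda>x. - tensor (incr F (fst x) (fst (snd x))) (incr G (fst (snd x)) (snd (snd x))))"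
      unfolding incr_def
      by (intro continuous_intros continuous_on_compose2[OF c(1)] continuous_on_compose2[OF c(2)]) auto
  qed (simp_all add: norm_tensor_le)
  then show "N_op (\<lambda>s t. tensor (F s) (incr G s t)) \<in> Omega_C2_hoelder (a + b) I"
    by (rule Omega_C2_hoelder_cong) (simp add: N_young_germ)
qed

lemma young_germ_extendable:
  assumes I: "is_interval I" and F: "path_bound a I F K" and G: "path_bound b I G L" and ab: "0 < a" "0 < b"
    and ne: "I \<noteq> {}"
  shows "extendable (a + b) I (N_op (\<lambda>s t. tensor (F s) (incr G s t)))"
proof -
  obtain \<rho> where \<rho>: "approx_retraction I \<rho>" using approx_retraction_exists[OF I] ne by blast
  have "N_op (\<lambda>s t. tensor (extension \<rho> F s) (incr (extension \<rho> G) s t)) \<in> Z2_space (a + b) UNIV"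
    by (rule young_germ_Z2[OF path_bound_extension[OF \<rho> F] path_bound_extension[OF \<rho> G]]) (use ab in auto)
  moreover have "N_op (\<lambda>s t. tensor (extension \<rho> F s) (incr (extension \<rho> G) s t)) s u t
      = N_op (\<lambda>s t. tensor (F s) (incr G s t)) s u t" if "s \<in> I" "u \<in> I" "t \<in> I" for s u t
    using that extension_eq[OF \<rho> F ab(1)] extension_eq[OF \<rho> G ab(2)] by (simp add: N_op_def incr_def)
  ultimately show ?thesis unfolding extendable_def by blast
qed

text \<open>
  The cancellation that makes the integral exist.  The defect of \<open>Z \<delta>W\<close> is \<open>- \<delta>Z\<^sub>s\<^sub>u \<delta>W\<^sub>u\<^sub>t\<close>, whose leading part
  \<open>Z' \<delta>X\<^sub>s\<^sub>u W' \<delta>X\<^sub>u\<^sub>t\<close> has order \<open>2 * \<gamma>\<close> only; by Chen's relation the defect of \<open>Z' W' X2\<close> contains the same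
  term with the opposite sign.  Each of the terms that are left has total order \<open>\<eta> + \<gamma>\<close>.
\<close>

lemma N_rough_germ:
  assumes "N_op X2 s u t = tensor (incr X s u) (incr X u t)"
  shows "N_op (rough_germ X2 (Z, Z') (W, W')) s u t =
    - tensor (remainder X Z Z' s u) (incr W u t)
    - tensor (contract (Z' s) (incr X s u)) (remainder X W W' u t)
    - tensor (contract (Z' s) (incr X s u)) (contract (incr W' s u) (incr X u t))
    - (contract2 (incr Z' s u) (W' u) (X2 u t) + contract2 (Z' s) (incr W' s u) (X2 u t))"
proof -
  have "X2 s t = X2 s u + X2 u t + tensor (incr X s u) (incr X u t)"
    using assms by (simp add: N_op_def algebra_simps)
  then have X2: "contract2 (Z' s) (W' s) (X2 s t) = contract2 (Z' s) (W' s) (X2 s u)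
      + contract2 (Z' s) (W' s) (X2 u t) + tensor (contract (Z' s) (incr X s u)) (contract (W' s) (incr X u t))"
    by (simp add: contract2_simps contract2_tensor)
  show ?thesis
    by (simp add: N_op_def rough_germ_def X2)
       (simp add: remainder_def incr_def tensor_simps contract_simps contract2_simps algebra_simps)
qed

lemma remainder_dominated:
  assumes p: "controlled_bound \<gamma> \<eta> I X (Z, Z') K" and X: "path_bound \<gamma> I X L" and st: "s \<in> I" "t \<in> I"
  shows "dominated (2 * K + 2 * K * L) \<eta> \<bar>t - s\<bar> (norm (remainder X Z Z' s t))"
proof -
  have Z: "path_bound \<gamma> I Z K" "path_bound (\<eta> - \<gamma>) I Z' K"
    "norm (remainder X Z Z' s t) \<le> K * \<bar>t - s\<bar> powr \<eta>"
    using p st by (auto simp: controlled_bound_def)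
  have K: "0 \<le> K" "0 \<le> L" "norm (Z' s) \<le> K" using Z X st by (auto simp: path_bound_def)
  have "norm (Z' s) * norm (incr X s t) \<le> K * (2 * L)"
    using K path_bound_incr_le[OF X st] by (intro mult_mono) auto
  then have "norm (remainder X Z Z' s t) \<le> 2 * K + 2 * K * L"
    using norm_contract_le[of "Z' s" "incr X s t"] path_bound_incr_le[OF Z(1) st]
      norm_triangle_ineq4[of "incr Z s t" "contract (Z' s) (incr X s t)"]
    unfolding remainder_def by linarith
  moreover have "K * \<bar>t - s\<bar> powr \<eta> \<le> (2 * K + 2 * K * L) * \<bar>t - s\<bar> powr \<eta>"
    using K by (intro mult_right_mono) auto
  ultimately show ?thesis using Z(3) by (simp add: dominated_def)
qed

text \<open>
  The terms of \<open>N_rough_germ\<close> have the exponents \<open>(\<eta>, \<gamma>)\<close>, \<open>(\<gamma>, \<eta>)\<close>, \<open>(\<eta>, \<gamma>)\<close> and \<open>(\<eta> - \<gamma>, 2 * \<gamma>)\<close>.  In the third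
  one, the factors \<open>\<delta>X\<^sub>s\<^sub>u\<close> and \<open>\<delta>W'\<^sub>s\<^sub>u\<close> together give \<open>\<gamma> + (\<eta> - \<gamma>)\<close>.
\<close>

lemma rough_germ_Z2:
  assumes X: "rough_path_bound \<gamma> I X X2 L"
    and p: "controlled_bound \<gamma> \<eta> I X p K" and q: "controlled_bound \<gamma> \<eta> I X q M"
    and \<gamma>: "0 < \<gamma>" "\<gamma> < \<eta>"
  shows "N_op (rough_germ X2 p q) \<in> Z2_space (\<eta> + \<gamma>) I"
proof (rule Z2_spaceI)
  obtain Z Z' W W' where pq: "p = (Z, Z')" "q = (W, W')" by (cases p, cases q)
  have Z: "path_bound \<gamma> I Z K" "path_bound (\<eta> - \<gamma>) I Z' K" and W: "path_bound \<gamma> I W M" "path_bound (\<eta> - \<gamma>) I W' M"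
    using p q by (auto simp: controlled_bound_def pq)
  have XL: "path_bound \<gamma> I X L" using X by (simp add: rough_path_bound_def)
  have pos: "0 \<le> K" "0 \<le> M" "0 \<le> L" using Z W XL by (auto simp: path_bound_def)
  have sup: "norm (Z s) \<le> K" "norm (Z' s) \<le> K" "norm (W' s) \<le> M" if "s \<in> I" for s
    using Z W that by (auto simp: path_bound_def)
  have X2: "dominated L (2 * \<gamma>) \<bar>t - s\<bar> (norm (X2 s t))" if "s \<in> I" "t \<in> I" for s t
    using X that by (simp add: rough_path_bound_def dominated_def)
  have cZ: "continuous_on I Z" "continuous_on I Z'" "continuous_on I W" "continuous_on I W'" "continuous_on I X"
    using \<gamma> path_bound_continuous[OF Z(1)] path_bound_continuous[OF Z(2)] path_bound_continuous[OF W(1)]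
      path_bound_continuous[OF W(2)] path_bound_continuous[OF XL] by auto
  have cX2: "continuous_on (I \<times> I) (\<lambda>x. X2 (fst x) (snd x))"
    by (rule second_level_continuous[OF X \<gamma>(1)])
  note cont = continuous_on_compose2[OF cZ(1)] continuous_on_compose2[OF cZ(2)] continuous_on_compose2[OF cZ(3)]
    continuous_on_compose2[OF cZ(4)] continuous_on_compose2[OF cZ(5)]
  have cX2': "continuous_on (I \<times> I \<times> I) (\<lambda>x. X2 (fst (snd x)) (snd (snd x)))"
    by (rule continuous_on_compose2[OF cX2]) (auto intro: continuous_intros)
  have X2_0: "X2 s s = 0" if "s \<in> I" for s using X2[OF that that] \<gamma> by (simp add: dominated_def)
  show "rough_germ X2 p q \<in> Omega_C I"
  proof (rule Omega_C_memI)
    show "continuous_on (I \<times> I) (\<lambda>x. rough_germ X2 p q (fst x) (snd x))"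
      unfolding pq rough_germ_def prod.case incr_def by (intro continuous_intros cont cX2) auto
    show "norm (rough_germ X2 p q s t) \<le> K * (2 * M) + K * M * L" if "s \<in> I" "t \<in> I" for s t
    proof -
      have "norm (Z s) * norm (incr W s t) \<le> K * (2 * M)"
        using sup[OF that(1)] pos path_bound_incr_le[OF W(1) that] by (intro mult_mono) auto
      moreover have "norm (Z' s) * norm (W' s) * norm (X2 s t) \<le> K * M * L"
        using sup[OF that(1)] pos X2[OF that] by (intro mult_mono) (auto simp: dominated_def)
      ultimately show ?thesis
        using norm_tensor_le[of "Z s" "incr W s t"] norm_contract2_le[of "Z' s" "W' s" "X2 s t"]
          norm_triangle_ineq[of "tensor (Z s) (incr W s t)" "contract2 (Z' s) (W' s) (X2 s t)"]
        unfolding pq rough_germ_def prod.case by linarith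
    qed
    show "rough_germ X2 p q s s = 0" if "s \<in> I" for s
      using X2_0[OF that] by (simp add: pq rough_germ_def tensor_simps contract2_simps)
  qed
  define A1 A2 A3 A4 where
    "A1 s u t = - tensor (remainder X Z Z' s u) (incr W u t)" and
    "A2 s u t = - tensor (contract (Z' s) (incr X s u)) (remainder X W W' u t)" and
    "A3 s u t = - tensor (contract (Z' s) (incr X s u)) (contract (incr W' s u) (incr X u t))" and
    "A4 s u t = - (contract2 (incr Z' s u) (W' u) (X2 u t) + contract2 (Z' s) (incr W' s u) (X2 u t))" for s u t
  have "A1 \<in> Omega_C2_hoelder (\<eta> + \<gamma>) I"
  proof (rule Omega_C2_hoelder_productI[OF _ _ remainder_dominated[OF p[unfolded pq] XL] dominated_incr[OF W(1)]])
    show "continuous_on (I \<times> I \<times> I) (\<lambda>x. A1 (fst x) (fst (snd x)) (snd (snd x)))"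
      unfolding A1_def remainder_def incr_def by (intro continuous_intros cont) auto
  qed (use \<gamma> in \<open>auto simp: A1_def norm_tensor_le\<close>)
  moreover have "A2 \<in> Omega_C2_hoelder (\<eta> + \<gamma>) I"
    unfolding add.commute[of \<eta> \<gamma>]
  proof (rule Omega_C2_hoelder_productI[OF _ _ dominated_cmult[OF dominated_incr[OF XL] norm_ge_zero sup(2)]
        remainder_dominated[OF q[unfolded pq] XL]])
    show "continuous_on (I \<times> I \<times> I) (\<lambda>x. A2 (fst x) (fst (snd x)) (snd (snd x)))"
      unfolding A2_def remainder_def incr_def by (intro continuous_intros cont) auto
    show "norm (A2 s u t) \<le> norm (Z' s) * norm (incr X s u) * norm (remainder X W W' u t)" for s u t
      unfolding A2_def norm_minus_cancel
      using norm_tensor_le mult_right_mono[OF norm_contract_le norm_ge_zero] order.trans by blast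
  qed (use \<gamma> in auto)
  moreover have "A3 \<in> Omega_C2_hoelder (\<gamma> + (\<eta> - \<gamma>) + \<gamma>) I"
  proof (rule Omega_C2_hoelder_productI[OF _ _ dominated_mult[OF
        dominated_cmult[OF dominated_incr[OF XL] norm_ge_zero sup(2)] dominated_incr[OF W(2)]] dominated_incr[OF XL]])
    show "continuous_on (I \<times> I \<times> I) (\<lambda>x. A3 (fst x) (fst (snd x)) (snd (snd x)))"
      unfolding A3_def remainder_def incr_def by (intro continuous_intros cont) auto
    show "norm (A3 s u t) \<le> norm (Z' s) * norm (incr X s u) * norm (incr W' s u) * norm (incr X u t)" for s u t
    proof -
      have "norm (contract (Z' s) (incr X s u)) * norm (contract (incr W' s u) (incr X u t))
          \<le> (norm (Z' s) * norm (incr X s u)) * (norm (incr W' s u) * norm (incr X u t))"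
        by (intro mult_mono norm_contract_le) auto
      then show ?thesis
        using norm_tensor_le[of "contract (Z' s) (incr X s u)" "contract (incr W' s u) (incr X u t)"]
        by (simp add: A3_def mult.assoc)
    qed
  qed (use \<gamma> in auto)
  moreover have "A4 \<in> Omega_C2_hoelder ((\<eta> - \<gamma>) + 2 * \<gamma>) I"
  proof (rule Omega_C2_hoelder_productI[OF _ _ dominated_add[OF dominated_cmult[OF dominated_incr[OF Z(2)] pos(2) order.refl]
        dominated_cmult[OF dominated_incr[OF W(2)] pos(1) order.refl]] X2])
    show "continuous_on (I \<times> I \<times> I) (\<lambda>x. A4 (fst x) (fst (snd x)) (snd (snd x)))"
      unfolding A4_def remainder_def incr_def by (intro continuous_intros cont cX2') auto
    show "norm (A4 s u t) \<le> (M * norm (incr Z' s u) + K * norm (incr W' s u)) * norm (X2 u t)"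
      if "s \<in> I" "u \<in> I" "t \<in> I" for s u t
    proof -
      have "norm (incr Z' s u) * norm (W' u) * norm (X2 u t) \<le> norm (incr Z' s u) * M * norm (X2 u t)"
        using sup that pos by (intro mult_mono) auto
      moreover have "norm (Z' s) * norm (incr W' s u) * norm (X2 u t) \<le> K * norm (incr W' s u) * norm (X2 u t)"
        using sup that pos by (intro mult_mono) auto
      ultimately show ?thesis
        using norm_contract2_le[of "incr Z' s u" "W' u" "X2 u t"] norm_contract2_le[of "Z' s" "incr W' s u" "X2 u t"]
          norm_triangle_ineq[of "contract2 (incr Z' s u) (W' u) (X2 u t)" "contract2 (Z' s) (incr W' s u) (X2 u t)"]
        unfolding A4_def norm_minus_cancel by (simp add: algebra_simps)
    qed
  qed (use \<gamma> in auto)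
  ultimately have "(\<lambda>s u t. A1 s u t + A2 s u t + A3 s u t + A4 s u t) \<in> Omega_C2_hoelder (\<eta> + \<gamma>) I"
    by (intro Omega_C2_hoelder_add) (simp_all add: algebra_simps)
  then show "N_op (rough_germ X2 p q) \<in> Omega_C2_hoelder (\<eta> + \<gamma>) I"
  proof (rule Omega_C2_hoelder_cong)
    show "A1 s u t + A2 s u t + A3 s u t + A4 s u t = N_op (rough_germ X2 p q) s u t"
      if "s \<in> I" "u \<in> I" "t \<in> I" for s u t
      using N_rough_germ[of X2 s u t X Z Z' W W'] X that
      by (simp add: pq rough_path_bound_def A1_def A2_def A3_def A4_def)
  qed
qed

text \<open>
  Extending the data \<open>X\<close>, \<open>X2\<close>, \<open>p\<close>, \<open>q\<close> instead of the defect keeps it of the form \<open>N R\<close> with a germ \<open>R\<close> that is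
  continuous and bounded on the plane.
\<close>

lemma rough_germ_extendable:
  assumes I: "is_interval I" and X: "rough_path_bound \<gamma> I X X2 L"
    and p: "controlled_bound \<gamma> \<eta> I X p K" and q: "controlled_bound \<gamma> \<eta> I X q M"
    and \<gamma>: "0 < \<gamma>" "\<gamma> < \<eta>" and b: "b \<in> I"
  shows "extendable (\<eta> + \<gamma>) I (N_op (rough_germ X2 p q))"
proof -
  obtain Z Z' W W' where pq: "p = (Z, Z')" "q = (W, W')" by (cases p, cases q)
  obtain \<rho> where \<rho>: "approx_retraction I \<rho>" using approx_retraction_exists[OF I b] by blast
  have XL: "path_bound \<gamma> I X L" using X by (simp add: rough_path_bound_def)
  obtain X2' where X2': "rough_path_bound \<gamma> UNIV (extension \<rho> X) X2' L" "\<And>s t. s \<in> I \<Longrightarrow> t \<in> I \<Longrightarrow> X2' s t = X2 s t"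
    using rough_path_bound_extension[OF \<rho> X b \<gamma>(1)] by blast
  let ?p = "(extension \<rho> Z, extension \<rho> Z')" and ?q = "(extension \<rho> W, extension \<rho> W')"
  have Z: "path_bound \<gamma> I Z K" "path_bound (\<eta> - \<gamma>) I Z' K" and W: "path_bound \<gamma> I W M" "path_bound (\<eta> - \<gamma>) I W' M"
    using p q by (auto simp: controlled_bound_def pq)
  have "N_op (rough_germ X2' ?p ?q) \<in> Z2_space (\<eta> + \<gamma>) UNIV"
    by (rule rough_germ_Z2[OF X2'(1) controlled_bound_extension[OF \<rho> XL p[unfolded pq] \<gamma>]
          controlled_bound_extension[OF \<rho> XL q[unfolded pq] \<gamma>] \<gamma>])
  moreover have "N_op (rough_germ X2' ?p ?q) s u t = N_op (rough_germ X2 p q) s u t"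
    if "s \<in> I" "u \<in> I" "t \<in> I" for s u t
    using that X2'(2) \<gamma> extension_eq[OF \<rho> Z(1)] extension_eq[OF \<rho> Z(2)] extension_eq[OF \<rho> W(1)] extension_eq[OF \<rho> W(2)]
    by (simp add: pq rough_germ_def N_op_def incr_def)
  ultimately show ?thesis unfolding extendable_def by blast
qed

section \<open>The rough integral\<close>

text \<open>
  The individual norms are kept apart here: no product of a norm of \<open>Z\<close> and a norm of \<open>W\<close> occurs twice, so
  that the sum is at most the product of the semi-norms up to the coefficients in \<open>x\<close> and \<open>x2\<close>.
\<close>

lemma N_rough_germ_bound:
  assumes chen: "N_op X2 s u t = tensor (incr X s u) (incr X u t)"
    and h: "\<bar>u - s\<bar> \<le> h" "\<bar>t - u\<bar> \<le> h" and \<gamma>: "0 < \<gamma>" "\<gamma> < \<eta>"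
    and Z: "norm (Z' s) \<le> z0" "norm (incr Z' s u) \<le> z1 * \<bar>u - s\<bar> powr (\<eta> - \<gamma>)"
      "norm (remainder X Z Z' s u) \<le> zR * \<bar>u - s\<bar> powr \<eta>"
    and W: "norm (W' u) \<le> w0" "norm (incr W' s u) \<le> w1 * \<bar>u - s\<bar> powr (\<eta> - \<gamma>)"
      "norm (remainder X W W' u t) \<le> wR * \<bar>t - u\<bar> powr \<eta>" "norm (incr W u t) \<le> wg * \<bar>t - u\<bar> powr \<gamma>"
    and X: "norm (incr X s u) \<le> x * \<bar>u - s\<bar> powr \<gamma>" "norm (incr X u t) \<le> x * \<bar>t - u\<bar> powr \<gamma>"
      "norm (X2 u t) \<le> x2 * \<bar>t - u\<bar> powr (2 * \<gamma>)"
    and pos: "0 \<le> z0" "0 \<le> z1" "0 \<le> zR" "0 \<le> w0" "0 \<le> w1" "0 \<le> wR" "0 \<le> wg" "0 \<le> x" "0 \<le> x2"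
  shows "norm (N_op (rough_germ X2 (Z, Z') (W, W')) s u t)
    \<le> (zR * wg + z0 * x * wR + z0 * w1 * (x\<^sup>2 + x2) + z1 * w0 * x2) * h powr (\<eta> + \<gamma>)"
proof -
  have mono: "v \<le> c * h powr a" if "v \<le> c * \<bar>y\<bar> powr a" "\<bar>y\<bar> \<le> h" "0 \<le> c" "0 < a" for v c y a
    using that mult_left_mono[OF powr_mono2[of a "\<bar>y\<bar>" h], of c] by simp
  note Z' = Z(1) mono[OF Z(2) h(1) pos(2)] mono[OF Z(3) h(1) pos(3)]
  note W' = W(1) mono[OF W(2) h(1) pos(5)] mono[OF W(3) h(2) pos(6)] mono[OF W(4) h(2) pos(7) \<gamma>(1)]
  note X' = mono[OF X(1) h(1) pos(8) \<gamma>(1)] mono[OF X(2) h(2) pos(8) \<gamma>(1)] mono[OF X(3) h(2) pos(9)]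
  have e: "h powr (\<eta> + \<gamma>) = h powr \<eta> * h powr \<gamma>"
    "h powr (\<eta> + \<gamma>) = h powr \<gamma> * (h powr (\<eta> - \<gamma>) * h powr \<gamma>)"
    "h powr (\<eta> + \<gamma>) = h powr (\<eta> - \<gamma>) * h powr (2 * \<gamma>)"
    by (simp_all add: powr_add[symmetric] add.commute)
  have "norm (tensor (remainder X Z Z' s u) (incr W u t)) \<le> (zR * h powr \<eta>) * (wg * h powr \<gamma>)"
    using Z' W' \<gamma> pos by (intro order.trans[OF norm_tensor_le] mult_mono) auto
  moreover have zx: "norm (contract (Z' s) (incr X s u)) \<le> z0 * (x * h powr \<gamma>)"
    using Z' X' pos by (intro order.trans[OF norm_contract_le] mult_mono) auto
  have "norm (tensor (contract (Z' s) (incr X s u)) (remainder X W W' u t)) \<le> (z0 * (x * h powr \<gamma>)) * (wR * h powr \<eta>)"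
    using zx W' \<gamma> pos by (intro order.trans[OF norm_tensor_le] mult_mono) auto
  moreover have "norm (contract (incr W' s u) (incr X u t)) \<le> (w1 * h powr (\<eta> - \<gamma>)) * (x * h powr \<gamma>)"
    using W' X' \<gamma> pos by (intro order.trans[OF norm_contract_le] mult_mono) auto
  then have "norm (tensor (contract (Z' s) (incr X s u)) (contract (incr W' s u) (incr X u t)))
      \<le> (z0 * (x * h powr \<gamma>)) * ((w1 * h powr (\<eta> - \<gamma>)) * (x * h powr \<gamma>))"
    using zx pos by (intro order.trans[OF norm_tensor_le] mult_mono) auto
  moreover have "norm (contract2 (incr Z' s u) (W' u) (X2 u t)) \<le> (z1 * h powr (\<eta> - \<gamma>)) * w0 * (x2 * h powr (2 * \<gamma>))"
    using Z' W' X' \<gamma> pos by (intro order.trans[OF norm_contract2_le] mult_mono) auto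
  moreover have "norm (contract2 (Z' s) (incr W' s u) (X2 u t)) \<le> z0 * (w1 * h powr (\<eta> - \<gamma>)) * (x2 * h powr (2 * \<gamma>))"
    using Z' W' X' \<gamma> pos by (intro order.trans[OF norm_contract2_le] mult_mono) auto
  moreover have "norm (- a - b - c - (d + d')) \<le> norm a + norm b + norm c + (norm d + norm d')"
    for a b c d d' :: "real^'n^'n"
    using norm_triangle_ineq4[of "- a - b - c" "d + d'"] norm_triangle_ineq4[of "- a - b" c]
      norm_triangle_ineq4[of "- a" b] norm_triangle_ineq[of d d'] norm_minus_cancel[of a] by linarith
  ultimately have "norm (N_op (rough_germ X2 (Z, Z') (W, W')) s u t)
    \<le> (zR * h powr \<eta>) * (wg * h powr \<gamma>) + (z0 * (x * h powr \<gamma>)) * (wR * h powr \<eta>)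
      + (z0 * (x * h powr \<gamma>)) * ((w1 * h powr (\<eta> - \<gamma>)) * (x * h powr \<gamma>))
      + ((z1 * h powr (\<eta> - \<gamma>)) * w0 * (x2 * h powr (2 * \<gamma>)) + z0 * (w1 * h powr (\<eta> - \<gamma>)) * (x2 * h powr (2 * \<gamma>)))"
    unfolding N_rough_germ[OF chen] by (smt (verit))
  also have "\<dots> = zR * wg * (h powr \<eta> * h powr \<gamma>) + z0 * x * wR * (h powr \<eta> * h powr \<gamma>)
      + z0 * w1 * x\<^sup>2 * (h powr \<gamma> * (h powr (\<eta> - \<gamma>) * h powr \<gamma>))
      + (z1 * w0 * x2 + z0 * w1 * x2) * (h powr (\<eta> - \<gamma>) * h powr (2 * \<gamma>))"
    by (simp add: algebra_simps power2_eq_square)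
  also have "\<dots> = (zR * wg + z0 * x * wR + z0 * w1 * (x\<^sup>2 + x2) + z1 * w0 * x2) * h powr (\<eta> + \<gamma>)"
    unfolding e[symmetric] by (simp add: algebra_simps)
  finally show ?thesis .
qed

lemma Lambda_hoelder:
  assumes "z > 1" "is_interval I" "extendable z I A"
  shows "\<exists>K. \<forall>s\<in>I. \<forall>t\<in>I. norm (Lambda z I A s t) \<le> K * \<bar>t - s\<bar> powr z"
  using Lambda_eq_sew(3)[OF assms] Lambda_bound[OF assms] by metis

lemma germ_minus_Lambda_additive:
  assumes "z > 1" "is_interval I" "extendable z I (N_op R)" "s \<in> I" "u \<in> I" "t \<in> I"
  shows "R s t - Lambda z I (N_op R) s t
    = (R s u - Lambda z I (N_op R) s u) + (R u t - Lambda z I (N_op R) u t)"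
proof -
  have "N_op (Lambda z I (N_op R)) s u t = N_op R s u t"
    using Lambda_eq_sew(2)[OF assms(1-3)] assms by blast
  then show ?thesis by (simp add: N_op_def algebra_simps)
qed

lemma rough_germ_lincomb:
  "rough_germ X2 (pair_comb c p p') q s t = c *\<^sub>R rough_germ X2 p q s t + rough_germ X2 p' q s t"
  "rough_germ X2 q (pair_comb c p p') s t = c *\<^sub>R rough_germ X2 q p s t + rough_germ X2 q p' s t"
  by (simp_all add: rough_germ_def pair_comb_def case_prod_unfold incr_def tensor_simps contract2_simps algebra_simps)

context
  fixes I :: "real set" and \<gamma> \<eta> L :: real and X :: "real \<Rightarrow> real^'n" and X2
  assumes I: "is_interval I" and \<gamma>: "0 < \<gamma>" "\<gamma> < \<eta>" and dl: "1 < \<eta> + \<gamma>"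
    and X: "rough_path_bound \<gamma> I X X2 L"
begin

lemma rough_path_bound_on_I:
  shows "0 \<le> L" "s \<in> I \<Longrightarrow> t \<in> I \<Longrightarrow> norm (incr X s t) \<le> L * \<bar>t - s\<bar> powr \<gamma>"
    "s \<in> I \<Longrightarrow> t \<in> I \<Longrightarrow> norm (X2 s t) \<le> L * \<bar>t - s\<bar> powr (2 * \<gamma>)"
    "s \<in> I \<Longrightarrow> u \<in> I \<Longrightarrow> t \<in> I \<Longrightarrow> N_op X2 s u t = tensor (incr X s u) (incr X u t)"
  using X by (auto simp: rough_path_bound_def path_bound_def)

lemma rough_integral_additive:
  assumes p: "controlled_bound \<gamma> \<eta> I X p K" and q: "controlled_bound \<gamma> \<eta> I X q M"
    and st: "s \<in> I" "u \<in> I" "t \<in> I"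
  shows "rough_integral (\<eta> + \<gamma>) I X2 p q s t
    = rough_integral (\<eta> + \<gamma>) I X2 p q s u + rough_integral (\<eta> + \<gamma>) I X2 p q u t"
  unfolding rough_integral_def
  by (rule germ_minus_Lambda_additive[OF dl I rough_germ_extendable[OF I X p q \<gamma> st(1)] st])

lemma rough_integral_lincomb:
  assumes p: "controlled_bound \<gamma> \<eta> I X p K" and p': "controlled_bound \<gamma> \<eta> I X p' K'"
    and q: "controlled_bound \<gamma> \<eta> I X q M" and st: "s \<in> I" "t \<in> I"
  shows "rough_integral (\<eta> + \<gamma>) I X2 (pair_comb c p p') q s t
      = c *\<^sub>R rough_integral (\<eta> + \<gamma>) I X2 p q s t + rough_integral (\<eta> + \<gamma>) I X2 p' q s t" (is ?left)
    and "rough_integral (\<eta> + \<gamma>) I X2 q (pair_comb c p p') s t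
      = c *\<^sub>R rough_integral (\<eta> + \<gamma>) I X2 q p s t + rough_integral (\<eta> + \<gamma>) I X2 q p' s t" (is ?right)
proof -
  note ext = rough_germ_extendable[OF I X _ _ \<gamma> st(1)]
  note pp = controlled_bound_pair_comb[OF p p', of c]
  have "Lambda (\<eta> + \<gamma>) I (N_op (rough_germ X2 (pair_comb c p p') q)) s t
      = c *\<^sub>R Lambda (\<eta> + \<gamma>) I (N_op (rough_germ X2 p q)) s t + Lambda (\<eta> + \<gamma>) I (N_op (rough_germ X2 p' q)) s t"
    by (rule Lambda_lincomb[OF dl I ext[OF p q] ext[OF p' q] ext[OF pp q] _ st])
       (simp add: N_op_def rough_germ_lincomb algebra_simps)
  then show ?left by (simp add: rough_integral_def rough_germ_lincomb algebra_simps)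
  have "Lambda (\<eta> + \<gamma>) I (N_op (rough_germ X2 q (pair_comb c p p'))) s t
      = c *\<^sub>R Lambda (\<eta> + \<gamma>) I (N_op (rough_germ X2 q p)) s t + Lambda (\<eta> + \<gamma>) I (N_op (rough_germ X2 q p')) s t"
    by (rule Lambda_lincomb[OF dl I ext[OF q p] ext[OF q p'] ext[OF q pp] _ st])
       (simp add: N_op_def rough_germ_lincomb algebra_simps)
  then show ?right by (simp add: rough_integral_def rough_germ_lincomb algebra_simps)
qed

lemma rough_Lambda_bound:
  assumes p: "controlled_bound \<gamma> \<eta> I X (Z, Z') K" and q: "controlled_bound \<gamma> \<eta> I X (W, W') M" and st: "s \<in> I" "t \<in> I"
  shows "norm (Lambda (\<eta> + \<gamma>) I (N_op (rough_germ X2 (Z, Z') (W, W'))) s t)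
    \<le> 1 / (2 powr (\<eta> + \<gamma>) - 2) * (K * M * (1 + 3 * L + L\<^sup>2)) * \<bar>t - s\<bar> powr (\<eta> + \<gamma>)"
proof (rule Lambda_bound[OF dl I rough_germ_extendable[OF I X p q \<gamma> st(1)] _ st])
  fix s t assume st: "s \<in> I" "t \<in> I"
  let ?m = "(s + t) / 2"
  have m: "?m \<in> I" by (rule midpoint_mem_interval[OF I st])
  have pos: "0 \<le> K" "0 \<le> M" using p q by (auto simp: controlled_bound_def path_bound_def)
  have "norm (N_op (rough_germ X2 (Z, Z') (W, W')) s ?m t)
      \<le> (K * M + K * L * M + K * M * (L\<^sup>2 + L) + K * M * L) * (\<bar>t - s\<bar> / 2) powr (\<eta> + \<gamma>)"
  proof (rule N_rough_germ_bound[OF rough_path_bound_on_I(4)[OF st(1) m st(2)] _ _ \<gamma>])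
    show "\<bar>?m - s\<bar> \<le> \<bar>t - s\<bar> / 2" "\<bar>t - ?m\<bar> \<le> \<bar>t - s\<bar> / 2" by (auto simp: field_simps abs_if)
  qed (use p q st m rough_path_bound_on_I pos in \<open>simp_all only: controlled_bound_def path_bound_def fst_conv snd_conv\<close>)
  then show "norm (N_op (rough_germ X2 (Z, Z') (W, W')) s ?m t)
      \<le> K * M * (1 + 3 * L + L\<^sup>2) * (\<bar>t - s\<bar> / 2) powr (\<eta> + \<gamma>)"
    by (simp add: algebra_simps)
qed

text \<open>
  The increment of the integral is \<open>Z \<delta>W + Z' W' X2 - \<Lambda>\<close>, of orders \<open>\<gamma>\<close>, \<open>2 * \<gamma>\<close>, \<open>\<eta> + \<gamma>\<close>.  Subtracting \<open>Z W' \<delta>X\<close>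
  improves the first order to \<open>\<eta>\<close>, so that the remainder has order \<open>min (2 * \<gamma>) \<eta>\<close>.  On a bounded interval
  higher powers of \<open>\<bar>t - s\<bar>\<close> are controlled by lower ones.  The constant does not depend on \<open>p\<close> and \<open>q\<close>, so
  this bound is also the one behind continuity.
\<close>

lemma integration_map_bound:
  assumes "bounded I" and zero: "0 \<in> I"
  shows "\<exists>C\<ge>0. \<forall>p q K M. controlled_bound \<gamma> \<eta> I X p K \<longrightarrow> controlled_bound \<gamma> \<eta> I X q M \<longrightarrow>
    controlled_bound \<gamma> (min (2 * \<gamma>) \<eta>) I X (integration_map (\<eta> + \<gamma>) I X2 p q) (C * (K * M))"
proof -
  let ?\<theta> = "min (2 * \<gamma>) \<eta>" and ?\<delta> = "\<eta> + \<gamma>"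
  obtain B where B: "\<And>t. t \<in> I \<Longrightarrow> \<bar>t\<bar> \<le> B" using assms(1) by (auto simp: bounded_iff)
  define D where "D = max 1 (2 * B)"
  define E where "E = D powr ?\<delta>"
  define c where "c = 1 / (2 powr ?\<delta> - 2) * (1 + 3 * L + L\<^sup>2)"
  define G where "G = 2 + L + c"
  have D: "1 \<le> D" "\<bar>t - s\<bar> \<le> D" if "s \<in> I" "t \<in> I" for s t
    using B[OF that(1)] B[OF that(2)] by (auto simp: D_def)
  \<comment> \<open>\<open>E\<close> bounds all powers of \<open>\<bar>t - s\<bar>\<close> with exponents between \<open>0\<close> and \<open>\<eta> + \<gamma>\<close>; a second factor \<open>E\<close> is spent below on the sup norm of the integral\<close>
  have E1: "1 \<le> E" unfolding E_def using D[OF zero zero] \<gamma> by (intro ge_one_powr_ge_zero) auto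
  have conv: "\<bar>t - s\<bar> powr a \<le> E * \<bar>t - s\<bar> powr b"
    if "s \<in> I" "t \<in> I" "0 \<le> b" "b \<le> a" "a \<le> ?\<delta>" for s t a b
  proof -
    have "\<bar>t - s\<bar> powr a = \<bar>t - s\<bar> powr (a - b) * \<bar>t - s\<bar> powr b" by (simp add: powr_add[symmetric])
    also have "\<bar>t - s\<bar> powr (a - b) \<le> D powr (a - b)" using D that by (intro powr_mono2) auto
    also have "D powr (a - b) \<le> E" unfolding E_def using D that by (intro powr_mono) auto
    finally show ?thesis by (simp add: mult_right_mono)
  qed
  have "2 powr ?\<delta> > (2::real)" using dl powr_less_cancel_iff[of 2 1 ?\<delta>] by simp
  then have c: "0 \<le> c" using rough_path_bound_on_I(1) by (simp add: c_def)
  have L: "0 \<le> L" by (rule rough_path_bound_on_I(1))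
  have G: "0 \<le> G" using c L by (simp add: G_def)
  have "controlled_bound \<gamma> ?\<theta> I X (integration_map ?\<delta> I X2 p q) (E * E * G * (K * M))"
    if p: "controlled_bound \<gamma> \<eta> I X p K" and q: "controlled_bound \<gamma> \<eta> I X q M" for p q K M
  proof -
    obtain Z Z' W W' where pq: "p = (Z, Z')" "q = (W, W')" by (cases p, cases q)
    have Z: "path_bound \<gamma> I Z K" "path_bound (\<eta> - \<gamma>) I Z' K" and W: "path_bound \<gamma> I W M" "path_bound (\<eta> - \<gamma>) I W' M"
      and RW: "\<And>s t. s \<in> I \<Longrightarrow> t \<in> I \<Longrightarrow> norm (remainder X W W' s t) \<le> M * \<bar>t - s\<bar> powr \<eta>"
      using p q by (auto simp: controlled_bound_def pq)
    have pos: "0 \<le> K" "0 \<le> M" "0 \<le> K * M" using Z W by (auto simp: path_bound_def)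
    let ?J = "rough_integral ?\<delta> I X2 p q"
    let ?Y' = "\<lambda>t. tensor_dual (Z t) (W' t)"
    have scale: "v \<le> E * E * G * (K * M) * y" if "v \<le> E * G * (K * M) * y" "0 \<le> y" for v y
    proof -
      have "1 * (E * G * (K * M) * y) \<le> E * (E * G * (K * M) * y)"
        using E1 G pos that by (intro mult_right_mono mult_nonneg_nonneg) auto
      then show ?thesis using that by (simp add: mult_ac)
    qed
    have area: "norm (contract2 (Z' s) (W' s) (X2 s t)) \<le> K * M * L * (E * \<bar>t - s\<bar> powr b)"
      if st: "s \<in> I" "t \<in> I" and b: "0 \<le> b" "b \<le> 2 * \<gamma>" for s t b
    proof -
      have "norm (contract2 (Z' s) (W' s) (X2 s t)) \<le> K * M * (L * \<bar>t - s\<bar> powr (2 * \<gamma>))"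
        using Z W st pos rough_path_bound_on_I(3)[OF st]
        by (intro order.trans[OF norm_contract2_le] mult_mono) (auto simp: path_bound_def)
      also have "\<dots> \<le> K * M * (L * (E * \<bar>t - s\<bar> powr b))"
        using conv[OF st b] \<gamma> pos L by (intro mult_left_mono) auto
      finally show ?thesis by (simp add: mult_ac)
    qed
    have lam: "norm (Lambda ?\<delta> I (N_op (rough_germ X2 p q)) s t) \<le> K * M * c * (E * \<bar>t - s\<bar> powr b)"
      if st: "s \<in> I" "t \<in> I" and b: "0 \<le> b" "b \<le> ?\<delta>" for s t b
    proof -
      have "norm (Lambda ?\<delta> I (N_op (rough_germ X2 p q)) s t) \<le> K * M * c * \<bar>t - s\<bar> powr ?\<delta>"
        using rough_Lambda_bound[OF p[unfolded pq] q[unfolded pq] st] by (simp add: pq c_def mult_ac)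
      also have "\<dots> \<le> K * M * c * (E * \<bar>t - s\<bar> powr b)"
        using conv[OF st b] pos c by (intro mult_left_mono) auto
      finally show ?thesis .
    qed
    \<comment> \<open>\<open>G\<close> collects the constants of the three terms of the integral; its summand \<open>2\<close> rather than \<open>1\<close> serves the two terms of the increment of \<open>Z W'\<close>\<close>
    have tri: "norm (x + y - z) \<le> E * G * (K * M) * v"
      if "norm x \<le> K * M * (E * v)" "norm y \<le> K * M * L * (E * v)" "norm z \<le> K * M * c * (E * v)" "0 \<le> v"
      for x y z :: "real^'n^'n" and v
    proof -
      have "norm (x + y - z) \<le> norm x + norm y + norm z"
        using norm_triangle_ineq4[of "x + y" z] norm_triangle_ineq[of x y] by linarith
      also have "\<dots> \<le> K * M * (E * v) + K * M * L * (E * v) + K * M * c * (E * v)" using that by linarith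
      also have "\<dots> \<le> E * G * (K * M) * v"
      proof -
        have "0 \<le> K * M * (E * v)" using pos E1 that by simp
        then show ?thesis by (simp add: G_def algebra_simps)
      qed
      finally show ?thesis .
    qed
    have J: "norm (?J s t) \<le> E * G * (K * M) * \<bar>t - s\<bar> powr \<gamma>" if st: "s \<in> I" "t \<in> I" for s t
    proof -
      have "norm (tensor (Z s) (incr W s t)) \<le> K * (M * \<bar>t - s\<bar> powr \<gamma>)"
        using Z W st pos by (intro order.trans[OF norm_tensor_le] mult_mono) (auto simp: path_bound_def)
      also have "\<dots> \<le> K * (M * (E * \<bar>t - s\<bar> powr \<gamma>))"
        using E1 pos by (intro mult_left_mono mult_right_mono[of 1 E, simplified]) auto
      finally have "norm (tensor (Z s) (incr W s t)) \<le> K * M * (E * \<bar>t - s\<bar> powr \<gamma>)" by (simp add: mult_ac)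
      from tri[OF this area[OF st] lam[OF st]] show ?thesis
        using \<gamma> by (simp add: rough_integral_def rough_germ_def pq)
    qed
    have rem: "norm (?J s t - contract (?Y' s) (incr X s t)) \<le> E * G * (K * M) * \<bar>t - s\<bar> powr ?\<theta>"
      if st: "s \<in> I" "t \<in> I" for s t
    proof -
      have "norm (tensor (Z s) (remainder X W W' s t)) \<le> K * (M * \<bar>t - s\<bar> powr \<eta>)"
        using Z RW[OF st] st pos by (intro order.trans[OF norm_tensor_le] mult_mono) (auto simp: path_bound_def)
      also have "\<dots> \<le> K * (M * (E * \<bar>t - s\<bar> powr ?\<theta>))"
        using conv[OF st, of ?\<theta> \<eta>] \<gamma> pos by (intro mult_left_mono) auto
      finally have "norm (tensor (Z s) (remainder X W W' s t)) \<le> K * M * (E * \<bar>t - s\<bar> powr ?\<theta>)"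
        by (simp add: mult_ac)
      from tri[OF this area[OF st] lam[OF st]] show ?thesis
        using \<gamma> by (simp add: rough_integral_def rough_germ_def pq remainder_def tensor_simps contract_tensor_dual algebra_simps)
    qed
    have J0: "?J 0 t - ?J 0 s = ?J s t" if "s \<in> I" "t \<in> I" for s t
      using rough_integral_additive[OF p q zero that] by simp
    have "path_bound \<gamma> I (\<lambda>t. ?J 0 t) (E * E * G * (K * M))"
    proof -
      have "norm (?J 0 t) \<le> E * E * G * (K * M)" if t: "t \<in> I" for t
      proof -
        have "\<bar>t - 0\<bar> powr \<gamma> \<le> E"
          using conv[OF zero t, of 0 \<gamma>] \<gamma> E1 by (cases "t = 0") auto
        then have "E * G * (K * M) * \<bar>t - 0\<bar> powr \<gamma> \<le> E * G * (K * M) * E"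
          using E1 G pos by (intro mult_left_mono) auto
        then show ?thesis using J[OF zero t] by (simp add: mult_ac)
      qed
      then show ?thesis
        using E1 G pos J scale by (simp add: path_bound_def incr_def J0)
    qed
    moreover have "path_bound (?\<theta> - \<gamma>) I ?Y' (E * E * G * (K * M))"
    proof -
      have n: "norm (tensor_dual (Z t) (W' t)) \<le> K * M" if "t \<in> I" for t
        using Z W that pos by (intro order.trans[OF norm_tensor_dual_le] mult_mono) (auto simp: path_bound_def)
      have EG: "2 * E \<le> E * G" "1 \<le> E * E * G"
      proof -
        show "2 * E \<le> E * G" using E1 L c by (simp add: G_def)
        have "1 \<le> E * G" using E1 \<open>2 * E \<le> E * G\<close> by linarith
        then have "1 * 1 \<le> E * (E * G)" using E1 by (intro mult_mono) linarith+
        then show "1 \<le> E * E * G" by (simp add: mult_ac)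
      qed
      have "norm (tensor_dual (Z t) (W' t)) \<le> E * E * G * (K * M)" if "t \<in> I" for t
        using n[OF that] mult_right_mono[OF EG(2) pos(3)] by simp
      moreover have "norm (incr ?Y' s t) \<le> E * G * (K * M) * \<bar>t - s\<bar> powr (?\<theta> - \<gamma>)" if st: "s \<in> I" "t \<in> I" for s t
      proof -
        let ?v = "\<bar>t - s\<bar> powr (?\<theta> - \<gamma>)"
        have "norm (tensor_dual (incr Z s t) (W' t)) \<le> (K * \<bar>t - s\<bar> powr \<gamma>) * M"
          using Z W st pos by (intro order.trans[OF norm_tensor_dual_le] mult_mono) (auto simp: path_bound_def)
        also have "\<dots> \<le> (K * (E * ?v)) * M"
          using conv[OF st, of "?\<theta> - \<gamma>" \<gamma>] \<gamma> pos by (intro mult_left_mono mult_right_mono) auto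
        finally have 1: "norm (tensor_dual (incr Z s t) (W' t)) \<le> (K * (E * ?v)) * M" .
        have "norm (tensor_dual (Z s) (incr W' s t)) \<le> K * (M * \<bar>t - s\<bar> powr (\<eta> - \<gamma>))"
          using Z W st pos by (intro order.trans[OF norm_tensor_dual_le] mult_mono) (auto simp: path_bound_def)
        also have "\<dots> \<le> K * (M * (E * ?v))"
          using conv[OF st, of "?\<theta> - \<gamma>" "\<eta> - \<gamma>"] \<gamma> pos by (intro mult_left_mono) auto
        finally have 2: "norm (tensor_dual (Z s) (incr W' s t)) \<le> K * (M * (E * ?v))" .
        have "incr ?Y' s t = tensor_dual (incr Z s t) (W' t) + tensor_dual (Z s) (incr W' s t)"
          by (simp add: incr_def tensor_dual_simps)
        then have "norm (incr ?Y' s t) \<le> (K * (E * ?v)) * M + K * (M * (E * ?v))"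
          using 1 2 norm_triangle_ineq[of "tensor_dual (incr Z s t) (W' t)" "tensor_dual (Z s) (incr W' s t)"]
          by (simp only:)
        also have "\<dots> = 2 * E * (K * M * ?v)" by simp
        also have "\<dots> \<le> E * G * (K * M * ?v)" using EG(1) pos by (intro mult_right_mono) auto
        finally show ?thesis by (simp add: mult_ac)
      qed
      ultimately show ?thesis using E1 G pos scale by (simp add: path_bound_def)
    qed
    moreover have "norm (remainder X (\<lambda>t. ?J 0 t) ?Y' s t) \<le> E * E * G * (K * M) * \<bar>t - s\<bar> powr ?\<theta>"
      if st: "s \<in> I" "t \<in> I" for s t
      using scale[OF rem[OF st]] by (simp add: remainder_def incr_def J0[OF st])
    ultimately show ?thesis
      by (simp add: controlled_bound_def integration_map_def pq tensor_dual_def)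
  qed
  then show ?thesis using E1 G by (intro exI[of _ "E * E * G"]) auto
qed

end

section \<open>Agreement with the Young integral\<close>

lemma path_is_controlled:
  assumes \<gamma>: "0 < \<gamma>" "\<gamma> < \<eta>" and X: "X \<in> C_hoelder \<gamma> I" and F: "F \<in> C_hoelder \<eta> I"
  shows "(F, \<lambda>_. 0) \<in> controlled \<gamma> \<eta> I X"
proof -
  obtain K where K: "path_bound \<eta> I F K" using F C_hoelder_iff_path_bound[of \<eta>] \<gamma> by auto
  have "path_bound \<gamma> I F (2 * K)" by (rule path_bound_weaken[OF K]) (use \<gamma> in auto)
  moreover have "path_bound (\<eta> - \<gamma>) I (\<lambda>_. 0) (2 * K)"
    using K by (simp add: path_bound_def incr_def)
  moreover have "norm (remainder X F (\<lambda>_. 0) s t) \<le> 2 * K * \<bar>t - s\<bar> powr \<eta>" if "s \<in> I" "t \<in> I" for s t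
  proof -
    have "norm (incr F s t) \<le> K * \<bar>t - s\<bar> powr \<eta>" "0 \<le> K * \<bar>t - s\<bar> powr \<eta>"
      using K that by (auto simp: path_bound_def)
    then show ?thesis by (simp add: remainder_def contract_simps)
  qed
  ultimately have "controlled_bound \<gamma> \<eta> I X (F, \<lambda>_. 0) (2 * K)" by (simp add: controlled_bound_def)
  then show ?thesis using controlled_iff_bound[OF \<gamma> X] by blast
qed

text \<open>
  Both integrals are additive, and they differ by \<open>Z' W' X2\<close> and two values of \<open>\<Lambda>\<close>.  All three have an order
  larger than \<open>1\<close>, or the first one vanishes, so uniqueness applies.
\<close>

lemma rough_integral_eq_young:
  assumes I: "is_interval I" and \<gamma>: "0 < \<gamma>" "\<gamma> < \<eta>" and dl: "1 < \<eta> + \<gamma>"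
    and X: "rough_path_bound \<gamma> I X X2 L"
    and p: "controlled_bound \<gamma> \<eta> I X (Z, Z') K" and q: "controlled_bound \<gamma> \<eta> I X (W, W') M"
    and Z: "path_bound \<rho> I Z K'" and W: "path_bound \<sigma> I W M'" and \<rho>: "0 < \<rho>" "0 < \<sigma>" "1 < \<rho> + \<sigma>"
    and area: "(\<forall>u\<in>I. Z' u = 0) \<or> (\<forall>u\<in>I. W' u = 0) \<or> 1 < 2 * \<gamma>"
    and st: "s \<in> I" "t \<in> I"
  shows "rough_integral (\<eta> + \<gamma>) I X2 (Z, Z') (W, W') s t = young_integral \<rho> \<sigma> I Z W s t"
proof -
  let ?A = "N_op (rough_germ X2 (Z, Z') (W, W'))" and ?Y = "N_op (\<lambda>s t. tensor (Z s) (incr W s t))"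
  have ext: "extendable (\<eta> + \<gamma>) I ?A" by (rule rough_germ_extendable[OF I X p q \<gamma> st(1)])
  have extY: "extendable (\<rho> + \<sigma>) I ?Y" by (rule young_germ_extendable[OF I Z W]) (use \<rho> st in auto)
  define D where "D s t = rough_integral (\<eta> + \<gamma>) I X2 (Z, Z') (W, W') s t - young_integral \<rho> \<sigma> I Z W s t" for s t
  have KM: "0 \<le> K" "0 \<le> M" using p q by (auto simp: controlled_bound_def path_bound_def)
  have "\<exists>C1 z1. 1 < z1 \<and> (\<forall>a\<in>I. \<forall>b\<in>I. norm (contract2 (Z' a) (W' a) (X2 a b)) \<le> C1 * \<bar>b - a\<bar> powr z1)"
  proof (cases "1 < 2 * \<gamma>")
    case True
    have "norm (contract2 (Z' a) (W' a) (X2 a b)) \<le> K * M * L * \<bar>b - a\<bar> powr (2 * \<gamma>)" if "a \<in> I" "b \<in> I" for a b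
    proof -
      have "norm (Z' a) * norm (W' a) * norm (X2 a b) \<le> K * M * (L * \<bar>b - a\<bar> powr (2 * \<gamma>))"
        using p q X that KM by (intro mult_mono) (auto simp: controlled_bound_def path_bound_def rough_path_bound_def)
      then show ?thesis using norm_contract2_le[of "Z' a" "W' a" "X2 a b"] by (simp add: mult_ac)
    qed
    then show ?thesis using True by blast
  next
    case False
    then have "contract2 (Z' a) (W' a) (X2 a b) = 0" if "a \<in> I" for a b
      using area that by (auto simp: contract2_simps)
    \<comment> \<open>any exponent larger than \<open>1\<close> would do here\<close>
    then show ?thesis by (intro exI[of _ 0] exI[of _ 2]) auto
  qed
  then obtain C1 z1 where C1: "1 < z1"
    "\<And>a b. a \<in> I \<Longrightarrow> b \<in> I \<Longrightarrow> norm (contract2 (Z' a) (W' a) (X2 a b)) \<le> C1 * \<bar>b - a\<bar> powr z1" by blast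
  obtain C2 where C2: "\<And>a b. a \<in> I \<Longrightarrow> b \<in> I \<Longrightarrow> norm (Lambda (\<eta> + \<gamma>) I ?A a b) \<le> C2 * \<bar>b - a\<bar> powr (\<eta> + \<gamma>)"
    using Lambda_hoelder[OF dl I ext] by blast
  obtain C3 where C3: "\<And>a b. a \<in> I \<Longrightarrow> b \<in> I \<Longrightarrow> norm (Lambda (\<rho> + \<sigma>) I ?Y a b) \<le> C3 * \<bar>b - a\<bar> powr (\<rho> + \<sigma>)"
    using Lambda_hoelder[OF \<rho>(3) I extY] by blast
  define \<omega> where "\<omega> x = C1 * \<bar>x\<bar> powr z1 + C2 * \<bar>x\<bar> powr (\<eta> + \<gamma>) + C3 * \<bar>x\<bar> powr (\<rho> + \<sigma>)" for x
  have "D s t = 0"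
  proof (rule bisect_invariant_eq_0[OF I _ _ _ st])
    fix s t assume st: "s \<in> I" "t \<in> I"
    note m = midpoint_mem_interval[OF I st]
    have "young_integral \<rho> \<sigma> I Z W s t
        = young_integral \<rho> \<sigma> I Z W s ((s + t) / 2) + young_integral \<rho> \<sigma> I Z W ((s + t) / 2) t"
      unfolding young_integral_def by (rule germ_minus_Lambda_additive[OF \<rho>(3) I extY st(1) m st(2)])
    then show "bisect D s t = D s t"
      using rough_integral_additive[OF I \<gamma> dl X p q st(1) m st(2)] by (simp add: D_def bisect_def)
    have "D s t = contract2 (Z' s) (W' s) (X2 s t) - Lambda (\<eta> + \<gamma>) I ?A s t + Lambda (\<rho> + \<sigma>) I ?Y s t"
      by (simp add: D_def rough_integral_def young_integral_def rough_germ_def)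
    also have "norm \<dots> \<le> norm (contract2 (Z' s) (W' s) (X2 s t)) + norm (Lambda (\<eta> + \<gamma>) I ?A s t)
        + norm (Lambda (\<rho> + \<sigma>) I ?Y s t)"
      by (intro order.trans[OF norm_triangle_ineq] add_mono norm_triangle_ineq4 order.refl)
    also have "\<dots> \<le> \<omega> \<bar>t - s\<bar>"
      using C1(2)[OF st] C2[OF st] C3[OF st] by (simp add: \<omega>_def)
    finally show "norm (D s t) \<le> \<omega> \<bar>t - s\<bar>" .
  next
    fix x
    have "(\<lambda>n. 2 ^ n * (C1 * \<bar>x / 2 ^ n\<bar> powr z1) + 2 ^ n * (C2 * \<bar>x / 2 ^ n\<bar> powr (\<eta> + \<gamma>))
        + 2 ^ n * (C3 * \<bar>x / 2 ^ n\<bar> powr (\<rho> + \<sigma>))) \<longlonglongrightarrow> 0 + 0 + 0"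
      by (intro tendsto_add powr_rescale_lim C1(1) dl \<rho>(3))
    then show "(\<lambda>n. 2 ^ n * \<omega> (x / 2 ^ n)) \<longlonglongrightarrow> 0" by (simp only: \<omega>_def distrib_left add_0)
  qed
  then show ?thesis by (simp add: D_def)
qed

section \<open>The bound and the continuity of integration\<close>

text \<open>
  The expression to be estimated is \<open>- \<Lambda> N\<close> of the germ.  The coefficients \<open>1\<close>, \<open>x\<close>, \<open>x\<^sup>2 + x2\<close>, \<open>x2\<close> that
  \<open>N_rough_germ_bound\<close> produces, with the norms \<open>x\<close> of \<open>X\<close> and \<open>x2\<close> of \<open>X2\<close>, are all at most
  \<open>max 1 (x\<^sup>2 + x2)\<close>.
\<close>

lemma rough_integral_bound:
  assumes I: "is_interval I" and \<gamma>: "0 < \<gamma>" "\<gamma> < \<eta>" and dl: "1 < \<eta> + \<gamma>"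
    and X: "X \<in> C_hoelder \<gamma> I" and X2: "X2 \<in> Omega_C_hoelder (2 * \<gamma>) I"
    and chen: "\<forall>s\<in>I. \<forall>u\<in>I. \<forall>t\<in>I. N_op X2 s u t = tensor (incr X s u) (incr X u t)"
    and p: "(Z, Z') \<in> controlled \<gamma> \<eta> I X" and q: "(W, W') \<in> controlled \<gamma> \<eta> I X"
    and st: "s \<in> I" "t \<in> I"
  shows "norm (rough_integral (\<eta> + \<gamma>) I X2 (Z, Z') (W, W') s t - tensor (Z s) (incr W s t)
      - contract2 (Z' s) (W' s) (X2 s t))
    \<le> 1 / (2 powr (\<eta> + \<gamma>) - 2) * \<bar>t - s\<bar> powr (\<eta> + \<gamma>)
      * max 1 ((path_norm \<gamma> I X)\<^sup>2 + Omega_norm (2 * \<gamma>) I X2)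
      * D_seminorm \<gamma> \<eta> I X (Z, Z') * D_seminorm \<gamma> \<eta> I X (W, W')"
proof -
  obtain L where L: "rough_path_bound \<gamma> I X X2 L" using rough_path_bound_exists[OF \<gamma>(1) X X2 chen] by blast
  define z0 z1 zR zg where "z0 = sup_norm I Z'" and "z1 = path_norm (\<eta> - \<gamma>) I Z'"
    and "zR = Omega_norm \<eta> I (remainder X Z Z')" and "zg = path_norm \<gamma> I Z"
  define w0 w1 wR wg where "w0 = sup_norm I W'" and "w1 = path_norm (\<eta> - \<gamma>) I W'"
    and "wR = Omega_norm \<eta> I (remainder X W W')" and "wg = path_norm \<gamma> I W"
  define x x2 where "x = path_norm \<gamma> I X" and "x2 = Omega_norm (2 * \<gamma>) I X2"
  define m where "m = max 1 (x\<^sup>2 + x2)"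
  note Z = controlled_norms[OF p, folded z0_def z1_def zR_def zg_def]
  note W = controlled_norms[OF q, folded w0_def w1_def wR_def wg_def]
  have x: "0 \<le> x" "0 \<le> x2"
    using path_norm_nonneg[OF X] Omega_norm_nonneg[of "2 * \<gamma>" I X2] X2 by (auto simp: x_def x2_def Omega_C_hoelder_def)
  have "norm (N_op (rough_germ X2 (Z, Z') (W, W')) a ((a + b) / 2) b)
      \<le> (zR * wg + z0 * x * wR + z0 * w1 * (x\<^sup>2 + x2) + z1 * w0 * x2) * (\<bar>b - a\<bar> / 2) powr (\<eta> + \<gamma>)"
    if ab: "a \<in> I" "b \<in> I" for a b
  proof -
    note mid = midpoint_mem_interval[OF I ab]
    show ?thesis
    proof (rule N_rough_germ_bound[where s = a and u = "(a + b) / 2" and t = b and X = X])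
      show "N_op X2 a ((a + b) / 2) b = tensor (incr X a ((a + b) / 2)) (incr X ((a + b) / 2) b)"
        using chen ab mid by blast
      show "\<bar>(a + b) / 2 - a\<bar> \<le> \<bar>b - a\<bar> / 2" "\<bar>b - (a + b) / 2\<bar> \<le> \<bar>b - a\<bar> / 2"
        by (auto simp: field_simps abs_if)
    qed (fact \<gamma> Z(7)[OF ab(1)] Z(8)[OF ab(1) mid] Z(9)[OF ab(1) mid]
          W(7)[OF mid] W(8)[OF ab(1) mid] W(9)[OF mid ab(2)] W(10)[OF mid ab(2)]
          path_norm_upper[OF X ab(1) mid, folded x_def] path_norm_upper[OF X mid ab(2), folded x_def]
          Omega_norm_upper[OF X2 mid ab(2), folded x2_def] Z(2,3,4) W(2,3,4,5) x)+
  qed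
  moreover have b: "controlled_bound \<gamma> \<eta> I X (Z, Z') (sup_norm I Z + D_seminorm \<gamma> \<eta> I X (Z, Z'))"
    "controlled_bound \<gamma> \<eta> I X (W, W') (sup_norm I W + D_seminorm \<gamma> \<eta> I X (W, W'))"
    using controlled_bound_norm[OF p] controlled_bound_norm[OF q] by simp_all
  ultimately have "norm (Lambda (\<eta> + \<gamma>) I (N_op (rough_germ X2 (Z, Z') (W, W'))) s t)
      \<le> 1 / (2 powr (\<eta> + \<gamma>) - 2) * (zR * wg + z0 * x * wR + z0 * w1 * (x\<^sup>2 + x2) + z1 * w0 * x2)
        * \<bar>t - s\<bar> powr (\<eta> + \<gamma>)"
    using Lambda_bound[OF dl I rough_germ_extendable[OF I L b \<gamma> st(1)] _ st] by blast
  also have "\<dots> \<le> 1 / (2 powr (\<eta> + \<gamma>) - 2) * (m * (z0 + z1 + zR + zg) * (w0 + w1 + wR + wg)) * \<bar>t - s\<bar> powr (\<eta> + \<gamma>)"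
  proof (intro mult_right_mono mult_left_mono)
    have m: "1 \<le> m" "x\<^sup>2 + x2 \<le> m" by (auto simp: m_def)
    have "x2 \<le> m" using m(2) by (smt (verit) zero_le_power2)
    have "x \<le> m"
    proof (cases "x \<le> 1")
      case False
      then have "x \<le> x\<^sup>2" by (simp add: power2_eq_square)
      then show ?thesis using m x by linarith
    qed (use m in simp)
    note pos = Z(2-5) W(2-5)
    have "zR * wg \<le> m * (zR * wg)" using mult_right_mono[OF m(1), of "zR * wg"] pos by simp
    moreover have "z0 * x * wR \<le> m * (z0 * wR)"
      using mult_right_mono[OF \<open>x \<le> m\<close>, of "z0 * wR"] pos by (simp add: mult_ac)
    moreover have "z0 * w1 * (x\<^sup>2 + x2) \<le> m * (z0 * w1)"
      using mult_right_mono[OF m(2), of "z0 * w1"] pos by (simp add: mult_ac)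
    moreover have "z1 * w0 * x2 \<le> m * (z1 * w0)"
      using mult_right_mono[OF \<open>x2 \<le> m\<close>, of "z1 * w0"] pos by (simp add: mult_ac)
    ultimately have "zR * wg + z0 * x * wR + z0 * w1 * (x\<^sup>2 + x2) + z1 * w0 * x2
        \<le> m * (zR * wg + z0 * wR + z0 * w1 + z1 * w0)" by (simp add: distrib_left)
    also have "\<dots> \<le> m * ((z0 + z1 + zR + zg) * (w0 + w1 + wR + wg))"
    proof (rule mult_left_mono)
      have "0 \<le> z0 * w0 + z0 * wg + z1 * w1 + z1 * wR + z1 * wg + zR * w0 + zR * w1 + zR * wR
          + zg * w0 + zg * w1 + zg * wR + zg * wg"
        using pos by (intro add_nonneg_nonneg mult_nonneg_nonneg)
      then show "zR * wg + z0 * wR + z0 * w1 + z1 * w0 \<le> (z0 + z1 + zR + zg) * (w0 + w1 + wR + wg)"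
        by (simp add: algebra_simps)
    qed (use m in simp)
    finally show "zR * wg + z0 * x * wR + z0 * w1 * (x\<^sup>2 + x2) + z1 * w0 * x2
        \<le> m * (z0 + z1 + zR + zg) * (w0 + w1 + wR + wg)" by (simp add: mult.assoc)
    show "0 \<le> 1 / (2 powr (\<eta> + \<gamma>) - (2::real))" using dl powr_less_cancel_iff[of 2 1 "\<eta> + \<gamma>"] by simp
  qed simp
  also have "\<dots> = 1 / (2 powr (\<eta> + \<gamma>) - 2) * \<bar>t - s\<bar> powr (\<eta> + \<gamma>) * m
      * D_seminorm \<gamma> \<eta> I X (Z, Z') * D_seminorm \<gamma> \<eta> I X (W, W')"
    by (simp add: D_seminorm_def z0_def z1_def zR_def zg_def w0_def w1_def wR_def wg_def)
  finally show ?thesis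
    by (simp add: rough_integral_def rough_germ_def m_def x_def x2_def norm_minus_commute)
qed

lemma controlled_bound_cong:
  assumes "controlled_bound \<gamma> \<eta> I X p K"
    and "\<And>t. t \<in> I \<Longrightarrow> fst p t = fst q t" "\<And>t. t \<in> I \<Longrightarrow> snd p t = snd q t"
  shows "controlled_bound \<gamma> \<eta> I X q K"
  using assms by (simp add: controlled_bound_def path_bound_def remainder_def incr_def)

lemma controlled_pair_comb:
  assumes "0 < \<gamma>" "\<gamma> < \<eta>" "X \<in> C_hoelder \<gamma> I" "p \<in> controlled \<gamma> \<eta> I X" "q \<in> controlled \<gamma> \<eta> I X"
  shows "pair_comb c p q \<in> controlled \<gamma> \<eta> I X"
  using assms(4,5) controlled_bound_pair_comb controlled_iff_bound[OF assms(1-3)] by metis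

lemma integration_map_lincomb:
  assumes I: "is_interval I" and \<gamma>: "0 < \<gamma>" "\<gamma> < \<eta>" and dl: "1 < \<eta> + \<gamma>"
    and X: "rough_path_bound \<gamma> I X X2 L"
    and p: "controlled_bound \<gamma> \<eta> I X p K" "controlled_bound \<gamma> \<eta> I X p' K'"
    and q: "controlled_bound \<gamma> \<eta> I X q M" and t: "0 \<in> I" "t \<in> I"
  shows "fst (integration_map (\<eta> + \<gamma>) I X2 (pair_comb c p p') q) t =
        fst (pair_comb c (integration_map (\<eta> + \<gamma>) I X2 p q) (integration_map (\<eta> + \<gamma>) I X2 p' q)) t"
    and "snd (integration_map (\<eta> + \<gamma>) I X2 (pair_comb c p p') q) t =
        snd (pair_comb c (integration_map (\<eta> + \<gamma>) I X2 p q) (integration_map (\<eta> + \<gamma>) I X2 p' q)) t"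
    and "fst (integration_map (\<eta> + \<gamma>) I X2 q (pair_comb c p p')) t =
        fst (pair_comb c (integration_map (\<eta> + \<gamma>) I X2 q p) (integration_map (\<eta> + \<gamma>) I X2 q p')) t"
    and "snd (integration_map (\<eta> + \<gamma>) I X2 q (pair_comb c p p')) t =
        snd (pair_comb c (integration_map (\<eta> + \<gamma>) I X2 q p) (integration_map (\<eta> + \<gamma>) I X2 q p')) t"
  using rough_integral_lincomb[OF I \<gamma> dl X p q t]
  by (simp_all add: integration_map_def pair_comb_def tensor_simps vec_eq_iff)

text \<open>
  For a bilinear map \<open>\<Phi>\<close> the difference \<open>\<Phi> p' q' - \<Phi> p q\<close> is \<open>\<Phi> (p' - p) q' + \<Phi> p (q' - q)\<close>, and
  \<open>integration_map_bound\<close> applies to both terms.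
\<close>

lemma integration_map_continuous:
  assumes I: "is_interval I" "bounded I" "0 \<in> I" and \<gamma>: "0 < \<gamma>" "\<gamma> < \<eta>" and dl: "1 < \<eta> + \<gamma>"
    and XC: "X \<in> C_hoelder \<gamma> I" and X: "rough_path_bound \<gamma> I X X2 L"
    and p: "p \<in> controlled \<gamma> \<eta> I X" and q: "q \<in> controlled \<gamma> \<eta> I X" and \<epsilon>: "0 < \<epsilon>"
  shows "\<exists>d>0. \<forall>p'\<in>controlled \<gamma> \<eta> I X. \<forall>q'\<in>controlled \<gamma> \<eta> I X.
    D_dist \<gamma> \<eta> I X p p' < d \<and> D_dist \<gamma> \<eta> I X q q' < d \<longrightarrow>
    D_dist \<gamma> (min (2 * \<gamma>) \<eta>) I X (integration_map (\<eta> + \<gamma>) I X2 p q) (integration_map (\<eta> + \<gamma>) I X2 p' q') < \<epsilon>"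
proof -
  let ?\<Phi> = "integration_map (\<eta> + \<gamma>) I X2" and ?\<theta> = "min (2 * \<gamma>) \<eta>"
  obtain C where C: "0 \<le> C" "\<And>p q K M. controlled_bound \<gamma> \<eta> I X p K \<Longrightarrow> controlled_bound \<gamma> \<eta> I X q M \<Longrightarrow>
      controlled_bound \<gamma> ?\<theta> I X (?\<Phi> p q) (C * (K * M))"
    using integration_map_bound[OF I(1) \<gamma> dl X I(2,3)] by blast
  define K M where "K = sup_norm I (fst p) + D_seminorm \<gamma> \<eta> I X p"
    and "M = sup_norm I (fst q) + D_seminorm \<gamma> \<eta> I X q"
  have pK: "controlled_bound \<gamma> \<eta> I X p K" and qM: "controlled_bound \<gamma> \<eta> I X q M"
    using controlled_bound_norm[OF p] controlled_bound_norm[OF q] by (simp_all only: K_def M_def)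
  have pos: "0 \<le> K" "0 \<le> M" using pK qM by (auto simp: controlled_bound_def path_bound_def)
  \<comment> \<open>with \<open>d \<le> 1\<close>, the norm of \<open>q'\<close> is at most \<open>M + 1\<close>, and the distance of the images is at most \<open>5 * C * d * (M + 1 + K)\<close>; the last summand makes \<open>S\<close> positive and the final inequality strict\<close>
  define S where "S = 5 * C * (M + 1 + K) + 1"
  have S: "0 < S" using C(1) pos by (simp add: S_def add_nonneg_pos)
  define d where "d = min 1 (\<epsilon> / S)"
  have d: "0 < d" "d \<le> 1" "d * S \<le> \<epsilon>" using S \<epsilon> by (auto simp: d_def min_def field_simps)
  have "D_dist \<gamma> ?\<theta> I X (?\<Phi> p q) (?\<Phi> p' q') < \<epsilon>"
    if p': "p' \<in> controlled \<gamma> \<eta> I X" and q': "q' \<in> controlled \<gamma> \<eta> I X"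
      and small: "D_dist \<gamma> \<eta> I X p p' < d" "D_dist \<gamma> \<eta> I X q q' < d" for p' q'
  proof -
    define a b where "a = D_dist \<gamma> \<eta> I X p p'" and "b = D_dist \<gamma> \<eta> I X q q'"
    have dp: "controlled_bound \<gamma> \<eta> I X (pair_comb (-1) p p') a" and dq: "controlled_bound \<gamma> \<eta> I X (pair_comb (-1) q q') b"
      using controlled_bound_norm[OF controlled_pair_comb[OF \<gamma> XC p p']]
        controlled_bound_norm[OF controlled_pair_comb[OF \<gamma> XC q q']]
      by (simp_all only: a_def b_def D_dist_def)
    have ab: "0 \<le> a" "0 \<le> b" "a < d" "b < d"
      using dp dq small by (auto simp: controlled_bound_def path_bound_def a_def b_def)
    have "controlled_bound \<gamma> \<eta> I X (pair_comb 1 q (pair_comb (-1) q q')) (\<bar>1\<bar> * M + b)"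
      by (rule controlled_bound_pair_comb[OF qM dq])
    moreover have "pair_comb 1 q (pair_comb (-1) q q') = q'"
      by (simp add: pair_comb_def prod_eq_iff)
    ultimately have q'b: "controlled_bound \<gamma> \<eta> I X q' (M + b)" by simp
    have p'b: "\<exists>K'. controlled_bound \<gamma> \<eta> I X p' K'" using controlled_bound_norm[OF p'] by blast
    have sum: "controlled_bound \<gamma> ?\<theta> I X (pair_comb 1 (?\<Phi> (pair_comb (-1) p p') q') (?\<Phi> p (pair_comb (-1) q q')))
        (\<bar>1\<bar> * (C * (a * (M + b))) + C * (K * b))"
      by (intro controlled_bound_pair_comb C(2) dp dq pK q'b)
    obtain K' where K': "controlled_bound \<gamma> \<eta> I X p' K'" using p'b by blast
    note lin1 = integration_map_lincomb(1,2)[OF I(1) \<gamma> dl X pK K' q'b I(3), of _ "-1"]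
    note lin2 = integration_map_lincomb(3,4)[OF I(1) \<gamma> dl X qM q'b pK I(3), of _ "-1"]
    have "controlled_bound \<gamma> ?\<theta> I X (pair_comb (-1) (?\<Phi> p q) (?\<Phi> p' q')) (C * (a * (M + b)) + C * (K * b))"
      by (rule controlled_bound_cong[OF sum[simplified abs_one mult_1]])
         (simp_all add: pair_comb_def[of 1] lin1 lin2, simp_all add: pair_comb_def)
    then have "D_dist \<gamma> ?\<theta> I X (?\<Phi> p q) (?\<Phi> p' q') \<le> 5 * (C * (a * (M + b)) + C * (K * b))"
      unfolding D_dist_def by (rule norm_le_controlled_bound)
    also have "\<dots> \<le> 5 * (C * (d * (M + 1)) + C * (K * d))"
      using ab d C(1) pos by (intro mult_left_mono add_mono mult_mono) auto
    also have "\<dots> = d * S - d" by (simp add: S_def algebra_simps)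
    also have "\<dots> < \<epsilon>" using d by simp
    finally show ?thesis .
  qed
  then show ?thesis using d(1) by blast
qed

theorem theorem1:
  fixes I :: "real set" and \<gamma> \<eta> \<delta> :: real
    and X :: "real \<Rightarrow> real^'n" and X2 :: "real \<Rightarrow> real \<Rightarrow> real^'n^'n"
  assumes "is_interval I"
    and "\<gamma> > 0" and "\<eta> > \<gamma>" and "\<eta> + \<gamma> = \<delta>" and "\<delta> > 1"
    and "X \<in> C_hoelder \<gamma> I"
    and "X2 \<in> Omega_C_hoelder (2 * \<gamma>) I"
    and "\<forall>s\<in>I. \<forall>u\<in>I. \<forall>t\<in>I. N_op X2 s u t = tensor (incr X s u) (incr X u t)"
  shows
    \<comment> \<open>the integral is well defined\<close>
    "(\<forall>p\<in>controlled \<gamma> \<eta> I X. \<forall>q\<in>controlled \<gamma> \<eta> I X.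
        N_op (rough_germ X2 p q) \<in> Z2_space \<delta> I)
    \<and> \<comment> \<open>it extends the Young integral\<close>
     (\<forall>F\<in>C_hoelder \<eta> I. (F, \<lambda>_. 0 :: real^'n^'n) \<in> controlled \<gamma> \<eta> I X)
    \<and>
     (\<forall>Z Z' W W' \<rho> \<sigma>.
        (Z, Z') \<in> controlled \<gamma> \<eta> I X \<and> (W, W') \<in> controlled \<gamma> \<eta> I X \<and>
        0 < \<rho> \<and> 0 < \<sigma> \<and> \<rho> + \<sigma> > 1 \<and> Z \<in> C_hoelder \<rho> I \<and> W \<in> C_hoelder \<sigma> I \<and>
        ((\<forall>u\<in>I. Z' u = 0) \<or> (\<forall>u\<in>I. W' u = 0) \<or> 2 * \<gamma> > 1) \<longrightarrow>
        (\<forall>s\<in>I. \<forall>t\<in>I.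
           rough_integral \<delta> I X2 (Z, Z') (W, W') s t = young_integral \<rho> \<sigma> I Z W s t))
    \<and> \<comment> \<open>the bound\<close>
     (\<forall>Z Z' W W'. (Z, Z') \<in> controlled \<gamma> \<eta> I X \<and> (W, W') \<in> controlled \<gamma> \<eta> I X \<longrightarrow>
        (\<forall>s\<in>I. \<forall>t\<in>I.
           norm (rough_integral \<delta> I X2 (Z, Z') (W, W') s t - tensor (Z s) (incr W s t)
                 - contract2 (Z' s) (W' s) (X2 s t))
           \<le> 1 / (2 powr \<delta> - 2) * \<bar>t - s\<bar> powr \<delta>
               * max 1 ((path_norm \<gamma> I X)\<^sup>2 + Omega_norm (2 * \<gamma>) I X2)
               * D_seminorm \<gamma> \<eta> I X (Z, Z') * D_seminorm \<gamma> \<eta> I X (W, W')))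
    \<and> \<comment> \<open>continuity of the bilinear map\<close>
     (bounded I \<and> 0 \<in> I \<longrightarrow>
        (\<forall>p\<in>controlled \<gamma> \<eta> I X. \<forall>q\<in>controlled \<gamma> \<eta> I X.
           integration_map \<delta> I X2 p q \<in> controlled \<gamma> (min (2 * \<gamma>) \<eta>) I X)
      \<and> (\<forall>p\<in>controlled \<gamma> \<eta> I X. \<forall>p'\<in>controlled \<gamma> \<eta> I X. \<forall>q\<in>controlled \<gamma> \<eta> I X. \<forall>c. \<forall>t\<in>I.
           fst (integration_map \<delta> I X2 (pair_comb c p p') q) t =
             fst (pair_comb c (integration_map \<delta> I X2 p q) (integration_map \<delta> I X2 p' q)) t \<and>
           snd (integration_map \<delta> I X2 (pair_comb c p p') q) t =
             snd (pair_comb c (integration_map \<delta> I X2 p q) (integration_map \<delta> I X2 p' q)) t \<and>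
           fst (integration_map \<delta> I X2 q (pair_comb c p p')) t =
             fst (pair_comb c (integration_map \<delta> I X2 q p) (integration_map \<delta> I X2 q p')) t \<and>
           snd (integration_map \<delta> I X2 q (pair_comb c p p')) t =
             snd (pair_comb c (integration_map \<delta> I X2 q p) (integration_map \<delta> I X2 q p')) t)
      \<and> (\<forall>p\<in>controlled \<gamma> \<eta> I X. \<forall>q\<in>controlled \<gamma> \<eta> I X. \<forall>\<epsilon>>0. \<exists>d>0.
           \<forall>p'\<in>controlled \<gamma> \<eta> I X. \<forall>q'\<in>controlled \<gamma> \<eta> I X.
             D_dist \<gamma> \<eta> I X p p' < d \<and> D_dist \<gamma> \<eta> I X q q' < d \<longrightarrow>
             D_dist \<gamma> (min (2 * \<gamma>) \<eta>) I X
               (integration_map \<delta> I X2 p q) (integration_map \<delta> I X2 p' q') < \<epsilon>))"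
proof -
  have I: "is_interval I" and \<gamma>: "0 < \<gamma>" "\<gamma> < \<eta>" and \<delta>: "\<delta> = \<eta> + \<gamma>" and dl: "1 < \<eta> + \<gamma>"
    using assms(1-5) by auto
  note XC = assms(6) and X2C = assms(7) and chen = assms(8)
  obtain L where X: "rough_path_bound \<gamma> I X X2 L"
    using rough_path_bound_exists[OF \<gamma>(1) XC X2C chen] by blast
  have bound: "\<exists>K. controlled_bound \<gamma> \<eta> I X p K" if "p \<in> controlled \<gamma> \<eta> I X"
    for p :: "(real \<Rightarrow> real^'n) \<times> (real \<Rightarrow> real^'n^'n)"
    using controlled_bound_norm[OF that] by blast
  have \<theta>: "\<gamma> < min (2 * \<gamma>) \<eta>" using \<gamma> by simp
  have defined: "N_op (rough_germ X2 p q) \<in> Z2_space (\<eta> + \<gamma>) I"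
    if "p \<in> controlled \<gamma> \<eta> I X" "q \<in> controlled \<gamma> \<eta> I X" for p q
    using bound[OF that(1)] bound[OF that(2)] rough_germ_Z2[OF X _ _ \<gamma>] by blast
  have young: "rough_integral (\<eta> + \<gamma>) I X2 (Z, Z') (W, W') s t = young_integral \<rho> \<sigma> I Z W s t"
    if asm: "(Z, Z') \<in> controlled \<gamma> \<eta> I X" "(W, W') \<in> controlled \<gamma> \<eta> I X" "0 < \<rho>" "0 < \<sigma>" "\<rho> + \<sigma> > 1"
      "Z \<in> C_hoelder \<rho> I" "W \<in> C_hoelder \<sigma> I"
      "(\<forall>u\<in>I. Z' u = 0) \<or> (\<forall>u\<in>I. W' u = 0) \<or> 2 * \<gamma> > 1" "s \<in> I" "t \<in> I" for Z Z' W W' \<rho> \<sigma> s t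
  proof -
    obtain K M K' M' where "controlled_bound \<gamma> \<eta> I X (Z, Z') K" "controlled_bound \<gamma> \<eta> I X (W, W') M"
      "path_bound \<rho> I Z K'" "path_bound \<sigma> I W M'"
      using bound[OF asm(1)] bound[OF asm(2)] asm(6,7)
      unfolding C_hoelder_iff_path_bound[OF asm(3)] C_hoelder_iff_path_bound[OF asm(4)] by blast
    then show ?thesis by (rule rough_integral_eq_young[OF I \<gamma> dl X _ _ _ _ asm(3-5,8-10)])
  qed
  have maps_to: "integration_map (\<eta> + \<gamma>) I X2 p q \<in> controlled \<gamma> (min (2 * \<gamma>) \<eta>) I X"
    if "bounded I" "0 \<in> I" "p \<in> controlled \<gamma> \<eta> I X" "q \<in> controlled \<gamma> \<eta> I X" for p q
    using integration_map_bound[OF I \<gamma> dl X that(1,2)] bound[OF that(3)] bound[OF that(4)]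
    unfolding controlled_iff_bound[OF \<gamma>(1) \<theta> XC] by blast
  have linear: "fst (integration_map (\<eta> + \<gamma>) I X2 (pair_comb c p p') q) t =
        fst (pair_comb c (integration_map (\<eta> + \<gamma>) I X2 p q) (integration_map (\<eta> + \<gamma>) I X2 p' q)) t"
      "snd (integration_map (\<eta> + \<gamma>) I X2 (pair_comb c p p') q) t =
        snd (pair_comb c (integration_map (\<eta> + \<gamma>) I X2 p q) (integration_map (\<eta> + \<gamma>) I X2 p' q)) t"
      "fst (integration_map (\<eta> + \<gamma>) I X2 q (pair_comb c p p')) t =
        fst (pair_comb c (integration_map (\<eta> + \<gamma>) I X2 q p) (integration_map (\<eta> + \<gamma>) I X2 q p')) t"
      "snd (integration_map (\<eta> + \<gamma>) I X2 q (pair_comb c p p')) t =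
        snd (pair_comb c (integration_map (\<eta> + \<gamma>) I X2 q p) (integration_map (\<eta> + \<gamma>) I X2 q p')) t"
    if asm: "0 \<in> I" "p \<in> controlled \<gamma> \<eta> I X" "p' \<in> controlled \<gamma> \<eta> I X" "q \<in> controlled \<gamma> \<eta> I X" "t \<in> I"
    for p p' q c t
  proof -
    obtain K K' M where "controlled_bound \<gamma> \<eta> I X p K" "controlled_bound \<gamma> \<eta> I X p' K'" "controlled_bound \<gamma> \<eta> I X q M"
      using bound[OF asm(2)] bound[OF asm(3)] bound[OF asm(4)] by blast
    note lin = integration_map_lincomb[OF I \<gamma> dl X this asm(1,5), of c]
    show "fst (integration_map (\<eta> + \<gamma>) I X2 (pair_comb c p p') q) t =
        fst (pair_comb c (integration_map (\<eta> + \<gamma>) I X2 p q) (integration_map (\<eta> + \<gamma>) I X2 p' q)) t"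
      "snd (integration_map (\<eta> + \<gamma>) I X2 (pair_comb c p p') q) t =
        snd (pair_comb c (integration_map (\<eta> + \<gamma>) I X2 p q) (integration_map (\<eta> + \<gamma>) I X2 p' q)) t"
      "fst (integration_map (\<eta> + \<gamma>) I X2 q (pair_comb c p p')) t =
        fst (pair_comb c (integration_map (\<eta> + \<gamma>) I X2 q p) (integration_map (\<eta> + \<gamma>) I X2 q p')) t"
      "snd (integration_map (\<eta> + \<gamma>) I X2 q (pair_comb c p p')) t =
        snd (pair_comb c (integration_map (\<eta> + \<gamma>) I X2 q p) (integration_map (\<eta> + \<gamma>) I X2 q p')) t"
      by (fact lin)+
  qed
  show ?thesis
    unfolding \<delta>
  proof (intro conjI impI ballI allI, goal_cases)
    case (1 p q)
    then show ?case by (rule defined)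
  next
    case (2 F)
    then show ?case by (rule path_is_controlled[OF \<gamma> XC])
  next
    case (3 Z Z' W W' \<rho> \<sigma> s t)
    then show ?case by (elim conjE) (rule young)
  next
    case (4 Z Z' W W' s t)
    then show ?case by (elim conjE) (rule rough_integral_bound[OF I \<gamma> dl XC X2C chen])
  next
    case (5 p q)
    then show ?case by (elim conjE) (rule maps_to)
  next
    case (6 p p' q c t)
    then show ?case by (elim conjE) (rule linear)
  next
    case (7 p p' q c t)
    then show ?case by (elim conjE) (rule linear)
  next
    case (8 p p' q c t)
    then show ?case by (elim conjE) (rule linear)
  next
    case (9 p p' q c t)
    then show ?case by (elim conjE) (rule linear)
  next
    case (10 p q \<epsilon>)
    then show ?case by (elim conjE) (rule integration_map_continuous[OF I _ _ \<gamma> dl XC X])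
  qed
qed

end
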